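(* Let $L$ be a Dirac structure on $M$ compatible with $r\in\Omega^1(M,TM)$. Then each leaf $\mathcal{O}$ of $L$ is $r$-invariant, and its presymplectic form $\omega_{\mathcal{O}}$ is compatible with the restriction $r_{\mathcal{O}}=r|_{T\mathcal{O}}$. In particular, if $(M,L,r)$ is a Dirac-Nijenhuis manifold, then its leaves $(\mathcal{O},\omega_{\mathcal{O}},r_{\mathcal{O}})$ are presymplectic-Nijenhuis manifolds.
   Context: $\mathbb{T}M=TM\oplus T^*M$ carries the pairing $\langle(X,\alpha),(Y,\beta)\rangle=\beta(X)+\alpha(Y)$ and the Courant-Dorfman bracket $[\![(X,\alpha),(Y,\beta)]\!]=([X,Y],\mathcal{L}_X\beta-i_Yd\alpha)$. A Dirac structure is a subbundle $L\subset\mathbb{T}M$ with $L=L^\perp$ whose sections are closed under the bracket. For $r\in\Omega^1(M,TM)$, viewed as $r:TM\to TM$ with dual $r^*$, set $D^r_X(Y)=[Y,r(X)]-r([Y,X])$, $D^{r,*}_X(\alpha)=\mathcal{L}_X(r^*\alpha)-\mathcal{L}_{r(X)}\alpha$, $\mathbb{D}^r_X(Y,\alpha)=(D^r_X(Y),D^{r,*}_X(\alpha))$. $L$ and $r$ are compatible if $(r,r^* )(L)\subseteq L$ and $\mathbb{D}^r_X(\Gamma(L))\subseteq\Gamma(L)$ for all $X\in\mathfrak{X}(M)$. $r$ is Nijenhuis if $[r(X),r(Y)]-r([r(X),Y]+[X,r(Y)]-r[X,Y])=0$ for all $X,Y$. $(M,L,r)$ is a Dirac-Nijenhuis manifold if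 $L$ is Dirac, $r$ is Nijenhuis and they are compatible. The leaves of $L$ are the leaves $\mathcal{O}$ of the (singular) foliation of $M$ tangent to the distribution $\mathrm{pr}_{T}(L)\subseteq TM$; each carries a closed 2-form $\omega_{\mathcal{O}}$, its presymplectic form, defined by $\omega_{\mathcal{O}}(X,Y)=\alpha(Y)$ for $X,Y\in T\mathcal{O}$ and any $\alpha$ with $(X,\alpha)\in L$. A leaf is $r$-invariant if $r(T\mathcal{O})\subseteq T\mathcal{O}$. A 2-form $\omega$ and a $(1,1)$-tensor field $r$ on a manifold are compatible if $\omega(r(X),Y)=\omega(X,r(Y))$ for all $X,Y$ and $d(\omega_r)=(d\omega)_r$, where $i_X\omega_r=i_{r(X)}\omega$ and $i_X(d\omega)_r=i_{r(X)}d\omega$. The pair is presymplectic-Nijenhuis if it is compatible, $\omega$ is closed and $r$ is Nijenhuis. *)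

theory Defs
  imports "HOL-Analysis.Analysis"
begin

section \<open>Smooth functions on open subsets of Euclidean n-space\<close>

text \<open>
  Points of n-space are functions \<open>nat \<Rightarrow> real\<close> vanishing from index \<open>n\<close> on (the topological space
  \<open>Euclidean_space n\<close>). The dimension has to be a number and not a type: a leaf has its own
  dimension, varying from leaf to leaf and possibly zero.
\<close>

definition partial_deriv :: "nat \<Rightarrow> ((nat \<Rightarrow> real) \<Rightarrow> real) \<Rightarrow> (nat \<Rightarrow> real) \<Rightarrow> real" where
  "partial_deriv i f x = deriv (\<lambda>t. f (x(i := t))) (x i)"

primrec C_k_on :: "nat \<Rightarrow> nat \<Rightarrow> (nat \<Rightarrow> real) set \<Rightarrow> ((nat \<Rightarrow> real) \<Rightarrow> real) \<Rightarrow> bool" where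
  "C_k_on 0 n S f \<longleftrightarrow> continuous_on S f"
| "C_k_on (Suc k) n S f \<longleftrightarrow> continuous_on S f \<and>
     (\<forall>i<n. (\<forall>x\<in>S. (\<lambda>t. f (x(i := t))) differentiable (at (x i))) \<and>
            C_k_on k n S (partial_deriv i f))"

definition C_infinity_on :: "nat \<Rightarrow> (nat \<Rightarrow> real) set \<Rightarrow> ((nat \<Rightarrow> real) \<Rightarrow> real) \<Rightarrow> bool" where
  "C_infinity_on n S f \<longleftrightarrow> (\<forall>k. C_k_on k n S f)"


section \<open>Smooth manifolds\<close>

record 'a manifold =
  mtop :: "'a topology"
  mdim :: nat
  atlas :: "('a set \<times> ('a \<Rightarrow> nat \<Rightarrow> real)) set"

abbreviation points :: "'a manifold \<Rightarrow> 'a set" where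
  "points M \<equiv> topspace (mtop M)"

definition smooth_manifold :: "'a manifold \<Rightarrow> bool" where
  "smooth_manifold M \<longleftrightarrow>
     Hausdorff_space (mtop M) \<and> second_countable (mtop M) \<and>
     (\<Union>(U, \<phi>)\<in>atlas M. U) = points M \<and>
     (\<forall>(U, \<phi>)\<in>atlas M.
        openin (mtop M) U \<and>
        openin (Euclidean_space (mdim M)) (\<phi> ` U) \<and>
        homeomorphic_map (subtopology (mtop M) U)
          (subtopology (Euclidean_space (mdim M)) (\<phi> ` U)) \<phi>) \<and>
     (\<forall>(U, \<phi>)\<in>atlas M. \<forall>(V, \<psi>)\<in>atlas M. \<forall>i<mdim M.
        C_infinity_on (mdim M) (\<phi> ` (U \<inter> V)) (\<lambda>x. \<psi> (inv_into U \<phi> x) i))"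

definition smooth_on :: "'a manifold \<Rightarrow> 'a set \<Rightarrow> ('a \<Rightarrow> real) \<Rightarrow> bool" where
  "smooth_on M W f \<longleftrightarrow>
     (\<forall>(U, \<phi>)\<in>atlas M. C_infinity_on (mdim M) (\<phi> ` (U \<inter> W)) (\<lambda>x. f (inv_into U \<phi> x)))"

text \<open>
  Smooth functions are unrestricted outside \<open>points M\<close>. This is harmless: the Leibniz rule forces
  derivations to ignore those values (consider the product with the indicator function of the
  complement of \<open>points M\<close>, which is smooth on \<open>M\<close>).
\<close>

definition smooth_functions :: "'a manifold \<Rightarrow> ('a \<Rightarrow> real) set" where
  "smooth_functions M = {f. smooth_on M (points M) f}"

definition smooth_map :: "'a manifold \<Rightarrow> 'b manifold \<Rightarrow> ('a \<Rightarrow> 'b) \<Rightarrow> bool" where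
  "smooth_map M N F \<longleftrightarrow> continuous_map (mtop M) (mtop N) F \<and>
     (\<forall>(U, \<phi>)\<in>atlas M. \<forall>(V, \<psi>)\<in>atlas N. \<forall>i<mdim N.
        C_infinity_on (mdim M) (\<phi> ` (U \<inter> F -` V)) (\<lambda>x. \<psi> (F (inv_into U \<phi> x)) i))"


section \<open>Tangent and cotangent spaces, tensor fields\<close>

text \<open>
  Tangent vectors at \<open>p\<close> are derivations at \<open>p\<close> of the algebra of smooth functions, covectors are
  linear functionals on the tangent space. Both are set to zero off their domain, so that equality
  of (co)vectors is equality in HOL and the vector space operations are the pointwise ones.
\<close>

type_synonym 'a tvec = "('a \<Rightarrow> real) \<Rightarrow> real"
type_synonym 'a covec = "'a tvec \<Rightarrow> real"

definition tangent_space :: "'a manifold \<Rightarrow> 'a \<Rightarrow> 'a tvec set" where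
  "tangent_space M p = {v.
     (\<forall>f. f \<notin> smooth_functions M \<longrightarrow> v f = 0) \<and>
     (\<forall>f\<in>smooth_functions M. \<forall>g\<in>smooth_functions M. \<forall>a b.
        v (\<lambda>q. a * f q + b * g q) = a * v f + b * v g) \<and>
     (\<forall>f\<in>smooth_functions M. \<forall>g\<in>smooth_functions M.
        v (\<lambda>q. f q * g q) = f p * v g + g p * v f)}"

definition linear_on_tangent :: "'a manifold \<Rightarrow> 'a \<Rightarrow> ('a tvec \<Rightarrow> real) \<Rightarrow> bool" where
  "linear_on_tangent M p \<xi> \<longleftrightarrow>
     (\<forall>v\<in>tangent_space M p. \<forall>w\<in>tangent_space M p. \<forall>a b.
        \<xi> (\<lambda>f. a * v f + b * w f) = a * \<xi> v + b * \<xi> w)"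

definition cotangent_space :: "'a manifold \<Rightarrow> 'a \<Rightarrow> 'a covec set" where
  "cotangent_space M p =
     {\<xi>. (\<forall>v. v \<notin> tangent_space M p \<longrightarrow> \<xi> v = 0) \<and> linear_on_tangent M p \<xi>}"

definition differential :: "'a manifold \<Rightarrow> 'b manifold \<Rightarrow> ('a \<Rightarrow> 'b) \<Rightarrow> 'a tvec \<Rightarrow> 'b tvec" where
  "differential M N F v = (\<lambda>f. if f \<in> smooth_functions N then v (f \<circ> F) else 0)"

text \<open>The values of fields and forms outside the set on which they live are irrelevant.\<close>

definition vector_field_on :: "'a manifold \<Rightarrow> 'a set \<Rightarrow> ('a \<Rightarrow> 'a tvec) \<Rightarrow> bool" where
  "vector_field_on M W X \<longleftrightarrow>
     (\<forall>p\<in>W. X p \<in> tangent_space M p) \<and>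
     (\<forall>f\<in>smooth_functions M. smooth_on M W (\<lambda>p. X p f))"

definition vector_fields :: "'a manifold \<Rightarrow> ('a \<Rightarrow> 'a tvec) set" where
  "vector_fields M = {X. vector_field_on M (points M) X}"

definition one_form_on :: "'a manifold \<Rightarrow> 'a set \<Rightarrow> ('a \<Rightarrow> 'a covec) \<Rightarrow> bool" where
  "one_form_on M W \<alpha> \<longleftrightarrow>
     (\<forall>p\<in>W. \<alpha> p \<in> cotangent_space M p) \<and>
     (\<forall>X\<in>vector_fields M. smooth_on M W (\<lambda>p. \<alpha> p (X p)))"

definition one_forms :: "'a manifold \<Rightarrow> ('a \<Rightarrow> 'a covec) set" where
  "one_forms M = {\<alpha>. one_form_on M (points M) \<alpha>}"

definition two_forms :: "'a manifold \<Rightarrow> ('a \<Rightarrow> 'a tvec \<Rightarrow> 'a tvec \<Rightarrow> real) set" where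
  "two_forms M = {\<omega>.
     (\<forall>p\<in>points M. \<forall>v\<in>tangent_space M p.
        linear_on_tangent M p (\<lambda>w. \<omega> p v w) \<and> linear_on_tangent M p (\<lambda>w. \<omega> p w v) \<and>
        \<omega> p v v = 0) \<and>
     (\<forall>X\<in>vector_fields M. \<forall>Y\<in>vector_fields M. (\<lambda>p. \<omega> p (X p) (Y p)) \<in> smooth_functions M)}"

definition tensors11 :: "'a manifold \<Rightarrow> ('a \<Rightarrow> 'a tvec \<Rightarrow> 'a tvec) set" where
  "tensors11 M = {r.
     (\<forall>p\<in>points M. \<forall>v\<in>tangent_space M p. r p v \<in> tangent_space M p) \<and>
     (\<forall>p\<in>points M. \<forall>v\<in>tangent_space M p. \<forall>w\<in>tangent_space M p. \<forall>a b.
        r p (\<lambda>f. a * v f + b * w f) = (\<lambda>f. a * r p v f + b * r p w f)) \<and>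
     (\<forall>X\<in>vector_fields M. (\<lambda>p. r p (X p)) \<in> vector_fields M)}"

definition apply_tensor :: "('a \<Rightarrow> 'a tvec \<Rightarrow> 'a tvec) \<Rightarrow> ('a \<Rightarrow> 'a tvec) \<Rightarrow> 'a \<Rightarrow> 'a tvec" where
  "apply_tensor r X = (\<lambda>p. r p (X p))"

definition dual_map :: "'a manifold \<Rightarrow> ('a \<Rightarrow> 'a tvec \<Rightarrow> 'a tvec) \<Rightarrow> 'a \<Rightarrow> 'a covec \<Rightarrow> 'a covec" where
  "dual_map M r p \<xi> = (\<lambda>v. if v \<in> tangent_space M p then \<xi> (r p v) else 0)"

definition dual_form :: "'a manifold \<Rightarrow> ('a \<Rightarrow> 'a tvec \<Rightarrow> 'a tvec) \<Rightarrow> ('a \<Rightarrow> 'a covec) \<Rightarrow> 'a \<Rightarrow> 'a covec"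
  where "dual_form M r \<alpha> = (\<lambda>p. dual_map M r p (\<alpha> p))"


section \<open>Cartan calculus\<close>

definition lie_bracket ::
    "'a manifold \<Rightarrow> ('a \<Rightarrow> 'a tvec) \<Rightarrow> ('a \<Rightarrow> 'a tvec) \<Rightarrow> 'a \<Rightarrow> 'a tvec" where
  "lie_bracket M X Y = (\<lambda>p f. if f \<in> smooth_functions M
     then X p (\<lambda>q. Y q f) - Y p (\<lambda>q. X q f) else 0)"

text \<open>
  The exterior derivative and the Lie derivative are given by their invariant formulas on vector
  fields. If \<open>F\<close> is a functional on vector fields whose value \<open>F Z\<close> depends only on \<open>Z p\<close> (as
  tensoriality ensures in the uses below), then \<open>covector_at M p F\<close> is the covector at \<open>p\<close> that it
  induces: a tangent vector is extended to an arbitrary global vector field.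
\<close>

definition covector_at :: "'a manifold \<Rightarrow> 'a \<Rightarrow> (('a \<Rightarrow> 'a tvec) \<Rightarrow> real) \<Rightarrow> 'a covec" where
  "covector_at M p F = (\<lambda>v. if v \<in> tangent_space M p
     then F (SOME Z. Z \<in> vector_fields M \<and> Z p = v) else 0)"

definition d_one_form ::
    "'a manifold \<Rightarrow> ('a \<Rightarrow> 'a covec) \<Rightarrow> ('a \<Rightarrow> 'a tvec) \<Rightarrow> ('a \<Rightarrow> 'a tvec) \<Rightarrow> 'a \<Rightarrow> real" where
  "d_one_form M \<alpha> X Y = (\<lambda>p.
     X p (\<lambda>q. \<alpha> q (Y q)) - Y p (\<lambda>q. \<alpha> q (X q)) - \<alpha> p (lie_bracket M X Y p))"

definition contract_d_one_form ::
    "'a manifold \<Rightarrow> ('a \<Rightarrow> 'a tvec) \<Rightarrow> ('a \<Rightarrow> 'a covec) \<Rightarrow> 'a \<Rightarrow> 'a covec" where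
  "contract_d_one_form M Y \<alpha> = (\<lambda>p. covector_at M p (\<lambda>Z. d_one_form M \<alpha> Y Z p))"

definition lie_derivative ::
    "'a manifold \<Rightarrow> ('a \<Rightarrow> 'a tvec) \<Rightarrow> ('a \<Rightarrow> 'a covec) \<Rightarrow> 'a \<Rightarrow> 'a covec" where
  "lie_derivative M X \<beta> = (\<lambda>p. covector_at M p
     (\<lambda>Z. X p (\<lambda>q. \<beta> q (Z q)) - \<beta> p (lie_bracket M X Z p)))"

definition d_two_form ::
    "'a manifold \<Rightarrow> ('a \<Rightarrow> 'a tvec \<Rightarrow> 'a tvec \<Rightarrow> real) \<Rightarrow>
     ('a \<Rightarrow> 'a tvec) \<Rightarrow> ('a \<Rightarrow> 'a tvec) \<Rightarrow> ('a \<Rightarrow> 'a tvec) \<Rightarrow> 'a \<Rightarrow> real" where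
  "d_two_form M \<omega> X Y Z = (\<lambda>p.
     X p (\<lambda>q. \<omega> q (Y q) (Z q)) - Y p (\<lambda>q. \<omega> q (X q) (Z q)) + Z p (\<lambda>q. \<omega> q (X q) (Y q))
     - \<omega> p (lie_bracket M X Y p) (Z p) + \<omega> p (lie_bracket M X Z p) (Y p)
     - \<omega> p (lie_bracket M Y Z p) (X p))"


section \<open>Dirac structures\<close>

type_synonym 'a subset_TM = "'a \<Rightarrow> ('a tvec \<times> 'a covec) set"

definition smooth_subbundle :: "'a manifold \<Rightarrow> 'a subset_TM \<Rightarrow> bool" where
  "smooth_subbundle M L \<longleftrightarrow> (\<exists>k. \<forall>p\<in>points M. \<exists>U. openin (mtop M) U \<and> p \<in> U \<and>
     (\<exists>X \<alpha>. (\<forall>i<k. vector_field_on M U (X i) \<and> one_form_on M U (\<alpha> i)) \<and>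
       (\<forall>q\<in>U.
          L q = {(\<lambda>f. \<Sum>i<k. c i * X i q f, \<lambda>v. \<Sum>i<k. c i * \<alpha> i q v) | c :: nat \<Rightarrow> real. True} \<and>
          (\<forall>c :: nat \<Rightarrow> real.
             (\<forall>f. (\<Sum>i<k. c i * X i q f) = 0) \<and> (\<forall>v. (\<Sum>i<k. c i * \<alpha> i q v) = 0)
             \<longrightarrow> (\<forall>i<k. c i = 0)))))"

definition orthogonal_TM :: "'a manifold \<Rightarrow> 'a subset_TM \<Rightarrow> 'a subset_TM" where
  "orthogonal_TM M L p = {(v, \<xi>). v \<in> tangent_space M p \<and> \<xi> \<in> cotangent_space M p \<and>
     (\<forall>(w, \<eta>)\<in>L p. \<eta> v + \<xi> w = 0)}"

definition sections :: "'a manifold \<Rightarrow> 'a subset_TM \<Rightarrow> (('a \<Rightarrow> 'a tvec) \<times> ('a \<Rightarrow> 'a covec)) set" where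
  "sections M L = {(X, \<alpha>). X \<in> vector_fields M \<and> \<alpha> \<in> one_forms M \<and>
     (\<forall>p\<in>points M. (X p, \<alpha> p) \<in> L p)}"

fun courant_dorfman ::
    "'a manifold \<Rightarrow> ('a \<Rightarrow> 'a tvec) \<times> ('a \<Rightarrow> 'a covec) \<Rightarrow> ('a \<Rightarrow> 'a tvec) \<times> ('a \<Rightarrow> 'a covec) \<Rightarrow>
     ('a \<Rightarrow> 'a tvec) \<times> ('a \<Rightarrow> 'a covec)" where
  "courant_dorfman M (X, \<alpha>) (Y, \<beta>) =
     (lie_bracket M X Y,
      \<lambda>p v. lie_derivative M X \<beta> p v - contract_d_one_form M Y \<alpha> p v)"

definition dirac_structure :: "'a manifold \<Rightarrow> 'a subset_TM \<Rightarrow> bool" where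
  "dirac_structure M L \<longleftrightarrow> smooth_subbundle M L \<and>
     (\<forall>p\<in>points M. L p = orthogonal_TM M L p) \<and>
     (\<forall>s\<in>sections M L. \<forall>t\<in>sections M L. courant_dorfman M s t \<in> sections M L)"


section \<open>Compatibility with a (1,1)-tensor field, Nijenhuis tensors\<close>

definition D_vec :: "'a manifold \<Rightarrow> ('a \<Rightarrow> 'a tvec \<Rightarrow> 'a tvec) \<Rightarrow>
    ('a \<Rightarrow> 'a tvec) \<Rightarrow> ('a \<Rightarrow> 'a tvec) \<Rightarrow> 'a \<Rightarrow> 'a tvec" where
  "D_vec M r X Y = (\<lambda>p f.
     lie_bracket M Y (apply_tensor r X) p f - r p (lie_bracket M Y X p) f)"

definition D_form :: "'a manifold \<Rightarrow> ('a \<Rightarrow> 'a tvec \<Rightarrow> 'a tvec) \<Rightarrow>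
    ('a \<Rightarrow> 'a tvec) \<Rightarrow> ('a \<Rightarrow> 'a covec) \<Rightarrow> 'a \<Rightarrow> 'a covec" where
  "D_form M r X \<alpha> = (\<lambda>p v.
     lie_derivative M X (dual_form M r \<alpha>) p v - lie_derivative M (apply_tensor r X) \<alpha> p v)"

definition compatible_TM :: "'a manifold \<Rightarrow> 'a subset_TM \<Rightarrow> ('a \<Rightarrow> 'a tvec \<Rightarrow> 'a tvec) \<Rightarrow> bool" where
  "compatible_TM M L r \<longleftrightarrow>
     (\<forall>p\<in>points M. \<forall>(v, \<xi>)\<in>L p. (r p v, dual_map M r p \<xi>) \<in> L p) \<and>
     (\<forall>X\<in>vector_fields M. \<forall>(Y, \<alpha>)\<in>sections M L. (D_vec M r X Y, D_form M r X \<alpha>) \<in> sections M L)"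

definition nijenhuis :: "'a manifold \<Rightarrow> ('a \<Rightarrow> 'a tvec \<Rightarrow> 'a tvec) \<Rightarrow> bool" where
  "nijenhuis M r \<longleftrightarrow> (\<forall>X\<in>vector_fields M. \<forall>Y\<in>vector_fields M. \<forall>p\<in>points M. \<forall>f.
     lie_bracket M (apply_tensor r X) (apply_tensor r Y) p f
     - r p (\<lambda>g. lie_bracket M (apply_tensor r X) Y p g + lie_bracket M X (apply_tensor r Y) p g
                - r p (lie_bracket M X Y p) g) f = 0)"

definition dirac_nijenhuis :: "'a manifold \<Rightarrow> 'a subset_TM \<Rightarrow> ('a \<Rightarrow> 'a tvec \<Rightarrow> 'a tvec) \<Rightarrow> bool" where
  "dirac_nijenhuis M L r \<longleftrightarrow>
     dirac_structure M L \<and> r \<in> tensors11 M \<and> nijenhuis M r \<and> compatible_TM M L r"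

definition compatible_form ::
    "'a manifold \<Rightarrow> ('a \<Rightarrow> 'a tvec \<Rightarrow> 'a tvec \<Rightarrow> real) \<Rightarrow> ('a \<Rightarrow> 'a tvec \<Rightarrow> 'a tvec) \<Rightarrow> bool" where
  "compatible_form N \<omega> r \<longleftrightarrow>
     \<omega> \<in> two_forms N \<and> r \<in> tensors11 N \<and>
     (\<forall>p\<in>points N. \<forall>v\<in>tangent_space N p. \<forall>w\<in>tangent_space N p. \<omega> p (r p v) w = \<omega> p v (r p w)) \<and>
     (\<forall>X\<in>vector_fields N. \<forall>Y\<in>vector_fields N. \<forall>Z\<in>vector_fields N. \<forall>p\<in>points N.
        d_two_form N (\<lambda>q v w. \<omega> q (r q v) w) X Y Z p = d_two_form N \<omega> (apply_tensor r X) Y Z p)"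

definition closed_two_form :: "'a manifold \<Rightarrow> ('a \<Rightarrow> 'a tvec \<Rightarrow> 'a tvec \<Rightarrow> real) \<Rightarrow> bool" where
  "closed_two_form N \<omega> \<longleftrightarrow>
     (\<forall>X\<in>vector_fields N. \<forall>Y\<in>vector_fields N. \<forall>Z\<in>vector_fields N. \<forall>p\<in>points N.
        d_two_form N \<omega> X Y Z p = 0)"

definition presymplectic_nijenhuis ::
    "'a manifold \<Rightarrow> ('a \<Rightarrow> 'a tvec \<Rightarrow> 'a tvec \<Rightarrow> real) \<Rightarrow> ('a \<Rightarrow> 'a tvec \<Rightarrow> 'a tvec) \<Rightarrow> bool" where
  "presymplectic_nijenhuis N \<omega> r \<longleftrightarrow>
     smooth_manifold N \<and> compatible_form N \<omega> r \<and> closed_two_form N \<omega> \<and> nijenhuis N r"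


section \<open>Leaves\<close>

text \<open>
  An immersed submanifold is a subset of \<open>points M\<close> with its own topology (in general finer than the
  subspace topology), dimension and atlas, such that the inclusion is an immersion. Its tangent
  vectors are derivations of its own algebra of smooth functions, hence the explicit differential of
  the inclusion below.
\<close>

definition push :: "'a manifold \<Rightarrow> 'a manifold \<Rightarrow> 'a tvec \<Rightarrow> 'a tvec" where
  "push N M = differential N M (\<lambda>p. p)"

definition immersed_submanifold :: "'a manifold \<Rightarrow> 'a manifold \<Rightarrow> bool" where
  "immersed_submanifold M N \<longleftrightarrow>
     smooth_manifold N \<and> points N \<subseteq> points M \<and> smooth_map N M (\<lambda>p. p) \<and>
     (\<forall>p\<in>points N. inj_on (push N M) (tangent_space N p))"

definition integral_manifold :: "'a manifold \<Rightarrow> 'a subset_TM \<Rightarrow> 'a manifold \<Rightarrow> bool" where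
  "integral_manifold M L N \<longleftrightarrow>
     immersed_submanifold M N \<and> connected_space (mtop N) \<and> points N \<noteq> {} \<and>
     (\<forall>p\<in>points N. push N M ` tangent_space N p = fst ` L p)"

definition leaf :: "'a manifold \<Rightarrow> 'a subset_TM \<Rightarrow> 'a manifold \<Rightarrow> bool" where
  "leaf M L N \<longleftrightarrow> integral_manifold M L N \<and>
     (\<forall>N'. integral_manifold M L N' \<and> points N \<subseteq> points N' \<longrightarrow> points N' = points N)"

text \<open>Any covector \<open>\<xi>\<close> with \<open>(v, \<xi>) \<in> L p\<close> gives the same value, as \<open>L\<close> is isotropic.\<close>

definition presymplectic_form ::
    "'a manifold \<Rightarrow> 'a subset_TM \<Rightarrow> 'a manifold \<Rightarrow> 'a \<Rightarrow> 'a tvec \<Rightarrow> 'a tvec \<Rightarrow> real" where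
  "presymplectic_form M L N p v w = (SOME \<xi>. (push N M v, \<xi>) \<in> L p) (push N M w)"

definition leaf_invariant ::
    "'a manifold \<Rightarrow> 'a manifold \<Rightarrow> ('a \<Rightarrow> 'a tvec \<Rightarrow> 'a tvec) \<Rightarrow> bool" where
  "leaf_invariant M N r \<longleftrightarrow>
     (\<forall>p\<in>points N. r p ` (push N M ` tangent_space N p) \<subseteq> push N M ` tangent_space N p)"

text \<open>The restriction of \<open>r\<close> to the tangent bundle of an \<open>r\<close>-invariant immersed submanifold.\<close>

definition restrict_tensor ::
    "'a manifold \<Rightarrow> 'a manifold \<Rightarrow> ('a \<Rightarrow> 'a tvec \<Rightarrow> 'a tvec) \<Rightarrow> 'a \<Rightarrow> 'a tvec \<Rightarrow> 'a tvec" where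
  "restrict_tensor M N r p v = inv_into (tangent_space N p) (push N M) (r p (push N M v))"

end

theory Submission
  imports Defs "HOL-Real_Asymp.Real_Asymp"
begin

text \<open>
  The restriction of \<open>r\<close> to a leaf and the pointwise symmetry of \<open>\<omega>\<close> with respect to it are linear
  algebra. For the exterior derivatives, take sections \<open>(A, \<alpha>)\<close>, \<open>(B, \<beta>)\<close>, \<open>(C, \<gamma>)\<close> of \<open>L\<close>. The fields
  \<open>A\<close>, \<open>B\<close>, \<open>C\<close> are tangent to the leaf, and Cartan's formula turns \<open>d\<omega>(A, B, C)\<close> into the pairing of the
  Courant-Dorfman bracket of the first two sections with the third, and \<open>d\<omega>\<^sub>r(A, B, C) - d\<omega>(r A, B, C)\<close>
  into the pairing of \<open>(D_vec M r A B, D_form M r A \<beta>)\<close> with \<open>(C, \<gamma>)\<close>. Both vanish because \<open>L\<close> is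
  isotropic. Every vector tangent to the leaf is the value of a section of \<open>L\<close>, and all expressions
  involved (including the Nijenhuis torsion) are tensorial, so it suffices to treat sections.
\<close>

section \<open>Differential calculus in n-space\<close>

text \<open>A leaf has its own smooth structure, and its tangent vectors are derivations of its own
  functions; the immersion enters only through the injectivity of \<open>push\<close>. Without slice
  charts, the smoothness on the leaf of lifted fields, of \<omega> and of the restricted tensor
  cannot be read off their pointwise definitions. In each case the functions in question solve an
  overdetermined linear system with smooth coefficients and smooth right-hand sides that is
  injective at the point considered, and elimination over germs makes the solution smooth. The
  analysis in n-space serves two other needs. Sections, vector fields and test functions are global
  while charts and frames of \<open>L\<close> are local, which calls for bump functions and hence
  for a flat smooth function. And a derivation has to be determined by its values on coordinates,
  which yields local frames; this is Hadamard's lemma, and with it differentiation under the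
  integral.\<close>

lemma openin_Euclidean_space_iff:
  "openin (Euclidean_space n) S \<longleftrightarrow> (\<exists>T. open T \<and> S = T \<inter> {x. \<forall>i\<ge>n. x i = 0})"
  by (auto simp: Euclidean_space_def openin_subtopology euclidean_product_topology)

text \<open>Boxes around a point of \<open>Euclidean_space n\<close> form a neighbourhood basis
  there. They are stable under moving one coordinate within its range and, for such a centre, under
  passing to segments from it, which is what partial derivatives and Hadamard's formula
  need.\<close>

definition coord_box :: "nat \<Rightarrow> (nat \<Rightarrow> real) \<Rightarrow> real \<Rightarrow> (nat \<Rightarrow> real) set" where
  "coord_box n a e = {x. (\<forall>i<n. \<bar>x i - a i\<bar> < e) \<and> (\<forall>i\<ge>n. x i = 0)}"

lemma openin_coord_box: "openin (Euclidean_space n) (coord_box n a e)"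
proof -
  have "open (\<Inter>i\<in>{..<n}. {x :: nat \<Rightarrow> real. \<bar>x i - a i\<bar> < e})"
    by (intro open_INT ballI open_Collect_less continuous_intros finite_lessThan
        continuous_on_product_coordinates)
  moreover have "coord_box n a e
      = (\<Inter>i\<in>{..<n}. {x. \<bar>x i - a i\<bar> < e}) \<inter> {x. \<forall>i\<ge>n. x i = 0}"
    by (auto simp: coord_box_def)
  ultimately show ?thesis
    unfolding openin_Euclidean_space_iff by blast
qed

lemma open_contains_coord_box:
  assumes "openin (Euclidean_space n) S" "a \<in> S"
  obtains e where "e > 0" "coord_box n a e \<subseteq> S"
proof -
  obtain T where T: "open T" "S = T \<inter> {x. \<forall>i\<ge>n. x i = 0}"
    using assms(1) openin_Euclidean_space_iff by blast
  then obtain X where X: "a \<in> Pi\<^sub>E UNIV X" "\<And>i. open (X i)" "Pi\<^sub>E UNIV X \<subseteq> T"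
    using product_topology_open_contains_basis[of "\<lambda>i. euclidean" UNIV T a] assms(2)
    by (auto simp: open_fun_def)
  have "\<exists>d>0. ball (a i) d \<subseteq> X i" for i
    using X(1) X(2)[of i] by (meson PiE_mem UNIV_I open_contains_ball)
  then obtain d where d: "\<And>i. d i > 0" "\<And>i. ball (a i) (d i) \<subseteq> X i"
    by metis
  \<comment> \<open>The \<open>1\<close> keeps the minimum meaningful for \<open>n = 0\<close>.
    Indices from \<open>n\<close> on need no radius: there both points are \<open>0\<close>.\<close>
  define e where "e = Min (insert 1 (d ` {..<n}))"
  have "e > 0"
    unfolding e_def using d(1) by (subst Min_gr_iff) auto
  moreover have "coord_box n a e \<subseteq> S"
  proof
    fix x assume x: "x \<in> coord_box n a e"
    have "x i \<in> X i" for i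
    proof (cases "i < n")
      case True
      then have "e \<le> d i"
        unfolding e_def by (intro Min_le) auto
      moreover have "\<bar>x i - a i\<bar> < e"
        using x True by (simp add: coord_box_def)
      ultimately have "x i \<in> ball (a i) (d i)"
        by (simp add: dist_real_def)
      then show ?thesis
        using d(2) by blast
    next
      case False
      then have "x i = a i"
        using x assms(2) T(2) by (simp add: coord_box_def)
      then show ?thesis
        using X(1) by (simp add: PiE_iff)
    qed
    then show "x \<in> S"
      using X(3) T(2) x by (auto simp: coord_box_def)
  qed
  ultimately show ?thesis
    using that by blast
qed

lemma continuous_on_coord_box:
  fixes g :: "(nat \<Rightarrow> real) \<Rightarrow> real"
  assumes "openin (Euclidean_space n) S" "continuous_on S g" "a \<in> S" "r > 0"
  obtains e where "e > 0" "coord_box n a e \<subseteq> S" "\<And>y. y \<in> coord_box n a e \<Longrightarrow> \<bar>g y - g a\<bar> < r"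
proof -
  obtain T where T: "open T" "S = T \<inter> {x. \<forall>i\<ge>n. x i = 0}"
    using assms(1) openin_Euclidean_space_iff by blast
  obtain A where A: "open A" "A \<inter> S = g -` ball (g a) r \<inter> S"
    using assms(2) open_ball[of "g a" r] unfolding continuous_on_open_invariant by meson
  have "openin (Euclidean_space n) (A \<inter> S)"
    unfolding openin_Euclidean_space_iff using A(1) T by (intro exI[of _ "A \<inter> T"]) auto
  moreover have "a \<in> A \<inter> S"
    using A assms by auto
  ultimately obtain e where e: "e > 0" "coord_box n a e \<subseteq> A \<inter> S"
    using open_contains_coord_box by blast
  show ?thesis
  proof (rule that)
    show "\<bar>g y - g a\<bar> < r" if "y \<in> coord_box n a e" for y
    proof -
      have "y \<in> g -` ball (g a) r"
        using that e A by blast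
      then show ?thesis
        by (simp add: dist_real_def abs_minus_commute)
    qed
  qed (use e in auto)
qed

text \<open>\<open>partial_deriv\<close> looks at a function along a whole line of the function
  type. This lemma is why its values off an open \<open>S\<close> do not matter: a short piece of
  every coordinate line through a point of \<open>S\<close> stays in \<open>S\<close>.\<close>

lemma eventually_line_in_open:
  assumes "openin (Euclidean_space n) S" "x \<in> S" "i < n"
  shows "\<forall>\<^sub>F t in nhds (x i). x(i := t) \<in> S"
proof -
  obtain e where e: "e > 0" "coord_box n x e \<subseteq> S"
    using open_contains_coord_box assms by blast
  have "x(i := t) \<in> coord_box n x e" if "\<bar>t - x i\<bar> < e" for t
    using that e assms by (auto simp: coord_box_def openin_Euclidean_space_iff)
  then show ?thesis
    using e unfolding eventually_nhds_metric dist_real_def by blast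
qed

section \<open>Closure properties of C^k functions in coordinates\<close>

lemma partial_deriv_eqI:
  "((\<lambda>t. f (x(i := t))) has_real_derivative d) (at (x i)) \<Longrightarrow> partial_deriv i f x = d"
  unfolding partial_deriv_def by (rule DERIV_imp_deriv)

lemma C_k_on_imp_continuous: "C_k_on k n S f \<Longrightarrow> continuous_on S f"
  by (cases k) auto

lemma DERIV_partial_deriv:
  assumes "C_k_on (Suc k) n S f" "i < n" "x(i := s) \<in> S"
  shows "((\<lambda>t. f (x(i := t))) has_real_derivative partial_deriv i f (x(i := s))) (at s)"
proof -
  have "(\<lambda>t. f ((x(i := s))(i := t))) differentiable (at ((x(i := s)) i))"
    using assms unfolding C_k_on.simps by blast
  then show ?thesis
    by (auto simp: partial_deriv_def simp flip: DERIV_deriv_iff_real_differentiable)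
qed

lemma DERIV_partial_deriv_at:
  assumes "C_k_on (Suc k) n S f" "i < n" "x \<in> S"
  shows "((\<lambda>t. f (x(i := t))) has_real_derivative partial_deriv i f x) (at (x i))"
  using DERIV_partial_deriv[of k n S f i x "x i"] assms by simp

lemma partial_deriv_cong:
  assumes "openin (Euclidean_space n) S" "\<And>x. x \<in> S \<Longrightarrow> f x = g x" "x \<in> S" "i < n"
  shows "partial_deriv i f x = partial_deriv i g x"
proof -
  have "\<forall>\<^sub>F t in nhds (x i). f (x(i := t)) = g (x(i := t))"
    using eventually_line_in_open[OF assms(1,3,4)] by eventually_elim (rule assms(2))
  then show ?thesis
    unfolding partial_deriv_def by (intro deriv_cong_ev refl)
qed

lemma C_k_on_cong:
  assumes "openin (Euclidean_space n) S" "\<And>x. x \<in> S \<Longrightarrow> f x = g x"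
  shows "C_k_on k n S f \<longleftrightarrow> C_k_on k n S g"
  using assms(2)
proof (induction k arbitrary: f g)
  case 0
  then show ?case
    by (simp cong: continuous_on_cong)
next
  case (Suc k)
  have "(\<lambda>t. f (x(i := t))) differentiable (at (x i)) \<longleftrightarrow>
      (\<lambda>t. g (x(i := t))) differentiable (at (x i))" if "x \<in> S" "i < n" for i x
  proof -
    have "\<forall>\<^sub>F t in nhds (x i). f (x(i := t)) = g (x(i := t))"
      using eventually_line_in_open[OF assms(1) that] by eventually_elim (rule Suc.prems)
    then show ?thesis
      unfolding real_differentiable_def using DERIV_cong_ev[OF refl _ refl] by metis
  qed
  moreover have "C_k_on k n S (partial_deriv i f) \<longleftrightarrow> C_k_on k n S (partial_deriv i g)" if "i < n" for i
    using partial_deriv_cong[OF assms(1) Suc.prems _ that] by (intro Suc.IH) auto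
  ultimately show ?case
    using Suc.prems by (simp cong: continuous_on_cong)
qed

text \<open>Any functions \<open>f'\<close> that compute the partial derivatives on \<open>S\<close>
  may stand for \<open>partial_deriv\<close>. Each closure property below then amounts to a
  derivative formula and an induction on \<open>k\<close>.\<close>

lemma C_k_on_SucI:
  assumes "openin (Euclidean_space n) S" "continuous_on S f"
    and "\<And>i x. i < n \<Longrightarrow> x \<in> S \<Longrightarrow>
      ((\<lambda>t. f (x(i := t))) has_real_derivative f' i x) (at (x i))"
    and "\<And>i. i < n \<Longrightarrow> C_k_on k n S (f' i)"
  shows "C_k_on (Suc k) n S f"
proof -
  have "C_k_on k n S (partial_deriv i f)" if "i < n" for i
  proof -
    have "partial_deriv i f x = f' i x" if "x \<in> S" for x
      using assms(3)[OF \<open>i < n\<close> that] by (rule partial_deriv_eqI)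
    then show ?thesis
      using assms(4)[OF that] C_k_on_cong[OF assms(1)] by metis
  qed
  then show ?thesis
    using assms(2,3) real_differentiable_def by auto
qed

lemma C_k_on_mono: "C_k_on k n S f \<Longrightarrow> T \<subseteq> S \<Longrightarrow> C_k_on k n T f"
proof (induction k arbitrary: f)
  case 0
  then show ?case
    by (auto intro: continuous_on_subset)
next
  case (Suc k)
  then show ?case
    unfolding C_k_on.simps by (meson continuous_on_subset subsetD)
qed

lemma C_k_on_SucD: "C_k_on (Suc k) n S f \<Longrightarrow> C_k_on k n S f"
proof (induction k arbitrary: f)
  case (Suc k)
  then show ?case
    unfolding C_k_on.simps(2)[of "Suc k"] C_k_on.simps(2)[of k] by blast
qed simp

lemma C_k_on_local:
  assumes "\<And>x. x \<in> S \<Longrightarrow> \<exists>T. openin (Euclidean_space n) T \<and> x \<in> T \<and> C_k_on k n T f"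
  shows "C_k_on k n S f"
proof -
  have S: "S \<subseteq> {x. \<forall>i\<ge>n. x i = 0}"
    using assms unfolding openin_Euclidean_space_iff by blast
  have cont: "continuous_on S f"
    if loc: "\<And>x. x \<in> S \<Longrightarrow> \<exists>T. openin (Euclidean_space n) T \<and> x \<in> T \<and> continuous_on T f"
    for f :: "(nat \<Rightarrow> real) \<Rightarrow> real"
    unfolding continuous_on_eq_continuous_within
  proof
    fix x assume "x \<in> S"
    then obtain T where T: "openin (Euclidean_space n) T" "x \<in> T" "continuous_on T f"
      using loc by blast
    then obtain A where *: "open A" "T = A \<inter> {x. \<forall>i\<ge>n. x i = 0}"
      unfolding openin_Euclidean_space_iff by blast
    have "(f \<longlongrightarrow> f x) (at x within T)"
      using T unfolding continuous_on_def by blast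
    \<comment> \<open>\<open>S\<close> lies in n-space, so the ambient open set \<open>A\<close>
      already cuts it down into \<open>T\<close>, although \<open>S\<close> itself may fail to be
      open.\<close>
    moreover have "S \<inter> A \<subseteq> T"
      using * S by auto
    ultimately have "(f \<longlongrightarrow> f x) (at x within (S \<inter> A))"
      by (rule tendsto_within_subset)
    then show "continuous (at x within S) f"
      using * T at_within_nhd[of x A S "S \<inter> A"] by (auto simp: continuous_within)
  qed
  show ?thesis
    using assms
  proof (induction k arbitrary: f)
    case 0
    then show ?case
      using cont by simp
  next
    case (Suc k)
    have "continuous_on S f"
      by (rule cont) (use Suc.prems in \<open>force\<close>)
    moreover have "(\<lambda>t. f (x(i := t))) differentiable (at (x i))" if "x \<in> S" "i < n" for i x
      using Suc.prems[OF that(1)] that(2) by auto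
    moreover have "C_k_on k n S (partial_deriv i f)" if "i < n" for i
      by (rule Suc.IH) (use Suc.prems that in force)
    ultimately show ?case
      by simp
  qed
qed

lemma C_k_on_const:
  assumes "openin (Euclidean_space n) S"
  shows "C_k_on k n S (\<lambda>x. c)"
proof (induction k arbitrary: c)
  case (Suc k)
  show ?case
    by (rule C_k_on_SucI[OF assms, where f' = "\<lambda>i x. 0"]) (auto intro: Suc.IH)
qed simp

lemma C_k_on_coord:
  assumes "openin (Euclidean_space n) S"
  shows "C_k_on k n S (\<lambda>x. x j)"
proof (cases k)
  case 0
  then show ?thesis
    by (auto intro: continuous_on_product_coordinates continuous_on_subset)
next
  case (Suc k')
  show ?thesis
    unfolding Suc
  proof (rule C_k_on_SucI[OF assms, where f' = "\<lambda>i x. if j = i then 1 else 0"])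
    show "continuous_on S (\<lambda>x. x j)"
      by (auto intro: continuous_on_product_coordinates continuous_on_subset)
  qed (auto intro: C_k_on_const[OF assms])
qed

lemma C_k_on_add:
  assumes "openin (Euclidean_space n) S" "C_k_on k n S f" "C_k_on k n S g"
  shows "C_k_on k n S (\<lambda>x. f x + g x)"
  using assms(2,3)
proof (induction k arbitrary: f g)
  case (Suc k)
  show ?case
  proof (rule C_k_on_SucI[OF assms(1), where f' = "\<lambda>i x. partial_deriv i f x + partial_deriv i g x"])
    show "continuous_on S (\<lambda>x. f x + g x)"
      by (intro continuous_on_add Suc.prems[THEN C_k_on_imp_continuous])
    show "C_k_on k n S (\<lambda>x. partial_deriv i f x + partial_deriv i g x)" if "i < n" for i
      using Suc.prems that by (intro Suc.IH) auto
    show "((\<lambda>t. f (x(i := t)) + g (x(i := t))) has_real_derivative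
        partial_deriv i f x + partial_deriv i g x) (at (x i))" if "i < n" "x \<in> S" for i x
      by (intro DERIV_add DERIV_partial_deriv_at[OF Suc.prems(1) that]
          DERIV_partial_deriv_at[OF Suc.prems(2) that])
  qed
qed (auto intro: continuous_on_add)

lemma DERIV_partial_deriv_mult:
  assumes "C_k_on (Suc k) n S f" "C_k_on (Suc k) n S g" "i < n" "x \<in> S"
  shows "((\<lambda>t. f (x(i := t)) * g (x(i := t))) has_real_derivative
      partial_deriv i f x * g x + partial_deriv i g x * f x) (at (x i))"
  using DERIV_mult[OF DERIV_partial_deriv_at[OF assms(1,3,4)] DERIV_partial_deriv_at[OF assms(2-4)]]
  by simp

lemma C_k_on_mult:
  assumes "openin (Euclidean_space n) S" "C_k_on k n S f" "C_k_on k n S g"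
  shows "C_k_on k n S (\<lambda>x. f x * g x)"
  using assms(2,3)
proof (induction k arbitrary: f g)
  case (Suc k)
  show ?case
  proof (rule C_k_on_SucI[OF assms(1), where
        f' = "\<lambda>i x. partial_deriv i f x * g x + partial_deriv i g x * f x"])
    show "continuous_on S (\<lambda>x. f x * g x)"
      by (intro continuous_on_mult Suc.prems[THEN C_k_on_imp_continuous])
    show "C_k_on k n S (\<lambda>x. partial_deriv i f x * g x + partial_deriv i g x * f x)" if "i < n" for i
      using Suc.prems that by (intro C_k_on_add Suc.IH assms(1) Suc.prems[THEN C_k_on_SucD]) auto
  qed (rule DERIV_partial_deriv_mult[OF Suc.prems])
qed (auto intro: continuous_on_mult)

lemma C_k_on_sum:
  assumes "openin (Euclidean_space n) S" "\<And>j. j \<in> J \<Longrightarrow> C_k_on k n S (f j)"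
  shows "C_k_on k n S (\<lambda>x. \<Sum>j\<in>J. f j x)"
  using assms(2)
  by (induction J rule: infinite_finite_induct)
    (auto intro!: C_k_on_const C_k_on_add assms(1))

lemma C_k_on_prod:
  assumes "openin (Euclidean_space n) S" "\<And>j. j \<in> J \<Longrightarrow> C_k_on k n S (f j)"
  shows "C_k_on k n S (\<lambda>x. \<Prod>j\<in>J. f j x)"
  using assms(2)
  by (induction J rule: infinite_finite_induct)
    (auto intro!: C_k_on_const C_k_on_mult assms(1))

lemma C_k_on_inverse:
  assumes "openin (Euclidean_space n) S" "C_k_on k n S f" "\<And>x. x \<in> S \<Longrightarrow> f x \<noteq> 0"
  shows "C_k_on k n S (\<lambda>x. inverse (f x))"
  using assms(2)
proof (induction k)
  case 0
  then show ?case
    using assms(3) by (auto intro: continuous_on_inverse)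
next
  case (Suc k)
  show ?case
  proof (rule C_k_on_SucI[OF assms(1), where
        f' = "\<lambda>i x. (- 1) * (inverse (f x) * partial_deriv i f x * inverse (f x))"])
    show "continuous_on S (\<lambda>x. inverse (f x))"
      using assms(3) by (intro continuous_on_inverse Suc.prems[THEN C_k_on_imp_continuous]) auto
    show "C_k_on k n S (\<lambda>x. (- 1) * (inverse (f x) * partial_deriv i f x * inverse (f x)))"
      if "i < n" for i
      using Suc.prems that
      by (intro C_k_on_mult C_k_on_const Suc.IH assms(1) Suc.prems[THEN C_k_on_SucD]) auto
    show "((\<lambda>t. inverse (f (x(i := t)))) has_real_derivative
        (- 1) * (inverse (f x) * partial_deriv i f x * inverse (f x))) (at (x i))"
      if "i < n" "x \<in> S" for i x
      using DERIV_inverse'[OF DERIV_partial_deriv_at[OF Suc.prems that]] assms(3)[OF that(2)]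
      by (simp add: fun_upd_def)
  qed
qed

text \<open>
  Unlike \<open>exp (- 1 / t)\<close> alone, the functions \<open>exp (- 1 / t) / t ^ m\<close> span a space closed under
  differentiation, so one induction on the order of differentiability settles all of them.
\<close>

definition exp_flat :: "nat \<Rightarrow> real \<Rightarrow> real" where
  "exp_flat m t = (if t > 0 then exp (- 1 / t) / t ^ m else 0)"

lemma DERIV_exp_flat:
  "(exp_flat m has_real_derivative exp_flat (m + 2) t - real m * exp_flat (m + 1) t) (at t)"
proof (cases t "0 :: real" rule: linorder_cases)
  case less
  have "((\<lambda>t. 0) has_real_derivative 0) (at t)"
    by simp
  moreover have "\<forall>\<^sub>F s in nhds t. 0 = exp_flat m s"
    using less by (auto simp: exp_flat_def eventually_nhds intro!: exI[of _ "{..<0}"])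
  ultimately show ?thesis
    using less DERIV_cong_ev[of t t "\<lambda>t. 0" "exp_flat m" 0 0] by (auto simp: exp_flat_def)
next
  case equal
  have "((\<lambda>s. exp_flat m s / s) \<longlongrightarrow> 0) (at 0)"
  proof (subst filterlim_at_split, intro conjI)
    have "((\<lambda>s::real. 0) \<longlongrightarrow> 0) (at_left 0)"
      by simp
    then show "((\<lambda>s. exp_flat m s / s) \<longlongrightarrow> 0) (at_left 0)"
      by (rule Lim_transform_eventually)
        (auto simp: exp_flat_def eventually_at_left[of "-1"] intro!: exI[of _ "-1"])
    \<comment> \<open>To the right of \<open>0\<close> the difference quotient is again of the flat
      shape, with exponent \<open>m + 1\<close>; the exponential beats every power.\<close>
    have "((\<lambda>s::real. exp (- 1 / s) / s ^ m / s) \<longlongrightarrow> 0) (at_right 0)"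
      by real_asymp
    then show "((\<lambda>s. exp_flat m s / s) \<longlongrightarrow> 0) (at_right 0)"
      by (rule Lim_transform_eventually)
        (auto simp: exp_flat_def eventually_at_right[of _ 1] intro!: exI[of _ 1])
  qed
  then show ?thesis
    using equal by (simp add: has_field_derivative_iff exp_flat_def)
next
  case greater
  have "((\<lambda>s. exp (- 1 / s) * inverse (s ^ m)) has_real_derivative
      exp (- 1 / t) * (1 / t\<^sup>2) * inverse (t ^ m)
      + (- (inverse (t ^ m) * (real m * t ^ (m - 1)) * inverse (t ^ m))) * exp (- 1 / t)) (at t)"
    using greater by (auto intro!: derivative_eq_intros simp: power2_eq_square field_simps)
  moreover have "exp (- 1 / t) * (1 / t\<^sup>2) * inverse (t ^ m)
      + (- (inverse (t ^ m) * (real m * t ^ (m - 1)) * inverse (t ^ m))) * exp (- 1 / t)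
      = exp_flat (m + 2) t - real m * exp_flat (m + 1) t"
    using greater by (cases m) (auto simp: exp_flat_def field_simps power2_eq_square)
  moreover have "\<forall>\<^sub>F s in nhds t. exp (- 1 / s) * inverse (s ^ m) = exp_flat m s"
    using greater by (auto simp: exp_flat_def eventually_nhds field_simps intro!: exI[of _ "{0<..}"])
  ultimately show ?thesis
    using DERIV_cong_ev[of t t "\<lambda>s. exp (- 1 / s) * inverse (s ^ m)" "exp_flat m"] by auto
qed

lemma C_k_on_exp_flat:
  assumes "openin (Euclidean_space n) S" "C_k_on k n S f"
  shows "C_k_on k n S (\<lambda>x. exp_flat m (f x))"
proof -
  have cont: "continuous_on S (\<lambda>x. exp_flat m (f x))" if "continuous_on S f" for m
    by (rule continuous_on_compose2[OF _ that, of UNIV])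
      (auto intro: DERIV_isCont DERIV_exp_flat continuous_at_imp_continuous_on)
  show ?thesis
    using assms(2)
  proof (induction k arbitrary: m)
    case 0
    then show ?case
      using cont by simp
  next
    case (Suc k)
    show ?case
    proof (rule C_k_on_SucI[OF assms(1), where f' = "\<lambda>i x.
          (exp_flat (m + 2) (f x) + (- real m) * exp_flat (m + 1) (f x)) * partial_deriv i f x"])
      show "continuous_on S (\<lambda>x. exp_flat m (f x))"
        by (intro cont Suc.prems[THEN C_k_on_imp_continuous])
      show "C_k_on k n S (\<lambda>x.
          (exp_flat (m + 2) (f x) + (- real m) * exp_flat (m + 1) (f x)) * partial_deriv i f x)"
        if "i < n" for i
        using Suc.prems that
        by (intro C_k_on_mult C_k_on_add C_k_on_const Suc.IH assms(1) Suc.prems[THEN C_k_on_SucD]) auto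
      show "((\<lambda>t. exp_flat m (f (x(i := t)))) has_real_derivative
          (exp_flat (m + 2) (f x) + (- real m) * exp_flat (m + 1) (f x)) * partial_deriv i f x) (at (x i))"
        if "i < n" "x \<in> S" for i x
        using DERIV_chain2[OF DERIV_exp_flat DERIV_partial_deriv_at[OF Suc.prems that]]
        by (simp add: fun_upd_def)
    qed
qed
qed

section \<open>Plateau functions and bumps on boxes\<close>

definition plateau :: "real \<Rightarrow> real" where
  "plateau t = exp_flat 0 t * inverse (exp_flat 0 t + exp_flat 0 (1 - t))"

lemma plateau_eq_0: "t \<le> 0 \<Longrightarrow> plateau t = 0"
  by (simp add: plateau_def exp_flat_def)

lemma plateau_eq_1: "t \<ge> 1 \<Longrightarrow> plateau t = 1"
  by (simp add: plateau_def exp_flat_def)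

lemma C_k_on_plateau:
  assumes "openin (Euclidean_space n) S" "C_k_on k n S f"
  shows "C_k_on k n S (\<lambda>x. plateau (f x))"
proof -
  \<comment> \<open>One of \<open>t\<close> and \<open>1 - t\<close> is positive, so one summand is
    positive while the other is nonnegative.\<close>
  have "exp_flat 0 t + exp_flat 0 (1 - t) \<noteq> 0" for t
    by (smt (verit) exp_flat_def div_by_1 exp_gt_zero power_0)
  moreover have "C_k_on k n S (\<lambda>x. exp_flat 0 (1 + (- 1) * f x))"
    by (intro C_k_on_exp_flat C_k_on_add C_k_on_mult C_k_on_const assms)
  then have "C_k_on k n S (\<lambda>x. exp_flat 0 (1 - f x))"
    by simp
  ultimately show ?thesis
    unfolding plateau_def
    by (intro C_k_on_mult[OF assms(1) C_k_on_exp_flat[OF assms]] C_k_on_inverse[OF assms(1)]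
        C_k_on_add[OF assms(1) C_k_on_exp_flat[OF assms]])
qed

text \<open>With \<open>s\<close> the offset in one coordinate, the argument of
  \<open>plateau\<close> is 2 - 2 s^2 / e^2: it is at most \<open>0\<close> once s reaches e in
  absolute value, and at least 3/2 up to e / 2. Squaring avoids the non-smooth absolute value, and
  sums in place of differences match the shape of \<open>C_k_on_add\<close> and
  \<open>C_k_on_mult\<close>.\<close>

definition box_bump :: "nat \<Rightarrow> (nat \<Rightarrow> real) \<Rightarrow> real \<Rightarrow> (nat \<Rightarrow> real) \<Rightarrow> real" where
  "box_bump n a e x = (\<Prod>i<n. plateau (2 + (- 2 / e\<^sup>2) * ((x i + (- a i)) * (x i + (- a i)))))"

lemma C_k_on_box_bump:
  "openin (Euclidean_space n) S \<Longrightarrow> C_k_on k n S (box_bump n a e)"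
  unfolding box_bump_def
  by (intro C_k_on_prod C_k_on_plateau C_k_on_add C_k_on_mult C_k_on_const C_k_on_coord)

lemma box_bump_eq_1:
  assumes "e > 0" "x \<in> coord_box n a (e / 2)"
  shows "box_bump n a e x = 1"
proof -
  have "plateau (2 + (- 2 / e\<^sup>2) * ((x i + (- a i)) * (x i + (- a i)))) = 1" if "i < n" for i
  proof (rule plateau_eq_1)
    have "\<bar>x i - a i\<bar> \<le> e / 2"
      using assms that by (auto simp: coord_box_def less_imp_le)
    then have "\<bar>x i - a i\<bar>\<^sup>2 \<le> (e / 2)\<^sup>2"
      by (intro power_mono) auto
    then have "(x i + (- a i)) * (x i + (- a i)) \<le> e\<^sup>2 / 4"
      by (simp add: power2_eq_square)
    then have "2 * ((x i + (- a i)) * (x i + (- a i))) \<le> e\<^sup>2"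
      using zero_le_power2[of e] by linarith
    then show "1 \<le> 2 + (- 2 / e\<^sup>2) * ((x i + (- a i)) * (x i + (- a i)))"
      using assms(1) by (simp add: field_simps)
  qed
  then show ?thesis
    unfolding box_bump_def by simp
qed

lemma box_bump_eq_0:
  assumes "e > 0" "i < n" "\<bar>x i - a i\<bar> \<ge> e"
  shows "box_bump n a e x = 0"
proof -
  have "e\<^sup>2 \<le> \<bar>x i - a i\<bar>\<^sup>2"
    using assms by (intro power_mono) auto
  then have "e\<^sup>2 \<le> (x i + (- a i)) * (x i + (- a i))"
    by (simp add: power2_eq_square)
  then have "2 + (- 2 / e\<^sup>2) * ((x i + (- a i)) * (x i + (- a i))) \<le> 0"
    using assms(1) by (simp add: field_simps)
  then show ?thesis
    unfolding box_bump_def using assms(2) by (auto intro!: plateau_eq_0)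
qed

section \<open>The chain rule and composition of C^k maps\<close>

lemma chain_rule:
  fixes g :: "(nat \<Rightarrow> real) \<Rightarrow> real" and \<gamma> :: "real \<Rightarrow> nat \<Rightarrow> real"
  assumes S: "openin (Euclidean_space n) S" and g: "C_k_on (Suc 0) n S g" and t0: "\<gamma> t0 \<in> S"
    and \<gamma>: "\<And>j. j < n \<Longrightarrow> ((\<lambda>t. \<gamma> t j) has_real_derivative d j) (at t0)"
    and \<gamma>0: "\<forall>\<^sub>F t in at t0. \<forall>j\<ge>n. \<gamma> t j = 0"
  shows "((\<lambda>t. g (\<gamma> t)) has_real_derivative (\<Sum>j<n. partial_deriv j g (\<gamma> t0) * d j)) (at t0)"
proof -
  define a where "a = \<gamma> t0"
  have a: "a \<in> S" "\<And>i. i \<ge> n \<Longrightarrow> a i = 0"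
    using t0 S by (auto simp: a_def openin_Euclidean_space_iff)
  \<comment> \<open>\<open>w j y\<close> takes its first \<open>j\<close> coordinates from
    \<open>y\<close> and the others from \<open>a\<close>. Going from \<open>a\<close> to
    \<open>y\<close> through these points changes one coordinate at a time, so
    \<open>g y - g a\<close> telescopes into one-variable increments.\<close>
  define w where "w = (\<lambda>j (y :: nat \<Rightarrow> real) i. if i < j then y i else a i)"
  \<comment> \<open>The default value makes \<open>q j y * (y j - a j)\<close> the right increment
    also when coordinate \<open>j\<close> does not move, and makes \<open>q j\<close> tend to the
    partial derivative at \<open>a\<close>. Elsewhere the mean value theorem turns the quotient into
    a partial derivative at a point of a small box, where continuity of the partial derivatives
    applies.\<close>
  define q where "q = (\<lambda>j y. if y j = a j then partial_deriv j g a
    else (g (w (Suc j) y) - g (w j y)) / (y j - a j))"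
  have w_Suc: "w (Suc j) y = (w j y)(j := y j)" for j y
    by (auto simp: w_def)
  have telescope: "g y - g a = (\<Sum>j<n. q j y * (y j - a j))" if "\<forall>i\<ge>n. y i = 0" for y
  proof -
    have "w n y = y" "w 0 y = a"
      using that a(2) by (auto simp: w_def)
    then have "g y - g a = (\<Sum>j<n. g (w (Suc j) y) - g (w j y))"
      using sum_lessThan_telescope[of "\<lambda>j. g (w j y)" n] by simp
    also have "\<dots> = (\<Sum>j<n. q j y * (y j - a j))"
    proof (intro sum.cong refl)
      fix j
      have "y j = a j \<Longrightarrow> w (Suc j) y = w j y"
        by (auto simp: w_def less_Suc_eq)
      then show "g (w (Suc j) y) - g (w j y) = q j y * (y j - a j)"
        by (auto simp: q_def)
    qed
    finally show ?thesis .
  qed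
  have q_lim: "((\<lambda>t. q j (\<gamma> t)) \<longlongrightarrow> partial_deriv j g a) (at t0)" if j: "j < n" for j
    unfolding tendsto_iff
  proof (intro allI impI)
    fix r :: real assume "r > 0"
    have "continuous_on S (partial_deriv j g)"
      using g j by simp
    then obtain e where e: "e > 0" "coord_box n a e \<subseteq> S"
      "\<And>y. y \<in> coord_box n a e \<Longrightarrow> \<bar>partial_deriv j g y - partial_deriv j g a\<bar> < r"
      using continuous_on_coord_box[OF S _ a(1) \<open>r > 0\<close>] by metis
    have "\<forall>\<^sub>F t in at t0. \<bar>\<gamma> t i - a i\<bar> < e" if "i < n" for i
    proof -
      have "((\<lambda>t. \<gamma> t i) \<longlongrightarrow> a i) (at t0)"
        using DERIV_isCont[OF \<gamma>[OF that]] by (simp add: isCont_def a_def)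
      then show ?thesis
        using e(1) by (simp add: tendsto_iff dist_real_def)
    qed
    then have "\<forall>\<^sub>F t in at t0. \<forall>i\<in>{..<n}. \<bar>\<gamma> t i - a i\<bar> < e"
      by (intro eventually_ball_finite) auto
    then show "\<forall>\<^sub>F t in at t0. dist (q j (\<gamma> t)) (partial_deriv j g a) < r"
    proof eventually_elim
      case (elim t)
      define z where "z = w j (\<gamma> t)"
      have box: "z(j := s) \<in> coord_box n a e" if "\<bar>s - a j\<bar> < e" for s
        using elim that a(2) j e(1) by (auto simp: z_def w_def coord_box_def)
      have deriv: "((\<lambda>s. g (z(j := s))) has_real_derivative partial_deriv j g (z(j := s))) (at s)"
        if "\<bar>s - a j\<bar> < e" for s
        using DERIV_partial_deriv[OF g j] box[OF that] e(2) by blast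
      have z: "z(j := a j) = z"
        by (auto simp: z_def w_def)
      have t: "\<bar>\<gamma> t j - a j\<bar> < e"
        using elim j by auto
      have "\<exists>s. \<bar>s - a j\<bar> < e \<and> q j (\<gamma> t) = partial_deriv j g (z(j := s))" if "\<gamma> t j \<noteq> a j"
      proof (cases "\<gamma> t j < a j")
        case True
        obtain s where s: "\<gamma> t j < s" "s < a j" "g (z(j := a j)) - g (z(j := \<gamma> t j))
            = (a j - \<gamma> t j) * partial_deriv j g (z(j := s))"
          using MVT2[OF True, of "\<lambda>s. g (z(j := s))" "\<lambda>s. partial_deriv j g (z(j := s))"] deriv t
          by (smt (verit))
        then have "q j (\<gamma> t) = partial_deriv j g (z(j := s))"
          using that z by (simp add: q_def w_Suc z_def[symmetric] field_simps)
        then show ?thesis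
          using s t by (intro exI[of _ s]) auto
      next
        case False
        then have "a j < \<gamma> t j"
          using that by simp
        then obtain s where s: "a j < s" "s < \<gamma> t j" "g (z(j := \<gamma> t j)) - g (z(j := a j))
            = (\<gamma> t j - a j) * partial_deriv j g (z(j := s))"
          using MVT2[of "a j" "\<gamma> t j" "\<lambda>s. g (z(j := s))" "\<lambda>s. partial_deriv j g (z(j := s))"]
            deriv t by (smt (verit))
        then have "q j (\<gamma> t) = partial_deriv j g (z(j := s))"
          using that z by (simp add: q_def w_Suc z_def[symmetric] field_simps)
        then show ?thesis
          using s t by (intro exI[of _ s]) auto
      qed
      then show ?case
        using e(3) box \<open>r > 0\<close> by (cases "\<gamma> t j = a j") (auto simp: q_def dist_real_def)
    qed
  qed
  have "((\<lambda>t. \<Sum>j<n. q j (\<gamma> t) * ((\<gamma> t j - a j) / (t - t0)))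
      \<longlongrightarrow> (\<Sum>j<n. partial_deriv j g a * d j)) (at t0)"
    using \<gamma> q_lim by (intro tendsto_sum tendsto_mult) (auto simp: has_field_derivative_iff a_def)
  moreover have "\<forall>\<^sub>F t in at t0. (\<Sum>j<n. q j (\<gamma> t) * ((\<gamma> t j - a j) / (t - t0)))
      = (g (\<gamma> t) - g (\<gamma> t0)) / (t - t0)"
    using \<gamma>0
  proof eventually_elim
    case (elim t)
    then show ?case
      using telescope[of "\<gamma> t"] by (simp add: a_def sum_divide_distrib)
  qed
  ultimately show ?thesis
    unfolding has_field_derivative_iff a_def by (rule Lim_transform_eventually)
qed

text \<open>The induction generalises only \<open>g\<close>: after one differentiation its partial
  derivatives composed with \<open>F\<close> fall under the induction hypothesis, while the partial
  derivatives of the components of \<open>F\<close> are of the lower class outright.\<close>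

lemma C_k_on_compose:
  assumes T: "openin (Euclidean_space n) T" and S: "openin (Euclidean_space m) S"
    and FT: "F ` S \<subseteq> T" and F: "\<And>j. j < n \<Longrightarrow> C_k_on k m S (\<lambda>x. F x j)"
    and g: "C_k_on k n T g"
  shows "C_k_on k m S (\<lambda>x. g (F x))"
proof -
  have F0: "F x j = 0" if "x \<in> S" "j \<ge> n" for x j
    using FT T that by (auto simp: openin_Euclidean_space_iff)
  have cont: "continuous_on S (\<lambda>x. g (F x))"
    if "\<And>j. j < n \<Longrightarrow> continuous_on S (\<lambda>x. F x j)" "continuous_on T g"
    for g :: "(nat \<Rightarrow> real) \<Rightarrow> real"
  proof (rule continuous_on_compose2[OF that(2) _ FT])
    have "continuous_on S (\<lambda>x. F x j)" for j
    proof (cases "j < n")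
      case False
      then show ?thesis
        using F0 by (simp cong: continuous_on_cong)
    qed (rule that(1))
    then show "continuous_on S F"
      by (rule continuous_on_coordinatewise_then_product)
  qed
  show ?thesis
    using F g
  proof (induction k arbitrary: g)
    case 0
    then show ?case
      using cont by simp
  next
    case (Suc k)
    show ?case
    proof (rule C_k_on_SucI[OF S, where
          f' = "\<lambda>i x. \<Sum>j<n. partial_deriv j g (F x) * partial_deriv i (\<lambda>x. F x j) x"])
      show "continuous_on S (\<lambda>x. g (F x))"
        by (rule cont[OF Suc.prems[THEN C_k_on_imp_continuous]])
      show "C_k_on k m S (\<lambda>x. \<Sum>j<n. partial_deriv j g (F x) * partial_deriv i (\<lambda>x. F x j) x)"
        if i: "i < m" for i
      proof (rule C_k_on_sum[OF S], rule C_k_on_mult[OF S])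
        fix j assume j: "j \<in> {..<n}"
        show "C_k_on k m S (\<lambda>x. partial_deriv j g (F x))"
        proof (rule Suc.IH)
          show "C_k_on k m S (\<lambda>x. F x j)" if "j < n" for j
            using Suc.prems(1)[OF that] by (rule C_k_on_SucD)
          show "C_k_on k n T (partial_deriv j g)"
            using Suc.prems(2) j by simp
        qed
        show "C_k_on k m S (\<lambda>x. partial_deriv i (\<lambda>x. F x j) x)"
          using Suc.prems(1)[of j] i j by simp
      qed
      fix i x assume i: "i < m" "x \<in> S"
      have "C_k_on (Suc 0) n T g"
        using Suc.prems(2) by (auto dest: C_k_on_imp_continuous)
      moreover have "\<forall>\<^sub>F t in at (x i). \<forall>j\<ge>n. F (x(i := t)) j = 0"
        using eventually_line_in_open[OF S i(2,1)] F0 unfolding eventually_at_filter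
        by (auto elim: eventually_mono)
      ultimately show "((\<lambda>t. g (F (x(i := t)))) has_real_derivative
          (\<Sum>j<n. partial_deriv j g (F x) * partial_deriv i (\<lambda>x. F x j) x)) (at (x i))"
        using chain_rule[OF T, of g "\<lambda>t. F (x(i := t))" "x i"
            "\<lambda>j. partial_deriv i (\<lambda>x. F x j) x"] FT i DERIV_partial_deriv_at[OF Suc.prems(1) i]
        by auto
    qed
  qed
qed

lemma C_infinity_on_k: "C_infinity_on n S f \<Longrightarrow> C_k_on k n S f"
  by (simp add: C_infinity_on_def)

lemma C_infinity_on_partial: "C_infinity_on n S f \<Longrightarrow> i < n \<Longrightarrow> C_infinity_on n S (partial_deriv i f)"
  unfolding C_infinity_on_def by (metis C_k_on.simps(2))

section \<open>Integrals over segments and Hadamard's lemma\<close>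

abbreviation segment_point :: "(nat \<Rightarrow> real) \<Rightarrow> (nat \<Rightarrow> real) \<Rightarrow> real \<Rightarrow> nat \<Rightarrow> real" where
  "segment_point a x t \<equiv> (\<lambda>i. a i + t * (x i - a i))"

lemma segment_point_in_coord_box:
  assumes "x \<in> coord_box n a e" "\<And>i. i \<ge> n \<Longrightarrow> a i = 0" "t \<in> {0..1}"
  shows "segment_point a x t \<in> coord_box n a e"
proof -
  have "\<bar>t * (x i - a i)\<bar> < e" if "i < n" for i
  proof -
    have "\<bar>t\<bar> * \<bar>x i - a i\<bar> \<le> 1 * \<bar>x i - a i\<bar>"
      using assms(3) by (intro mult_right_mono) auto
    also have "\<dots> < e"
      using assms(1) that by (simp add: coord_box_def)
    finally show ?thesis
      by (simp add: abs_mult)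
  qed
  then show ?thesis
    using assms by (simp add: coord_box_def)
qed

lemma continuous_on_segment:
  fixes h :: "(nat \<Rightarrow> real) \<Rightarrow> real"
  assumes a: "\<And>i. i \<ge> n \<Longrightarrow> a i = 0" and h: "continuous_on (coord_box n a e) h"
  shows "continuous_on (coord_box n a e \<times> {0..1}) (\<lambda>(x, t). t ^ l * h (segment_point a x t))"
proof -
  have "continuous_on (coord_box n a e \<times> {0..1}) (\<lambda>p. segment_point a (fst p) (snd p))"
    by (intro continuous_intros continuous_on_coordinatewise_then_product
        continuous_on_compose2[OF continuous_on_product_coordinates]) auto
  then have "continuous_on (coord_box n a e \<times> {0..1}) (\<lambda>p. h (segment_point a (fst p) (snd p)))"
    by (rule continuous_on_compose2[OF h]) (auto intro: segment_point_in_coord_box a)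
  then have "continuous_on (coord_box n a e \<times> {0..1})
      (\<lambda>p. snd p ^ l * h (segment_point a (fst p) (snd p)))"
    by (intro continuous_intros)
  then show ?thesis
    by (simp add: case_prod_beta)
qed

text \<open>The weight \<open>t ^ l\<close> closes the family under differentiation: along
  coordinate \<open>i\<close> the inner derivative contributes a factor \<open>t\<close>, so
  \<open>l\<close> goes up by one and \<open>h\<close> becomes its partial derivative. One induction
  on \<open>k\<close> then settles every \<open>l\<close>.\<close>

lemma C_k_on_segment_integral:
  assumes a: "\<And>i. i \<ge> n \<Longrightarrow> a i = 0" and h: "C_k_on k n (coord_box n a e) h"
  shows "C_k_on k n (coord_box n a e) (\<lambda>x. integral {0..1} (\<lambda>t. t ^ l * h (segment_point a x t)))"
proof -
  let ?B = "coord_box n a e"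
  have cont: "continuous_on ?B (\<lambda>x. integral {0..1} (\<lambda>t. t ^ l * h (segment_point a x t)))"
    if "continuous_on ?B h" for l h
    using integral_continuous_on_param[OF continuous_on_segment[OF a that, unfolded box_real(2)[symmetric]]]
    by (simp add: box_real)
  show ?thesis
    using h
  proof (induction k arbitrary: h l)
    case 0
    then show ?case
      using cont by simp
  next
    case (Suc k)
    show ?case
    proof (rule C_k_on_SucI[OF openin_coord_box, where
          f' = "\<lambda>i x. integral {0..1} (\<lambda>t. t ^ Suc l * partial_deriv i h (segment_point a x t))"])
      show "continuous_on ?B (\<lambda>x. integral {0..1} (\<lambda>t. t ^ l * h (segment_point a x t)))"
        by (rule cont[OF Suc.prems[THEN C_k_on_imp_continuous]])
      show "C_k_on k n ?B (\<lambda>x. integral {0..1} (\<lambda>t. t ^ Suc l * partial_deriv i h (segment_point a x t)))"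
        if "i < n" for i
        using Suc.prems that by (intro Suc.IH) auto
      fix i x assume i: "i < n" and x: "x \<in> ?B"
      \<comment> \<open>The interval of values that coordinate \<open>i\<close> may take inside the
        box. It is convex, as the Leibniz rule requires, and open, so that the derivative within it
        is the full derivative.\<close>
      define U where "U = {a i - e <..< a i + e}"
      have U: "x(i := s) \<in> ?B" if "s \<in> U" for s
        using that x i by (auto simp: U_def coord_box_def)
      have xU: "x i \<in> U" "open U"
        using x i by (auto simp: U_def coord_box_def abs_less_iff)
      have conth: "continuous_on ?B h"
        using Suc.prems by (rule C_k_on_imp_continuous)
      have conth': "continuous_on ?B (partial_deriv i h)"
        using Suc.prems i by (auto dest: C_k_on_imp_continuous)
      have param: "continuous_on (U \<times> cbox 0 1)
          (\<lambda>(s, t). t ^ l * g (segment_point a (x(i := s)) t))"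
        if "continuous_on ?B g" for l g
      proof -
        have "continuous_on (U \<times> {0..1}) (\<lambda>p. (x(i := fst p), snd p))"
        proof (intro continuous_intros continuous_on_coordinatewise_then_product)
          show "continuous_on (U \<times> {0..1}) (\<lambda>p. (x(i := fst p)) j)" for j
            by (cases "j = i") (auto intro!: continuous_intros)
        qed
        then have "continuous_on (U \<times> {0..1}) (\<lambda>p. case (x(i := fst p), snd p) of
            (x, t) \<Rightarrow> t ^ l * g (segment_point a x t))"
          using U by (intro continuous_on_compose2[OF continuous_on_segment[OF a that]]) auto
        then show ?thesis
          by (simp add: case_prod_beta)
      qed
      have "((\<lambda>s. integral (cbox 0 1) (\<lambda>t. t ^ l * h (segment_point a (x(i := s)) t)))
        has_real_derivative integral (cbox 0 1) (\<lambda>t. t ^ Suc l * partial_deriv i h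
          (segment_point a (x(i := x i)) t))) (at (x i) within U)"
      proof (rule leibniz_rule_field_derivative)
        show "convex U" "x i \<in> U"
          using xU by (auto simp: U_def)
        show "continuous_on (U \<times> cbox 0 1)
            (\<lambda>(s, t). t ^ Suc l * partial_deriv i h (segment_point a (x(i := s)) t))"
          by (rule param[OF conth'])
        show "(\<lambda>t. t ^ l * h (segment_point a (x(i := s)) t)) integrable_on cbox 0 1" if "s \<in> U" for s
        proof (rule integrable_continuous)
          show "continuous_on (cbox 0 1) (\<lambda>t. t ^ l * h (segment_point a (x(i := s)) t))"
            using continuous_on_compose2[OF param[OF conth, of l] continuous_on_Pair[OF
                continuous_on_const[of "cbox 0 1" s] continuous_on_id]] that
            by (auto simp: image_subset_iff)
        qed
        fix s t :: real assume s: "s \<in> U" and t: "t \<in> cbox 0 1"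
        define z where "z = segment_point a (x(i := s)) t"
        have z: "z \<in> ?B"
          unfolding z_def by (rule segment_point_in_coord_box[OF U[OF s] a]) (use t in auto)
        have seg: "segment_point a (x(i := s')) t = z(i := a i + t * (s' - a i))" for s'
          by (auto simp: z_def)
        have zi: "z i = a i + t * (s - a i)"
          by (simp add: z_def)
        have "((\<lambda>s. a i + t * (s - a i)) has_real_derivative t) (at s within U)"
          by (auto intro!: derivative_eq_intros)
        moreover have "((\<lambda>u. h (z(i := u))) has_real_derivative partial_deriv i h z)
            (at (a i + t * (s - a i)))"
          using DERIV_partial_deriv_at[OF Suc.prems i z] zi by (simp add: fun_upd_def)
        ultimately have "((\<lambda>s. h (z(i := a i + t * (s - a i)))) has_real_derivative
            partial_deriv i h z * t) (at s within U)"
          by (rule DERIV_chain2[rotated])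
        then have "((\<lambda>s. t ^ l * h (segment_point a (x(i := s)) t)) has_real_derivative
            t ^ l * (partial_deriv i h z * t)) (at s within U)"
          unfolding seg by (rule DERIV_cmult)
        then show "((\<lambda>s. t ^ l * h (segment_point a (x(i := s)) t)) has_real_derivative
            t ^ Suc l * partial_deriv i h (segment_point a (x(i := s)) t)) (at s within U)"
          by (simp add: z_def mult.assoc mult.commute mult.left_commute)
      qed
      then show "((\<lambda>s. integral {0..1} (\<lambda>t. t ^ l * h (segment_point a (x(i := s)) t)))
        has_real_derivative integral {0..1} (\<lambda>t. t ^ Suc l * partial_deriv i h (segment_point a x t)))
          (at (x i))"
        using at_within_open[OF xU] by (simp add: box_real)
    qed
  qed
qed

text \<open>The fundamental theorem of calculus along the segment from \<open>a\<close> to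
  \<open>x\<close> writes \<open>f x - f a\<close> as the integral of the derivative, and the
  factors \<open>x j - a j\<close> come out of the integral. At \<open>x = a\<close> the segment is
  constant, which gives the value of \<open>g j\<close> there.\<close>

lemma hadamard:
  assumes a: "\<And>i. i \<ge> n \<Longrightarrow> a i = 0" and e: "e > 0" and f: "C_infinity_on n (coord_box n a e) f"
  obtains g where "\<And>j. j < n \<Longrightarrow> C_infinity_on n (coord_box n a e) (g j)"
    "\<And>j. j < n \<Longrightarrow> g j a = partial_deriv j f a"
    "\<And>x. x \<in> coord_box n a e \<Longrightarrow> f x = f a + (\<Sum>j<n. (x j - a j) * g j x)"
proof -
  let ?B = "coord_box n a e"
  \<comment> \<open>The factor \<open>t ^ 0\<close> only brings the integrand into the form of
    \<open>C_k_on_segment_integral\<close> with \<open>l = 0\<close>.\<close>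
  define g where "g = (\<lambda>j x. integral {0..1} (\<lambda>t. t ^ 0 * partial_deriv j f (segment_point a x t)))"
  show ?thesis
  proof (rule that)
    show "C_infinity_on n ?B (g j)" if "j < n" for j
      unfolding C_infinity_on_def g_def
      by (intro allI C_k_on_segment_integral a C_infinity_on_k[OF C_infinity_on_partial[OF f that]])
    show "g j a = partial_deriv j f a" for j
      by (simp add: g_def)
    fix x assume x: "x \<in> ?B"
    have deriv: "((\<lambda>t. f (segment_point a x t)) has_real_derivative
        (\<Sum>j<n. partial_deriv j f (segment_point a x t) * (x j - a j))) (at t)" if "t \<in> {0..1}" for t
    proof (rule chain_rule[OF openin_coord_box])
      show "C_k_on (Suc 0) n ?B f"
        by (rule C_infinity_on_k[OF f])
      show "segment_point a x t \<in> ?B"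
        by (rule segment_point_in_coord_box[OF x a that])
      show "((\<lambda>t. segment_point a x t j) has_real_derivative x j - a j) (at t)" for j
        by (auto intro!: derivative_eq_intros)
      show "\<forall>\<^sub>F t in at t. \<forall>j\<ge>n. segment_point a x t j = 0"
        using a x by (auto simp: coord_box_def)
    qed
    have int: "(\<lambda>t. partial_deriv j f (segment_point a x t)) integrable_on {0..1}" if "j < n" for j
    proof (rule integrable_continuous_real)
      have "continuous_on ?B (partial_deriv j f)"
        using C_infinity_on_k[OF C_infinity_on_partial[OF f that]] C_k_on_imp_continuous by blast
      then show "continuous_on {0..1} (\<lambda>t. partial_deriv j f (segment_point a x t))"
        using continuous_on_compose2[OF continuous_on_segment[OF a, where n = n and e = e and h = "partial_deriv j f" and l = 0]
            continuous_on_Pair[OF continuous_on_const[of "{0..1}" x] continuous_on_id]] x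
        by (auto simp: image_subset_iff)
    qed
    have "((\<lambda>t. \<Sum>j<n. partial_deriv j f (segment_point a x t) * (x j - a j)) has_integral
        f (segment_point a x 1) - f (segment_point a x 0)) {0..1}"
      using deriv
      by (intro fundamental_theorem_of_calculus)
        (auto intro: has_field_derivative_at_within simp flip: has_real_derivative_iff_has_vector_derivative)
    then have "f x - f a = integral {0..1} (\<lambda>t. \<Sum>j<n. partial_deriv j f (segment_point a x t) * (x j - a j))"
      by (simp add: integral_unique)
    also have "\<dots> = (\<Sum>j<n. g j x * (x j - a j))"
      by (subst integral_sum) (auto simp: g_def intro: integrable_on_mult_left int)
    finally show "f x = f a + (\<Sum>j<n. (x j - a j) * g j x)"
      by (simp add: mult.commute)
  qed
qed

section \<open>Smooth functions on manifolds\<close>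

lemma C_infinity_on_cong:
  assumes "openin (Euclidean_space n) S" "\<And>x. x \<in> S \<Longrightarrow> f x = g x" "C_infinity_on n S f"
  shows "C_infinity_on n S g"
  unfolding C_infinity_on_def
  using C_k_on_cong[OF assms(1,2)] C_infinity_on_k[OF assms(3)] by simp

section \<open>Charts of a smooth manifold\<close>

locale smooth_mfd =
  fixes M :: "'a manifold"
  assumes smooth_manifold: "smooth_manifold M"
begin

abbreviation near :: "'a \<Rightarrow> ('a \<Rightarrow> bool) \<Rightarrow> bool" where
  "near p P \<equiv> eventually P (nhdsin (mtop M) p)"

lemma near_iff: "p \<in> points M \<Longrightarrow> near p P \<longleftrightarrow> (\<exists>W. openin (mtop M) W \<and> p \<in> W \<and> (\<forall>q\<in>W. P q))"
  by (simp add: eventually_nhdsin)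

lemma near_imp: "near p P \<Longrightarrow> p \<in> points M \<Longrightarrow> P p"
  by (auto simp: near_iff)

lemma near_open: "openin (mtop M) W \<Longrightarrow> p \<in> W \<Longrightarrow> near p (\<lambda>q. q \<in> W)"
  using openin_subset by (subst near_iff) auto

lemma near_points: "p \<in> points M \<Longrightarrow> near p (\<lambda>q. q \<in> points M)"
  by (auto intro: near_open)

lemma Hausdorff: "Hausdorff_space (mtop M)"
  using smooth_manifold by (simp add: smooth_manifold_def)

lemma chart_exists:
  assumes "p \<in> points M"
  obtains U \<phi> where "(U, \<phi>) \<in> atlas M" "p \<in> U"
proof -
  have "(\<Union>(U, \<phi>)\<in>atlas M. U) = points M"
    using smooth_manifold unfolding smooth_manifold_def by blast
  then show ?thesis
    using assms that by auto
qed

context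
  fixes U \<phi> assumes chart: "(U, \<phi>) \<in> atlas M"
begin

lemma chart_open: "openin (mtop M) U"
  and chart_image_open: "openin (Euclidean_space (mdim M)) (\<phi> ` U)"
  and chart_homeomorphic: "homeomorphic_map (subtopology (mtop M) U)
        (subtopology (Euclidean_space (mdim M)) (\<phi> ` U)) \<phi>"
  using smooth_manifold chart unfolding smooth_manifold_def by blast+

lemma chart_subset: "U \<subseteq> points M"
  using chart_open by (rule openin_subset)

lemma chart_inj: "inj_on \<phi> U"
  using homeomorphic_imp_injective_map[OF chart_homeomorphic] chart_subset
  by (simp add: Int_absorb1)

lemma chart_inv: "q \<in> U \<Longrightarrow> inv_into U \<phi> (\<phi> q) = q"
  by (rule inv_into_f_f[OF chart_inj])

lemma chart_coord_0: "q \<in> U \<Longrightarrow> i \<ge> mdim M \<Longrightarrow> \<phi> q i = 0"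
  using openin_subset[OF chart_image_open] by (auto simp: topspace_Euclidean_space)

lemma chart_open_image:
  assumes "openin (mtop M) W" "W \<subseteq> U"
  shows "openin (Euclidean_space (mdim M)) (\<phi> ` W)"
proof -
  have "openin (subtopology (mtop M) U) W"
    using assms openin_open_subtopology[OF chart_open] by blast
  then have "openin (subtopology (Euclidean_space (mdim M)) (\<phi> ` U)) (\<phi> ` W)"
    using homeomorphic_imp_open_map[OF chart_homeomorphic] unfolding open_map_def by blast
  then show ?thesis
    using openin_open_subtopology[OF chart_image_open] by blast
qed

lemma chart_open_vimage:
  assumes "openin (Euclidean_space (mdim M)) A"
  shows "openin (mtop M) {q \<in> U. \<phi> q \<in> A}"
proof -
  have "openin (subtopology (Euclidean_space (mdim M)) (\<phi> ` U)) (A \<inter> \<phi> ` U)"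
    using assms by (rule openin_subtopology_Int)
  then have "openin (subtopology (mtop M) U) {q \<in> topspace (subtopology (mtop M) U). \<phi> q \<in> A \<inter> \<phi> ` U}"
    using homeomorphic_imp_continuous_map[OF chart_homeomorphic]
    by (rule openin_continuous_map_preimage[rotated])
  moreover have "{q \<in> topspace (subtopology (mtop M) U). \<phi> q \<in> A \<inter> \<phi> ` U} = {q \<in> U. \<phi> q \<in> A}"
    using chart_subset by auto
  ultimately show ?thesis
    using openin_open_subtopology[OF chart_open] by metis
qed

lemma chart_compact:
  assumes "compactin (Euclidean_space (mdim M)) K" "K \<subseteq> \<phi> ` U"
  shows "compactin (mtop M) {q \<in> U. \<phi> q \<in> K}"
proof -
  obtain g where g: "homeomorphic_maps (subtopology (mtop M) U)
        (subtopology (Euclidean_space (mdim M)) (\<phi> ` U)) \<phi> g"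
    using chart_homeomorphic homeomorphic_map_maps by blast
  have gq: "g (\<phi> q) = q" if "q \<in> U" for q
    using g that chart_subset by (auto simp: homeomorphic_maps_def)
  have "compactin (subtopology (Euclidean_space (mdim M)) (\<phi> ` U)) K"
    using assms by (simp add: compactin_subtopology)
  moreover have "continuous_map (subtopology (Euclidean_space (mdim M)) (\<phi> ` U))
      (subtopology (mtop M) U) g"
    using g by (simp add: homeomorphic_maps_def)
  ultimately have "compactin (subtopology (mtop M) U) (g ` K)"
    by (rule image_compactin)
  moreover have "g ` K = {q \<in> U. \<phi> q \<in> K}"
    using gq assms(2) by (force simp: image_iff)
  ultimately show ?thesis
    by (simp add: compactin_subtopology)
qed

lemma chart_transition:
  assumes "(V, \<psi>) \<in> atlas M" "i < mdim M"
  shows "C_infinity_on (mdim M) (\<phi> ` (U \<inter> V)) (\<lambda>x. \<psi> (inv_into U \<phi> x) i)"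
  using smooth_manifold chart assms unfolding smooth_manifold_def by fast

lemma smooth_on_chartD:
  "smooth_on M W f \<Longrightarrow> C_infinity_on (mdim M) (\<phi> ` (U \<inter> W)) (\<lambda>x. f (inv_into U \<phi> x))"
  using chart unfolding smooth_on_def by blast

end

text \<open>\<open>smooth_on\<close> asks for smoothness in every chart; composing with the smooth
  transition maps reduces this to one chart.\<close>

lemma smooth_on_chartI:
  assumes chart: "(U, \<phi>) \<in> atlas M" and W: "openin (mtop M) W" "W \<subseteq> U"
    and g: "C_infinity_on (mdim M) (\<phi> ` W) g" and f: "\<And>q. q \<in> W \<Longrightarrow> f q = g (\<phi> q)"
  shows "smooth_on M W f"
  unfolding smooth_on_def
proof safe
  fix V \<psi> assume V: "(V, \<psi>) \<in> atlas M"
  have open_VW: "openin (Euclidean_space (mdim M)) (\<psi> ` (V \<inter> W))"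
    using V W by (intro chart_open_image) (auto intro: chart_open)
  have "C_k_on k (mdim M) (\<psi> ` (V \<inter> W)) (\<lambda>x. g (\<phi> (inv_into V \<psi> x)))" for k
  proof (rule C_k_on_compose[OF chart_open_image[OF chart W] open_VW,
        where F = "\<lambda>x. \<phi> (inv_into V \<psi> x)" and g = g])
    show "(\<lambda>x. \<phi> (inv_into V \<psi> x)) ` \<psi> ` (V \<inter> W) \<subseteq> \<phi> ` W"
      using chart_inv[OF V] by auto
    show "C_k_on k (mdim M) (\<psi> ` (V \<inter> W)) (\<lambda>x. \<phi> (inv_into V \<psi> x) j)" if "j < mdim M" for j
      using C_infinity_on_k[OF chart_transition[OF V chart that]]
      by (rule C_k_on_mono) (use W in auto)
    show "C_k_on k (mdim M) (\<phi> ` W) g"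
      using g by (rule C_infinity_on_k)
  qed
  then have "C_infinity_on (mdim M) (\<psi> ` (V \<inter> W)) (\<lambda>x. g (\<phi> (inv_into V \<psi> x)))"
    by (simp add: C_infinity_on_def)
  then show "C_infinity_on (mdim M) (\<psi> ` (V \<inter> W)) (\<lambda>x. f (inv_into V \<psi> x))"
    by (rule C_infinity_on_cong[OF open_VW, rotated]) (use f chart_inv[OF V] in auto)
qed

section \<open>Locality and algebra of smooth functions\<close>

lemma smooth_on_mono: "smooth_on M W f \<Longrightarrow> V \<subseteq> W \<Longrightarrow> smooth_on M V f"
  unfolding smooth_on_def C_infinity_on_def by (fast elim: C_k_on_mono)

lemma smooth_on_cong:
  assumes W: "openin (mtop M) W" and fg: "\<And>q. q \<in> W \<Longrightarrow> f q = g q" and f: "smooth_on M W f"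
  shows "smooth_on M W g"
  unfolding smooth_on_def
proof safe
  fix V \<psi> assume V: "(V, \<psi>) \<in> atlas M"
  have open_VW: "openin (Euclidean_space (mdim M)) (\<psi> ` (V \<inter> W))"
    using V W by (intro chart_open_image) (auto intro: chart_open)
  show "C_infinity_on (mdim M) (\<psi> ` (V \<inter> W)) (\<lambda>x. g (inv_into V \<psi> x))"
    by (rule C_infinity_on_cong[OF open_VW _ smooth_on_chartD[OF V f]]) (use fg chart_inv[OF V] in auto)
qed

lemma smooth_on_local:
  assumes "\<And>p. p \<in> W \<Longrightarrow> \<exists>V. openin (mtop M) V \<and> p \<in> V \<and> smooth_on M V f"
  shows "smooth_on M W f"
  unfolding smooth_on_def
proof safe
  fix U \<phi> assume U: "(U, \<phi>) \<in> atlas M"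
  show "C_infinity_on (mdim M) (\<phi> ` (U \<inter> W)) (\<lambda>x. f (inv_into U \<phi> x))"
    unfolding C_infinity_on_def
  proof (intro allI C_k_on_local)
    fix k x assume "x \<in> \<phi> ` (U \<inter> W)"
    then obtain p where p: "p \<in> U" "p \<in> W" "x = \<phi> p"
      by blast
    then obtain V where V: "openin (mtop M) V" "p \<in> V" "smooth_on M V f"
      using assms by blast
    have "openin (Euclidean_space (mdim M)) (\<phi> ` (U \<inter> V))"
      using V U by (intro chart_open_image) (auto intro: chart_open)
    then show "\<exists>T. openin (Euclidean_space (mdim M)) T \<and> x \<in> T \<and>
        C_k_on k (mdim M) T (\<lambda>x. f (inv_into U \<phi> x))"
      using p V smooth_on_chartD[OF U V(3)] C_infinity_on_k by (intro exI[of _ "\<phi> ` (U \<inter> V)"]) auto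
  qed
qed

context
  fixes W assumes W: "openin (mtop M) W"
begin

lemma chart_open_Int: "(U, \<phi>) \<in> atlas M \<Longrightarrow> openin (Euclidean_space (mdim M)) (\<phi> ` (U \<inter> W))"
  using W by (intro chart_open_image) (auto intro: chart_open)

lemma smooth_on_const: "smooth_on M W (\<lambda>q. c)"
  unfolding smooth_on_def C_infinity_on_def by (auto intro: C_k_on_const chart_open_Int)

lemma smooth_on_add: "smooth_on M W f \<Longrightarrow> smooth_on M W g \<Longrightarrow> smooth_on M W (\<lambda>q. f q + g q)"
  unfolding smooth_on_def C_infinity_on_def by (fast intro: C_k_on_add chart_open_Int)

lemma smooth_on_mult: "smooth_on M W f \<Longrightarrow> smooth_on M W g \<Longrightarrow> smooth_on M W (\<lambda>q. f q * g q)"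
  unfolding smooth_on_def C_infinity_on_def by (fast intro: C_k_on_mult chart_open_Int)

lemma smooth_on_inverse:
  assumes "smooth_on M W f" "\<And>q. q \<in> W \<Longrightarrow> f q \<noteq> 0"
  shows "smooth_on M W (\<lambda>q. inverse (f q))"
  unfolding smooth_on_def
proof safe
  fix U \<phi> assume U: "(U, \<phi>) \<in> atlas M"
  have "f (inv_into U \<phi> x) \<noteq> 0" if "x \<in> \<phi> ` (U \<inter> W)" for x
    using that assms(2) chart_inv[OF U] by auto
  then show "C_infinity_on (mdim M) (\<phi> ` (U \<inter> W)) (\<lambda>x. inverse (f (inv_into U \<phi> x)))"
    unfolding C_infinity_on_def
    by (intro allI C_k_on_inverse[OF chart_open_Int[OF U] C_infinity_on_k[OF smooth_on_chartD[OF U assms(1)]]])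
qed

end

lemma smooth_on_smooth: "f \<in> smooth_functions M \<Longrightarrow> W \<subseteq> points M \<Longrightarrow> smooth_on M W f"
  by (auto simp: smooth_functions_def intro: smooth_on_mono)

lemma smoothI:
  "(\<And>p. p \<in> points M \<Longrightarrow> \<exists>W. openin (mtop M) W \<and> p \<in> W \<and> smooth_on M W f) \<Longrightarrow> f \<in> smooth_functions M"
  unfolding smooth_functions_def by (auto intro: smooth_on_local)

lemma smooth_const [intro, simp]: "(\<lambda>q. c) \<in> smooth_functions M"
  and smooth_add [intro]: "f \<in> smooth_functions M \<Longrightarrow> g \<in> smooth_functions M \<Longrightarrow>
    (\<lambda>q. f q + g q) \<in> smooth_functions M"
  and smooth_mult [intro]: "f \<in> smooth_functions M \<Longrightarrow> g \<in> smooth_functions M \<Longrightarrow>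
    (\<lambda>q. f q * g q) \<in> smooth_functions M"
  by (auto simp: smooth_functions_def intro: smooth_on_const smooth_on_add smooth_on_mult)

lemma smooth_minus [intro]:
  assumes "f \<in> smooth_functions M" "g \<in> smooth_functions M"
  shows "(\<lambda>q. f q - g q) \<in> smooth_functions M"
  using smooth_add[OF assms(1) smooth_mult[OF smooth_const[of "- 1"] assms(2)]] by simp

lemma smooth_sum [intro]:
  "(\<And>j. j \<in> J \<Longrightarrow> f j \<in> smooth_functions M) \<Longrightarrow> (\<lambda>q. \<Sum>j\<in>J. f j q) \<in> smooth_functions M"
  by (induction J rule: infinite_finite_induct) (auto intro: smooth_add)

lemma smooth_germI:
  assumes "\<And>p. p \<in> points M \<Longrightarrow> \<exists>g\<in>smooth_functions M. near p (\<lambda>q. f q = g q)"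
  shows "f \<in> smooth_functions M"
proof (rule smoothI)
  fix p assume p: "p \<in> points M"
  then obtain g where g0: "g \<in> smooth_functions M" "near p (\<lambda>q. f q = g q)"
    using assms by blast
  then obtain W where g: "g \<in> smooth_functions M" "openin (mtop M) W" "p \<in> W" "\<forall>q\<in>W. f q = g q"
    unfolding near_iff[OF p] by blast
  then have "smooth_on M W f"
    using smooth_on_cong[of W g f] smooth_on_smooth[OF g(1) openin_subset] by auto
  then show "\<exists>W. openin (mtop M) W \<and> p \<in> W \<and> smooth_on M W f"
    using g by blast
qed

lemma smooth_cong:
  assumes "f \<in> smooth_functions M" "\<And>q. q \<in> points M \<Longrightarrow> f q = g q"
  shows "g \<in> smooth_functions M"
proof (rule smooth_germI)
  fix p assume "p \<in> points M"
  then have "near p (\<lambda>q. g q = f q)"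
    by (rule eventually_mono[OF near_points]) (simp add: assms(2))
  then show "\<exists>f\<in>smooth_functions M. near p (\<lambda>q. g q = f q)"
    using assms(1) by blast
qed

section \<open>Global bump functions and extension of local functions\<close>

lemma compactin_closed_box:
  fixes n and a :: "nat \<Rightarrow> real"
  shows "compactin (Euclidean_space n) {x. (\<forall>i<n. \<bar>x i - a i\<bar> \<le> e) \<and> (\<forall>i\<ge>n. x i = 0)}"
    (is "compactin _ ?K")
proof -
  let ?I = "\<lambda>i. if i < n then {a i - e..a i + e} else {0}"
  have "x \<in> ?K \<longleftrightarrow> (\<forall>i. x i \<in> ?I i)" for x
  proof -
    have "\<bar>x i - a i\<bar> \<le> e \<longleftrightarrow> x i \<in> {a i - e..a i + e}" for i
      by auto
    then show ?thesis
      by (simp add: not_less) (meson not_less)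
  qed
  then have "?K = Pi\<^sub>E UNIV ?I"
    by (simp add: PiE_UNIV_domain Pi_def set_eq_iff)
  moreover have "compactin (powertop_real UNIV) (Pi\<^sub>E UNIV ?I)"
    unfolding compactin_PiE by simp
  moreover have "?K \<subseteq> {x. \<forall>i\<ge>n. x i = 0}"
    by blast
  ultimately show ?thesis
    unfolding Euclidean_space_def compactin_subtopology by metis
qed

text \<open>The last conclusion, vanishing near each point outside \<open>W\<close>, is what makes
  the product with a function that is smooth only on \<open>W\<close> smooth on all of
  \<open>M\<close>. It rests on the Hausdorff property: the preimage \<open>C\<close> of a closed
  box is compact in \<open>M\<close>, hence closed, and \<rho> vanishes off
  \<open>C\<close>.\<close>

lemma bump_exists:
  assumes W: "openin (mtop M) W" and p: "p \<in> W"
  obtains \<rho> where "\<rho> \<in> smooth_functions M" "near p (\<lambda>q. \<rho> q = 1)" "\<And>q. q \<notin> W \<Longrightarrow> \<rho> q = 0"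
    "\<And>q. q \<in> points M - W \<Longrightarrow> near q (\<lambda>q. \<rho> q = 0)"
proof -
  let ?n = "mdim M"
  obtain U \<phi> where U: "(U, \<phi>) \<in> atlas M" "p \<in> U"
    using chart_exists W p openin_subset by blast
  have "openin (Euclidean_space ?n) (\<phi> ` (U \<inter> W))"
    using W U by (rule_tac chart_open_Int)
  then obtain e' where e': "e' > 0" "coord_box ?n (\<phi> p) e' \<subseteq> \<phi> ` (U \<inter> W)"
    using open_contains_coord_box[of ?n "\<phi> ` (U \<inter> W)" "\<phi> p"] U p by auto
  \<comment> \<open>Halving the radius leaves room for the closed box of radius \<open>e\<close>
    inside the open box of radius \<open>e'\<close>, which lies in the image of
    \<open>W\<close>.\<close>
  define e where "e = e' / 2"
  have e: "e > 0"
    using e' by (simp add: e_def)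
  define \<rho> where "\<rho> = (\<lambda>q. if q \<in> U then box_bump ?n (\<phi> p) e (\<phi> q) else 0)"
  define K where "K = {x. (\<forall>i<?n. \<bar>x i - \<phi> p i\<bar> \<le> e) \<and> (\<forall>i\<ge>?n. x i = 0)}"
  define C where "C = {q \<in> U. \<phi> q \<in> K}"
  have K: "K \<subseteq> \<phi> ` (U \<inter> W)"
    using e' by (intro order.trans[OF _ e'(2)]) (force simp: K_def coord_box_def e_def)
  have CW: "C \<subseteq> W"
    using K chart_inj[OF U(1)] by (auto simp: C_def inj_on_def)
  have "compactin (mtop M) C"
    unfolding C_def using U(1) by (rule chart_compact) (use K in \<open>auto simp: K_def compactin_closed_box\<close>)
  then have C: "openin (mtop M) (points M - C)"
    using compactin_imp_closedin[OF Hausdorff] by (simp add: closedin_def)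
  have zero: "\<rho> q = 0" if "q \<notin> C" for q
  proof (cases "q \<in> U")
    case True
    then have "\<exists>i<?n. \<not> \<bar>\<phi> q i - \<phi> p i\<bar> \<le> e"
      using that chart_coord_0[OF U(1) True] by (auto simp: C_def K_def)
    then obtain i where "i < ?n" "\<bar>\<phi> q i - \<phi> p i\<bar> > e"
      by (auto simp: not_le)
    then show ?thesis
      using box_bump_eq_0[OF e] by (simp add: \<rho>_def)
  qed (simp add: \<rho>_def)
  show ?thesis
  proof (rule that)
    show "\<rho> q = 0" if "q \<notin> W" for q
      using zero that CW by blast
    show "near q (\<lambda>q. \<rho> q = 0)" if "q \<in> points M - W" for q
      using that CW by (intro eventually_mono[OF near_open[OF C]]) (auto intro: zero)
    have "openin (mtop M) {q \<in> U. \<phi> q \<in> coord_box ?n (\<phi> p) (e / 2)}"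
      using U(1) openin_coord_box by (rule chart_open_vimage)
    moreover have "p \<in> {q \<in> U. \<phi> q \<in> coord_box ?n (\<phi> p) (e / 2)}"
      using U e chart_coord_0[OF U(1)] by (simp add: coord_box_def)
    ultimately have "near p (\<lambda>q. q \<in> {q \<in> U. \<phi> q \<in> coord_box ?n (\<phi> p) (e / 2)})"
      by (rule near_open)
    then show "near p (\<lambda>q. \<rho> q = 1)"
      by eventually_elim (simp add: \<rho>_def box_bump_eq_1[OF e])
    show "\<rho> \<in> smooth_functions M"
    proof (rule smoothI)
      fix q assume q: "q \<in> points M"
      show "\<exists>W. openin (mtop M) W \<and> q \<in> W \<and> smooth_on M W \<rho>"
      proof (cases "q \<in> U")
        case True
        have "smooth_on M U \<rho>"
        proof (rule smooth_on_chartI[OF U(1) chart_open[OF U(1)] order.refl])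
          show "C_infinity_on ?n (\<phi> ` U) (box_bump ?n (\<phi> p) e)"
            unfolding C_infinity_on_def by (auto intro: C_k_on_box_bump chart_image_open[OF U(1)])
        qed (simp add: \<rho>_def)
        then show ?thesis
          using True chart_open[OF U(1)] by blast
      next
        case False
        have "smooth_on M (points M - C) \<rho>"
          by (rule smooth_on_cong[OF C _ smooth_on_const[OF C, of 0]]) (simp add: zero)
        then show ?thesis
          using False C q by (auto simp: C_def)
      qed
    qed
  qed
qed

lemma smooth_cutoff:
  assumes W: "openin (mtop M) W" and f: "smooth_on M W f" and \<rho>: "\<rho> \<in> smooth_functions M"
    and zero: "\<And>q. q \<in> points M - W \<Longrightarrow> near q (\<lambda>q. \<rho> q = 0)"
  shows "(\<lambda>q. \<rho> q * f q) \<in> smooth_functions M"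
proof (rule smoothI)
  fix q assume q: "q \<in> points M"
  show "\<exists>W. openin (mtop M) W \<and> q \<in> W \<and> smooth_on M W (\<lambda>q. \<rho> q * f q)"
  proof (cases "q \<in> W")
    case True
    then show ?thesis
      using W f smooth_on_smooth[OF \<rho> openin_subset[OF W]] smooth_on_mult by blast
  next
    case False
    then obtain V where V: "openin (mtop M) V" "q \<in> V" "\<forall>q\<in>V. \<rho> q = 0"
      using zero[of q] q near_iff[OF q] by auto
    have "smooth_on M V (\<lambda>q. \<rho> q * f q)"
      by (rule smooth_on_cong[OF V(1) _ smooth_on_const[OF V(1), of 0]]) (simp add: V(3))
    then show ?thesis
      using V by blast
  qed
qed

lemma smooth_extension:
  assumes W: "openin (mtop M) W" and p: "p \<in> W" and f: "smooth_on M W f"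
  obtains g where "g \<in> smooth_functions M" "near p (\<lambda>q. f q = g q)"
proof -
  obtain \<rho> where \<rho>: "\<rho> \<in> smooth_functions M" "near p (\<lambda>q. \<rho> q = 1)" "\<And>q. q \<notin> W \<Longrightarrow> \<rho> q = 0"
    "\<And>q. q \<in> points M - W \<Longrightarrow> near q (\<lambda>q. \<rho> q = 0)"
    using bump_exists[OF W p] by blast
  show ?thesis
  proof (rule that)
    show "(\<lambda>q. \<rho> q * f q) \<in> smooth_functions M"
      by (rule smooth_cutoff[OF W f \<rho>(1,4)])
    show "near p (\<lambda>q. f q = \<rho> q * f q)"
      using \<rho>(2) by eventually_elim simp
  qed
qed

lemma smooth_inverse_germ:
  assumes f: "f \<in> smooth_functions M" and p: "p \<in> points M" "f p \<noteq> 0"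
  obtains g where "g \<in> smooth_functions M" "near p (\<lambda>q. f q * g q = 1)"
proof -
  obtain U \<phi> where U: "(U, \<phi>) \<in> atlas M" "p \<in> U"
    using chart_exists p(1) by blast
  define h where "h = (\<lambda>x. f (inv_into U \<phi> x))"
  have "continuous_on (\<phi> ` U) h"
    using smooth_on_chartD[OF U(1) smooth_on_smooth[OF f chart_subset[OF U(1)]], THEN C_infinity_on_k]
    by (auto simp: h_def dest: C_k_on_imp_continuous)
  \<comment> \<open>An oscillation below \<open>\<bar>f p\<bar>\<close> keeps \<open>f\<close> away
    from \<open>0\<close> on the box.\<close>
  then obtain e where e: "e > 0" "coord_box (mdim M) (\<phi> p) e \<subseteq> \<phi> ` U"
      "\<And>y. y \<in> coord_box (mdim M) (\<phi> p) e \<Longrightarrow> \<bar>h y - h (\<phi> p)\<bar> < \<bar>f p\<bar>"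
    using continuous_on_coord_box[OF chart_image_open[OF U(1)], of h "\<phi> p" "\<bar>f p\<bar>"] U p(2) by auto
  define W where "W = {q \<in> U. \<phi> q \<in> coord_box (mdim M) (\<phi> p) e}"
  have W: "openin (mtop M) W"
    unfolding W_def by (rule chart_open_vimage[OF U(1) openin_coord_box])
  have pW: "p \<in> W"
    using U e(1) chart_coord_0[OF U(1)] by (simp add: W_def coord_box_def)
  have nz: "f q \<noteq> 0" if "q \<in> W" for q
    using e(3)[of "\<phi> q"] that chart_inv[OF U(1)] U(2) by (auto simp: W_def h_def)
  obtain g where g: "g \<in> smooth_functions M" "near p (\<lambda>q. inverse (f q) = g q)"
    using smooth_extension[OF W pW smooth_on_inverse[OF W smooth_on_smooth[OF f openin_subset[OF W]] nz]]
    by blast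
  have "near p (\<lambda>q. f q * g q = 1)"
    using g(2) near_open[OF W pW] by eventually_elim (use nz in \<open>force simp: field_simps\<close>)
  then show ?thesis
    using that g(1) by blast
qed

end

section \<open>Tangent vectors and local frames\<close>

context smooth_mfd
begin

section \<open>Tangent vectors as derivations\<close>

lemma smooth_on_points_iff: "smooth_on M (points M) f \<longleftrightarrow> f \<in> smooth_functions M"
  by (simp add: smooth_functions_def)

lemma tangent_outside: "v \<in> tangent_space M p \<Longrightarrow> f \<notin> smooth_functions M \<Longrightarrow> v f = 0"
  by (simp add: tangent_space_def)

lemma tangent_lincomb:
  "v \<in> tangent_space M p \<Longrightarrow> f \<in> smooth_functions M \<Longrightarrow> g \<in> smooth_functions M \<Longrightarrow>
    v (\<lambda>q. a * f q + b * g q) = a * v f + b * v g"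
  by (simp add: tangent_space_def)

lemma tangent_mult:
  "v \<in> tangent_space M p \<Longrightarrow> f \<in> smooth_functions M \<Longrightarrow> g \<in> smooth_functions M \<Longrightarrow>
    v (\<lambda>q. f q * g q) = f p * v g + g p * v f"
  by (simp add: tangent_space_def)

lemma tangent_add:
  "v \<in> tangent_space M p \<Longrightarrow> f \<in> smooth_functions M \<Longrightarrow> g \<in> smooth_functions M \<Longrightarrow>
    v (\<lambda>q. f q + g q) = v f + v g"
  using tangent_lincomb[of v p f g 1 1] by simp

lemma tangent_minus:
  "v \<in> tangent_space M p \<Longrightarrow> f \<in> smooth_functions M \<Longrightarrow> g \<in> smooth_functions M \<Longrightarrow>
    v (\<lambda>q. f q - g q) = v f - v g"
  using tangent_lincomb[of v p f g 1 "- 1"] by simp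

lemma tangent_uminus:
  "v \<in> tangent_space M p \<Longrightarrow> f \<in> smooth_functions M \<Longrightarrow> v (\<lambda>q. - f q) = - v f"
  using tangent_lincomb[of v p f f "- 1" 0] by simp

lemma tangent_const:
  assumes "v \<in> tangent_space M p"
  shows "v (\<lambda>q. c) = 0"
proof -
  have "v (\<lambda>q. 1) = 0"
    using tangent_mult[OF assms smooth_const[of 1] smooth_const[of 1]] by simp
  then show ?thesis
    using tangent_lincomb[OF assms smooth_const[of 1] smooth_const[of 1], of c 0] by simp
qed

lemma tangent_sum:
  assumes "v \<in> tangent_space M p" "\<And>j. j \<in> J \<Longrightarrow> f j \<in> smooth_functions M"
  shows "v (\<lambda>q. \<Sum>j\<in>J. f j q) = (\<Sum>j\<in>J. v (f j))"
  using assms(2)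
proof (induction J rule: infinite_finite_induct)
  case (insert j J)
  then show ?case
    using tangent_add[OF assms(1), of "f j" "\<lambda>q. \<Sum>j\<in>J. f j q"] by (simp add: smooth_sum)
qed (auto simp: tangent_const[OF assms(1)])

text \<open>With a bump \<rho> that vanishes off a neighbourhood where \<open>f = g\<close>, the
  difference \<open>f - g\<close> equals \<open>(1 - \<rho>) * (f - g)\<close>. Both factors vanish
  at \<open>p\<close>, so the Leibniz rule kills the product.\<close>

lemma tangent_local:
  assumes v: "v \<in> tangent_space M p" and p: "p \<in> points M"
    and f: "f \<in> smooth_functions M" and g: "g \<in> smooth_functions M" and fg: "near p (\<lambda>q. f q = g q)"
  shows "v f = v g"
proof -
  obtain W where W: "openin (mtop M) W" "p \<in> W" "\<forall>q\<in>W. f q = g q"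
    using fg unfolding near_iff[OF p] by blast
  obtain \<rho> where \<rho>: "\<rho> \<in> smooth_functions M" "near p (\<lambda>q. \<rho> q = 1)" "\<And>q. q \<notin> W \<Longrightarrow> \<rho> q = 0"
    using bump_exists[OF W(1,2)] by metis
  have "(\<lambda>q. (1 - \<rho> q) * (f q - g q)) = (\<lambda>q. f q - g q)"
    using W(3) \<rho>(3) by fastforce
  then have "v (\<lambda>q. f q - g q) = 0"
    using tangent_mult[OF v smooth_minus[OF smooth_const[of 1] \<rho>(1)] smooth_minus[OF f g]]
      near_imp[OF \<rho>(2) p] near_imp[OF fg p] by simp
  then show ?thesis
    using tangent_minus[OF v f g] by simp
qed

lemma tangent_cong:
  assumes "v \<in> tangent_space M p" "p \<in> points M" "f \<in> smooth_functions M"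
    "\<And>q. q \<in> points M \<Longrightarrow> f q = g q"
  shows "v f = v g"
  using assms smooth_cong[OF assms(3,4)]
  by (intro tangent_local) (auto intro: eventually_mono[OF near_points])

lemma tangent_comb:
  assumes "v \<in> tangent_space M p" "w \<in> tangent_space M p"
  shows "(\<lambda>f. a * v f + b * w f) \<in> tangent_space M p"
  using assms unfolding tangent_space_def by (auto simp: algebra_simps)

lemma tangent_zero: "(\<lambda>f. 0) \<in> tangent_space M p"
  by (auto simp: tangent_space_def)

lemma tangent_vec_sum:
  assumes "\<And>j. j \<in> J \<Longrightarrow> v j \<in> tangent_space M p"
  shows "(\<lambda>f. \<Sum>j\<in>J. c j * v j f) \<in> tangent_space M p"
  using assms
proof (induction J rule: infinite_finite_induct)
  case (insert j J)
  then show ?case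
    using tangent_comb[of "v j" p "\<lambda>f. \<Sum>j\<in>J. c j * v j f" "c j" 1] by simp
qed (auto simp: tangent_zero)

lemma linear_on_tangent_sum:
  assumes \<xi>: "linear_on_tangent M p \<xi>" and v: "\<And>j. j \<in> J \<Longrightarrow> v j \<in> tangent_space M p"
  shows "\<xi> (\<lambda>f. \<Sum>j\<in>J. c j * v j f) = (\<Sum>j\<in>J. c j * \<xi> (v j))"
proof -
  have lin: "\<xi> (\<lambda>f. a * v f + b * w f) = a * \<xi> v + b * \<xi> w"
    if "v \<in> tangent_space M p" "w \<in> tangent_space M p" for v w a b
    using \<xi> that by (simp add: linear_on_tangent_def)
  show ?thesis
    using v
  proof (induction J rule: infinite_finite_induct)
    case (insert j J)
    then show ?case
      using lin[of "v j" "\<lambda>f. \<Sum>j\<in>J. c j * v j f" "c j" 1] by (simp add: tangent_vec_sum)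
  qed (use lin[OF tangent_zero tangent_zero, of 0 0] in auto)
qed

section \<open>Vector fields and local frames\<close>

lemma vector_fieldI:
  "(\<And>p. p \<in> points M \<Longrightarrow> X p \<in> tangent_space M p) \<Longrightarrow>
    (\<And>f. f \<in> smooth_functions M \<Longrightarrow> (\<lambda>p. X p f) \<in> smooth_functions M) \<Longrightarrow> X \<in> vector_fields M"
  by (simp add: vector_fields_def vector_field_on_def smooth_on_points_iff)

lemma vector_field_tangent: "X \<in> vector_fields M \<Longrightarrow> p \<in> points M \<Longrightarrow> X p \<in> tangent_space M p"
  by (simp add: vector_fields_def vector_field_on_def)

lemma vector_field_smooth:
  "X \<in> vector_fields M \<Longrightarrow> f \<in> smooth_functions M \<Longrightarrow> (\<lambda>p. X p f) \<in> smooth_functions M"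
  by (simp add: vector_fields_def vector_field_on_def smooth_on_points_iff)

lemma vector_field_add:
  assumes "X \<in> vector_fields M" "Y \<in> vector_fields M"
  shows "(\<lambda>p f. X p f + Y p f) \<in> vector_fields M"
proof (rule vector_fieldI)
  show "(\<lambda>f. X p f + Y p f) \<in> tangent_space M p" if "p \<in> points M" for p
    using tangent_comb[OF assms[THEN vector_field_tangent, OF that], of 1 1] by simp
qed (rule smooth_add[OF assms[THEN vector_field_smooth]])

lemma vector_field_scale:
  assumes "h \<in> smooth_functions M" "X \<in> vector_fields M"
  shows "(\<lambda>p f. h p * X p f) \<in> vector_fields M"
proof (rule vector_fieldI)
  show "(\<lambda>f. h p * X p f) \<in> tangent_space M p" if "p \<in> points M" for p
    using tangent_comb[OF vector_field_tangent vector_field_tangent, OF assms(2) that assms(2) that,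
        of "h p" 0] by simp
qed (rule smooth_mult[OF assms(1) vector_field_smooth[OF assms(2)]])

lemma vector_field_sum:
  assumes "\<And>j. j \<in> J \<Longrightarrow> h j \<in> smooth_functions M" "\<And>j. j \<in> J \<Longrightarrow> X j \<in> vector_fields M"
  shows "(\<lambda>p f. \<Sum>j\<in>J. h j p * X j p f) \<in> vector_fields M"
proof (rule vector_fieldI)
  show "(\<lambda>f. \<Sum>j\<in>J. h j p * X j p f) \<in> tangent_space M p" if "p \<in> points M" for p
    by (rule tangent_vec_sum) (use assms(2) that vector_field_tangent in blast)
  show "(\<lambda>p. \<Sum>j\<in>J. h j p * X j p f) \<in> smooth_functions M" if "f \<in> smooth_functions M" for f
    by (intro smooth_sum smooth_mult assms(1)) (use assms(2) that vector_field_smooth in blast)+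
qed

text \<open>Coordinates and coordinate fields are cut off so that they become global objects. The
  expansion therefore holds only near \<open>p\<close>, where the cut-off is \<open>1\<close>;
  duality is recorded at \<open>p\<close> alone, where it gives linear independence.\<close>

definition frame_at :: "'a \<Rightarrow> (nat \<Rightarrow> 'a \<Rightarrow> real) \<Rightarrow> (nat \<Rightarrow> 'a \<Rightarrow> 'a tvec) \<Rightarrow> bool" where
  "frame_at p x E \<longleftrightarrow>
    (\<forall>j<mdim M. x j \<in> smooth_functions M \<and> E j \<in> vector_fields M) \<and>
    near p (\<lambda>q. \<forall>v\<in>tangent_space M q. v = (\<lambda>f. \<Sum>j<mdim M. v (x j) * E j q f)) \<and>
    (\<forall>i<mdim M. \<forall>j<mdim M. E j p (x i) = (if i = j then 1 else 0))"

lemma frame_atD: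
  assumes "frame_at p x E"
  shows "j < mdim M \<Longrightarrow> x j \<in> smooth_functions M"
    and "j < mdim M \<Longrightarrow> E j \<in> vector_fields M"
    and "near p (\<lambda>q. \<forall>v\<in>tangent_space M q. v = (\<lambda>f. \<Sum>j<mdim M. v (x j) * E j q f))"
    and "i < mdim M \<Longrightarrow> j < mdim M \<Longrightarrow> E j p (x i) = (if i = j then 1 else 0)"
  using assms by (simp_all add: frame_at_def)

text \<open>For \<open>q\<close> near \<open>p\<close>, apply a derivation at \<open>q\<close> to
  the Hadamard expansion of \<open>f\<close> about \<open>q\<close>. The constant term disappears,
  and each product leaves the value on a coordinate times the value of the second factor at
  \<open>q\<close>, which is a partial derivative of \<open>f\<close>.\<close>

lemma frame_exists:
  assumes p: "p \<in> points M"
  obtains x E where "frame_at p x E"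
proof -
  let ?n = "mdim M"
  obtain U \<phi> where U: "(U, \<phi>) \<in> atlas M" "p \<in> U"
    using chart_exists p by blast
  note open_U = chart_open[OF U(1)] and open_\<phi>U = chart_image_open[OF U(1)]
  obtain \<rho> where \<rho>: "\<rho> \<in> smooth_functions M" "near p (\<lambda>q. \<rho> q = 1)" "\<And>q. q \<notin> U \<Longrightarrow> \<rho> q = 0"
    "\<And>q. q \<in> points M - U \<Longrightarrow> near q (\<lambda>q. \<rho> q = 0)"
    using bump_exists[OF open_U U(2)] by blast
  define rep where "rep = (\<lambda>(f :: 'a \<Rightarrow> real) x. f (inv_into U \<phi> x))"
  have rep: "C_infinity_on ?n (\<phi> ` U) (rep f)" if "f \<in> smooth_functions M" for f
    using smooth_on_chartD[OF U(1) smooth_on_smooth[OF that chart_subset[OF U(1)]]]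
    by (simp add: rep_def)
  have rep_eq: "rep f (\<phi> q) = f q" if "q \<in> U" for f q
    using chart_inv[OF U(1) that] by (simp add: rep_def)
  note rep_deriv = DERIV_partial_deriv_at[OF C_infinity_on_k[OF rep]]
  define x where "x = (\<lambda>j q. \<rho> q * \<phi> q j)"
  \<comment> \<open>The case distinction follows the convention that tangent vectors are
    \<open>0\<close> on functions that are not smooth.\<close>
  define E where "E = (\<lambda>j q f. if f \<in> smooth_functions M
    then \<rho> q * partial_deriv j (rep f) (\<phi> q) else 0)"
  have x: "x j \<in> smooth_functions M" for j
    unfolding x_def
  proof (rule smooth_cutoff[OF open_U _ \<rho>(1,4)])
    show "smooth_on M U (\<lambda>q. \<phi> q j)"
      by (rule smooth_on_chartI[OF U(1) open_U order.refl, where g = "\<lambda>x. x j"])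
        (auto simp: C_infinity_on_def intro: C_k_on_coord open_\<phi>U)
  qed
  have E: "E j \<in> vector_fields M" if j: "j < ?n" for j
  proof (rule vector_fieldI)
    fix q assume "q \<in> points M"
    show "E j q \<in> tangent_space M q"
    proof (cases "q \<in> U")
      case False
      then have "E j q = (\<lambda>f. 0)"
        using \<rho>(3) by (simp add: E_def fun_eq_iff)
      then show ?thesis
        by (simp add: tangent_zero)
    next
      case True
      then have \<phi>q: "\<phi> q \<in> \<phi> ` U"
        by simp
      have "partial_deriv j (rep (\<lambda>q. a * f q + b * g q)) (\<phi> q)
          = a * partial_deriv j (rep f) (\<phi> q) + b * partial_deriv j (rep g) (\<phi> q)"
        if "f \<in> smooth_functions M" "g \<in> smooth_functions M" for f g a b
        using DERIV_add[OF DERIV_cmult[OF rep_deriv[OF that(1) j \<phi>q]]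
            DERIV_cmult[OF rep_deriv[OF that(2) j \<phi>q]]]
        by (intro partial_deriv_eqI) (simp add: rep_def)
      moreover have "partial_deriv j (rep (\<lambda>q. f q * g q)) (\<phi> q)
          = f q * partial_deriv j (rep g) (\<phi> q) + g q * partial_deriv j (rep f) (\<phi> q)"
        if "f \<in> smooth_functions M" "g \<in> smooth_functions M" for f g
        using DERIV_partial_deriv_mult[OF C_infinity_on_k[OF rep[OF that(1)]]
            C_infinity_on_k[OF rep[OF that(2)]] j \<phi>q] chart_inv[OF U(1) True]
        by (intro partial_deriv_eqI) (simp add: rep_def algebra_simps)
      ultimately show ?thesis
        unfolding tangent_space_def E_def
        by (auto simp: smooth_add smooth_mult algebra_simps)
    qed
  next
    fix f assume f: "f \<in> smooth_functions M"
    have "(\<lambda>q. \<rho> q * partial_deriv j (rep f) (\<phi> q)) \<in> smooth_functions M"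
    proof (rule smooth_cutoff[OF open_U _ \<rho>(1,4)])
      show "smooth_on M U (\<lambda>q. partial_deriv j (rep f) (\<phi> q))"
        by (rule smooth_on_chartI[OF U(1) open_U order.refl C_infinity_on_partial[OF rep[OF f] j]]) simp
    qed
    then show "(\<lambda>q. E j q f) \<in> smooth_functions M"
      using f by (simp add: E_def)
  qed
  obtain W' where W': "openin (mtop M) W'" "p \<in> W'" "\<forall>q\<in>W'. \<rho> q = 1"
    using \<rho>(2) unfolding near_iff[OF p] by blast
  define W where "W = W' \<inter> U"
  have W: "openin (mtop M) W" "p \<in> W" "W \<subseteq> U" "\<And>q. q \<in> W \<Longrightarrow> \<rho> q = 1"
    using W' U open_U by (auto simp: W_def)
  have open_\<phi>W: "openin (Euclidean_space ?n) (\<phi> ` W)"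
    by (rule chart_open_image[OF U(1) W(1,3)])
  have frame: "v f = (\<Sum>j<?n. v (x j) * E j q f)"
    if q: "q \<in> W" and v: "v \<in> tangent_space M q" and f: "f \<in> smooth_functions M" for q v f
  proof -
    have qU: "q \<in> U" and qM: "q \<in> points M"
      using q W(3) chart_subset[OF U(1)] by auto
    obtain e where e: "e > 0" "coord_box ?n (\<phi> q) e \<subseteq> \<phi> ` W"
      using open_contains_coord_box[OF open_\<phi>W] q by blast
    have C: "C_infinity_on ?n (coord_box ?n (\<phi> q) e) (rep f)"
      using rep[OF f] e(2) W(3) unfolding C_infinity_on_def by (meson C_k_on_mono image_mono order.trans)
    obtain g where g: "\<And>j. j < ?n \<Longrightarrow> C_infinity_on ?n (coord_box ?n (\<phi> q) e) (g j)"
      "\<And>j. j < ?n \<Longrightarrow> g j (\<phi> q) = partial_deriv j (rep f) (\<phi> q)"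
      "\<And>y. y \<in> coord_box ?n (\<phi> q) e \<Longrightarrow> rep f y = rep f (\<phi> q) + (\<Sum>j<?n. (y j - \<phi> q j) * g j y)"
      by (rule hadamard[OF chart_coord_0[OF U(1) qU] e(1) C]) (assumption, rule that, blast+)
    define Q where "Q = {q' \<in> U. \<phi> q' \<in> coord_box ?n (\<phi> q) e}"
    have Q: "openin (mtop M) Q"
      unfolding Q_def by (rule chart_open_vimage[OF U(1) openin_coord_box])
    have qQ: "q \<in> Q" and QU: "Q \<subseteq> U"
      using qU e(1) chart_coord_0[OF U(1) qU] by (auto simp: Q_def coord_box_def)
    have QW: "Q \<subseteq> W"
      using e(2) W(3) chart_inj[OF U(1)] by (auto simp: Q_def inj_on_def)
    have "\<exists>G\<in>smooth_functions M. near q (\<lambda>q'. g j (\<phi> q') = G q')" if j: "j < ?n" for j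
    proof -
      have "\<phi> ` Q \<subseteq> coord_box ?n (\<phi> q) e"
        by (auto simp: Q_def)
      then have "C_infinity_on ?n (\<phi> ` Q) (g j)"
        using g(1)[OF j] unfolding C_infinity_on_def by (meson C_k_on_mono)
      then have "smooth_on M Q (\<lambda>q'. g j (\<phi> q'))"
        by (rule smooth_on_chartI[OF U(1) Q QU]) simp
      then show ?thesis
        using smooth_extension[OF Q qQ, of "\<lambda>q'. g j (\<phi> q')"] by blast
    qed
    then have "\<forall>j\<in>{..<?n}. \<exists>G. G \<in> smooth_functions M \<and> near q (\<lambda>q'. g j (\<phi> q') = G q')"
      by auto
    from bchoice[OF this] obtain G where G: "\<And>j. j < ?n \<Longrightarrow> G j \<in> smooth_functions M"
      "\<And>j. j < ?n \<Longrightarrow> near q (\<lambda>q'. g j (\<phi> q') = G j q')"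
      by auto
    have Gq: "G j q = partial_deriv j (rep f) (\<phi> q)" if "j < ?n" for j
      using near_imp[OF G(2)[OF that] qM] g(2)[OF that] by simp
    have sm: "(\<lambda>q'. (x j q' - \<phi> q j) * G j q') \<in> smooth_functions M" if "j < ?n" for j
      by (rule smooth_mult[OF smooth_minus[OF x smooth_const] G(1)[OF that]])
    have sm_sum: "(\<lambda>q'. \<Sum>j<?n. (x j q' - \<phi> q j) * G j q') \<in> smooth_functions M"
      by (rule smooth_sum) (simp add: sm)
    have "near q (\<lambda>q'. \<forall>j\<in>{..<?n}. g j (\<phi> q') = G j q')"
      using G(2) by (intro eventually_ball_finite) auto
    then have "near q (\<lambda>q'. f q' = f q + (\<Sum>j<?n. (x j q' - \<phi> q j) * G j q'))"
      using near_open[OF Q qQ]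
    proof eventually_elim
      case (elim q')
      then have "f q' = rep f (\<phi> q')" "\<phi> q' \<in> coord_box ?n (\<phi> q) e" "\<rho> q' = 1"
        using QU QW W(4) rep_eq by (auto simp: Q_def)
      then show ?case
        using g(3)[of "\<phi> q'"] elim(1) rep_eq[OF qU] by (simp add: x_def)
    qed
    then have "v f = v (\<lambda>q'. f q + (\<Sum>j<?n. (x j q' - \<phi> q j) * G j q'))"
      by (rule tangent_local[OF v qM f smooth_add[OF smooth_const sm_sum]])
    also have "\<dots> = v (\<lambda>q'. \<Sum>j<?n. (x j q' - \<phi> q j) * G j q')"
      using tangent_add[OF v smooth_const sm_sum] by (simp add: tangent_const[OF v])
    also have "\<dots> = (\<Sum>j<?n. v (\<lambda>q'. (x j q' - \<phi> q j) * G j q'))"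
      by (rule tangent_sum[OF v]) (simp add: sm)
    also have "\<dots> = (\<Sum>j<?n. v (x j) * E j q f)"
    proof (intro sum.cong refl)
      fix j assume "j \<in> {..<?n}"
      then have j: "j < ?n"
        by simp
      \<comment> \<open>The first factor vanishes at \<open>q\<close>, so the Leibniz rule leaves a
        single term.\<close>
      have "x j q = \<phi> q j"
        using W(4)[OF q] by (simp add: x_def)
      then have "v (\<lambda>q'. (x j q' - \<phi> q j) * G j q') = G j q * v (\<lambda>q'. x j q' - \<phi> q j)"
        using tangent_mult[OF v smooth_minus[OF x smooth_const] G(1)[OF j]] by simp
      then show "v (\<lambda>q'. (x j q' - \<phi> q j) * G j q') = v (x j) * E j q f"
        using tangent_minus[OF v x smooth_const] tangent_const[OF v] Gq[OF j] W(4)[OF q] f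
        by (simp add: E_def)
    qed
    finally show ?thesis .
  qed
  have "frame_at p x E"
    unfolding frame_at_def
  proof (intro conjI allI impI)
    show "near p (\<lambda>q. \<forall>v\<in>tangent_space M q. v = (\<lambda>f. \<Sum>j<?n. v (x j) * E j q f))"
    proof (rule eventually_mono[OF near_open[OF W(1,2)]], intro ballI ext)
      fix q v f assume q: "q \<in> W" "v \<in> tangent_space M q"
      show "v f = (\<Sum>j<?n. v (x j) * E j q f)"
        using frame[OF q] tangent_outside[OF q(2)] by (cases "f \<in> smooth_functions M") (auto simp: E_def)
    qed
    fix i j assume ij: "i < ?n" "j < ?n"
    have "partial_deriv j (rep (x i)) (\<phi> p) = partial_deriv j (\<lambda>y. y i) (\<phi> p)"
    proof (rule partial_deriv_cong[OF open_\<phi>W])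
      show "rep (x i) y = y i" if "y \<in> \<phi> ` W" for y
        using that W rep_eq by (auto simp: x_def)
    qed (use W ij in auto)
    also have "\<dots> = (if i = j then 1 else 0)"
      by (intro partial_deriv_eqI) auto
    finally show "E j p (x i) = (if i = j then 1 else 0)"
      using x W by (simp add: E_def)
  qed (use x E in auto)
  then show ?thesis
    by (rule that)
qed

end

section \<open>Tensoriality and brackets\<close>

context smooth_mfd
begin

lemma vector_field_cutoff:
  assumes U: "openin (mtop M) U" and X: "vector_field_on M U X" and \<rho>: "\<rho> \<in> smooth_functions M"
    and zero: "\<And>q. q \<notin> U \<Longrightarrow> \<rho> q = 0" "\<And>q. q \<in> points M - U \<Longrightarrow> near q (\<lambda>q. \<rho> q = 0)"
  shows "(\<lambda>q f. \<rho> q * X q f) \<in> vector_fields M"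
proof (rule vector_fieldI)
  fix q assume "q \<in> points M"
  show "(\<lambda>f. \<rho> q * X q f) \<in> tangent_space M q"
  proof (cases "q \<in> U")
    case True
    then have "X q \<in> tangent_space M q"
      using X by (simp add: vector_field_on_def)
    then show ?thesis
      using tangent_comb[of "X q" q "X q" "\<rho> q" 0] by simp
  qed (simp add: zero(1) tangent_zero)
next
  fix f assume "f \<in> smooth_functions M"
  then have "smooth_on M U (\<lambda>q. X q f)"
    using X by (simp add: vector_field_on_def)
  then show "(\<lambda>q. \<rho> q * X q f) \<in> smooth_functions M"
    by (rule smooth_cutoff[OF U _ \<rho> zero(2)])
qed

lemma one_form_cutoff:
  assumes U: "openin (mtop M) U" and \<alpha>: "one_form_on M U \<alpha>" and \<rho>: "\<rho> \<in> smooth_functions M"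
    and zero: "\<And>q. q \<notin> U \<Longrightarrow> \<rho> q = 0" "\<And>q. q \<in> points M - U \<Longrightarrow> near q (\<lambda>q. \<rho> q = 0)"
  shows "(\<lambda>q v. \<rho> q * \<alpha> q v) \<in> one_forms M"
proof -
  have "(\<lambda>v. \<rho> q * \<alpha> q v) \<in> cotangent_space M q" for q
  proof (cases "q \<in> U")
    case True
    then have "\<alpha> q \<in> cotangent_space M q"
      using \<alpha> by (simp add: one_form_on_def)
    then show ?thesis
      by (auto simp: cotangent_space_def linear_on_tangent_def algebra_simps)
  qed (simp add: zero(1) cotangent_space_def linear_on_tangent_def)
  moreover have "(\<lambda>q. \<rho> q * \<alpha> q (X q)) \<in> smooth_functions M" if "X \<in> vector_fields M" for X
  proof (rule smooth_cutoff[OF U _ \<rho> zero(2)])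
    show "smooth_on M U (\<lambda>q. \<alpha> q (X q))"
      using \<alpha> that by (simp add: one_form_on_def)
  qed
  ultimately show ?thesis
    by (simp add: one_forms_def one_form_on_def smooth_on_points_iff)
qed

lemma linear_on_tangent_comb:
  "linear_on_tangent M p \<xi> \<Longrightarrow> v \<in> tangent_space M p \<Longrightarrow> w \<in> tangent_space M p \<Longrightarrow>
    \<xi> (\<lambda>f. a * v f + b * w f) = a * \<xi> v + b * \<xi> w"
  by (simp add: linear_on_tangent_def)

lemma linear_on_tangent_add:
  assumes "linear_on_tangent M p \<xi>" "v \<in> tangent_space M p" "w \<in> tangent_space M p"
  shows "\<xi> (\<lambda>f. v f + w f) = \<xi> v + \<xi> w"
  using linear_on_tangent_comb[OF assms, of 1 1] by simp

lemma linear_on_tangent_minus: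
  assumes "linear_on_tangent M p \<xi>" "v \<in> tangent_space M p" "w \<in> tangent_space M p"
  shows "\<xi> (\<lambda>f. v f - w f) = \<xi> v - \<xi> w"
  using linear_on_tangent_comb[OF assms, of 1 "- 1"] by simp

lemma linear_on_tangent_uminus:
  assumes "linear_on_tangent M p \<xi>" "v \<in> tangent_space M p"
  shows "\<xi> (\<lambda>f. - v f) = - \<xi> v"
  using linear_on_tangent_comb[OF assms assms(2), of "- 1" 0] by simp

lemma linear_on_tangent_scale:
  assumes "linear_on_tangent M p \<xi>" "v \<in> tangent_space M p"
  shows "\<xi> (\<lambda>f. a * v f) = a * \<xi> v"
  using linear_on_tangent_comb[OF assms assms(2), of a 0] by simp

lemma one_form_linear: "\<alpha> \<in> one_forms M \<Longrightarrow> p \<in> points M \<Longrightarrow> linear_on_tangent M p (\<alpha> p)"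
  by (simp add: one_forms_def one_form_on_def cotangent_space_def)

lemma one_form_smooth:
  "\<alpha> \<in> one_forms M \<Longrightarrow> X \<in> vector_fields M \<Longrightarrow> (\<lambda>q. \<alpha> q (X q)) \<in> smooth_functions M"
  by (simp add: one_forms_def one_form_on_def smooth_on_points_iff)

text \<open>The classical criterion for a functional on fields to depend only on the value at
  \<open>p\<close>. It is what makes \<open>covector_at\<close>, which picks an arbitrary extension
  of a tangent vector, computable on a given field.\<close>

definition tensorial :: "'a \<Rightarrow> (('a \<Rightarrow> 'a tvec) \<Rightarrow> real) \<Rightarrow> bool" where
  "tensorial p T \<longleftrightarrow>
    (\<forall>X\<in>vector_fields M. \<forall>Y\<in>vector_fields M. T (\<lambda>q f. X q f + Y q f) = T X + T Y) \<and>
    (\<forall>h\<in>smooth_functions M. \<forall>X\<in>vector_fields M. T (\<lambda>q f. h q * X q f) = h p * T X)"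

lemma tensorial_add:
  "tensorial p T \<Longrightarrow> X \<in> vector_fields M \<Longrightarrow> Y \<in> vector_fields M \<Longrightarrow>
    T (\<lambda>q f. X q f + Y q f) = T X + T Y"
  by (simp add: tensorial_def)

lemma tensorial_scale:
  "tensorial p T \<Longrightarrow> h \<in> smooth_functions M \<Longrightarrow> X \<in> vector_fields M \<Longrightarrow>
    T (\<lambda>q f. h q * X q f) = h p * T X"
  by (simp add: tensorial_def)

text \<open>Multiplication by a bump that vanishes off the region of agreement makes the two fields
  equal everywhere; homogeneity then returns the factor \<open>\<rho> p = 1\<close>.\<close>

lemma tensorial_local:
  assumes T: "tensorial p T" and p: "p \<in> points M"
    and X: "X \<in> vector_fields M" "Y \<in> vector_fields M" and XY: "near p (\<lambda>q. X q = Y q)"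
  shows "T X = T Y"
proof -
  obtain W where W: "openin (mtop M) W" "p \<in> W" "\<forall>q\<in>W. X q = Y q"
    using XY unfolding near_iff[OF p] by blast
  obtain \<rho> where \<rho>: "\<rho> \<in> smooth_functions M" "near p (\<lambda>q. \<rho> q = 1)" "\<And>q. q \<notin> W \<Longrightarrow> \<rho> q = 0"
    using bump_exists[OF W(1,2)] by metis
  have "\<rho> q * X q f = \<rho> q * Y q f" for q f
    using W(3) \<rho>(3) by (cases "q \<in> W") auto
  then have "(\<lambda>q f. \<rho> q * X q f) = (\<lambda>q f. \<rho> q * Y q f)"
    by (intro ext)
  moreover have "T (\<lambda>q f. \<rho> q * X q f) = \<rho> p * T X" "T (\<lambda>q f. \<rho> q * Y q f) = \<rho> p * T Y"
    by (rule tensorial_scale[OF T \<rho>(1)], fact)+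
  ultimately show ?thesis
    using near_imp[OF \<rho>(2) p] by simp
qed

lemma tensorial_sum:
  assumes T: "tensorial p T"
    and J: "finite J" "\<And>j. j \<in> J \<Longrightarrow> h j \<in> smooth_functions M" "\<And>j. j \<in> J \<Longrightarrow> X j \<in> vector_fields M"
  shows "T (\<lambda>q f. \<Sum>j\<in>J. h j q * X j q f) = (\<Sum>j\<in>J. h j p * T (X j))"
  using J
proof (induction J rule: finite_induct)
  case empty
  have "(\<lambda>q f. 0) \<in> vector_fields M"
    by (rule vector_fieldI) (auto simp: tangent_zero)
  then have "T (\<lambda>q f. 0 * 0) = 0 * T (\<lambda>q f. 0)"
    by (rule tensorial_scale[OF T smooth_const])
  then show ?case
    by simp
next
  case (insert j J)
  have "T (\<lambda>q f. h j q * X j q f + (\<Sum>j\<in>J. h j q * X j q f))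
      = T (\<lambda>q f. h j q * X j q f) + T (\<lambda>q f. \<Sum>j\<in>J. h j q * X j q f)"
    using insert.prems
    by (intro tensorial_add[OF T] vector_field_scale vector_field_sum) auto
  also have "T (\<lambda>q f. h j q * X j q f) = h j p * T (X j)"
    using insert.prems by (intro tensorial_scale[OF T]) auto
  finally show ?case
    using insert by simp
qed

text \<open>In a frame at \<open>p\<close>, locality and linearity express \<open>T Z\<close>
  through the numbers \<open>Z p (x j)\<close> and the fixed values \<open>T (E j)\<close>.\<close>

lemma tensorial_pointwise:
  assumes T: "tensorial p T" and p: "p \<in> points M"
    and X: "X \<in> vector_fields M" "Y \<in> vector_fields M" and XY: "X p = Y p"
  shows "T X = T Y"
proof -
  obtain x E where frame: "frame_at p x E"
    using frame_exists[OF p] .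
  have "T Z = (\<Sum>j<mdim M. Z p (x j) * T (E j))" if Z: "Z \<in> vector_fields M" for Z
  proof -
    have Zx: "(\<lambda>q. Z q (x j)) \<in> smooth_functions M" if "j < mdim M" for j
      by (rule vector_field_smooth[OF Z frame_atD(1)[OF frame that]])
    have "T Z = T (\<lambda>q f. \<Sum>j<mdim M. Z q (x j) * E j q f)"
    proof (rule tensorial_local[OF T p Z])
      show "(\<lambda>q f. \<Sum>j<mdim M. Z q (x j) * E j q f) \<in> vector_fields M"
        using Zx frame_atD(2)[OF frame] by (intro vector_field_sum) auto
      show "near p (\<lambda>q. Z q = (\<lambda>f. \<Sum>j<mdim M. Z q (x j) * E j q f))"
        using frame_atD(3)[OF frame] near_points[OF p]
      proof eventually_elim
        case (elim q)
        then show ?case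
          using vector_field_tangent[OF Z] by blast
      qed
    qed
    also have "\<dots> = (\<Sum>j<mdim M. Z p (x j) * T (E j))"
      using Zx frame_atD(2)[OF frame] by (intro tensorial_sum[OF T]) auto
    finally show ?thesis .
  qed
  then show ?thesis
    using X XY by simp
qed

lemma covector_at_eq:
  assumes T: "tensorial p T" and p: "p \<in> points M" and Z: "Z \<in> vector_fields M"
  shows "covector_at M p T (Z p) = T Z"
proof -
  let ?Z = "SOME Z'. Z' \<in> vector_fields M \<and> Z' p = Z p"
  have "?Z \<in> vector_fields M \<and> ?Z p = Z p"
    by (rule someI[of _ Z]) (use Z in simp)
  then have "T ?Z = T Z"
    using tensorial_pointwise[OF T p] Z by blast
  then show ?thesis
    using vector_field_tangent[OF Z p] by (simp add: covector_at_def)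
qed

section \<open>Lie brackets, Lie derivatives and differentials of one-forms\<close>

lemma lie_bracket_apply:
  "f \<in> smooth_functions M \<Longrightarrow> lie_bracket M X Y p f = X p (\<lambda>q. Y q f) - Y p (\<lambda>q. X q f)"
  by (simp add: lie_bracket_def)

lemma lie_bracket_antisym: "lie_bracket M Y X p = (\<lambda>f. - lie_bracket M X Y p f)"
  by (auto simp: lie_bracket_def)

lemma lie_bracket_vector_field:
  assumes X: "X \<in> vector_fields M" and Y: "Y \<in> vector_fields M"
  shows "lie_bracket M X Y \<in> vector_fields M"
proof (rule vector_fieldI)
  show "(\<lambda>p. lie_bracket M X Y p f) \<in> smooth_functions M" if f: "f \<in> smooth_functions M" for f
    unfolding lie_bracket_apply[OF f]
    by (rule smooth_minus[OF vector_field_smooth[OF X vector_field_smooth[OF Y f]]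
          vector_field_smooth[OF Y vector_field_smooth[OF X f]]])
  fix p assume p: "p \<in> points M"
  have lin: "A p (\<lambda>q. B q (\<lambda>q. a * f q + b * g q)) = a * A p (\<lambda>q. B q f) + b * A p (\<lambda>q. B q g)"
    if A: "A \<in> vector_fields M" and B: "B \<in> vector_fields M"
      and f: "f \<in> smooth_functions M" and g: "g \<in> smooth_functions M" for A B f g a b
  proof -
    note s = vector_field_smooth[OF B f] vector_field_smooth[OF B g]
    have "A p (\<lambda>q. B q (\<lambda>q. a * f q + b * g q)) = A p (\<lambda>q. a * B q f + b * B q g)"
      using tangent_lincomb[OF vector_field_tangent[OF B] f g]
      by (intro tangent_cong[OF vector_field_tangent[OF A p] p vector_field_smooth[OF B]])
        (auto intro!: smooth_add smooth_mult f g)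
    then show ?thesis
      using tangent_lincomb[OF vector_field_tangent[OF A p] s] by simp
  qed
  \<comment> \<open>The mixed terms \<open>B p g * A p f\<close> and \<open>B p f * A p g\<close>
    are symmetric in the two fields, so they cancel in the commutator.\<close>
  have leibniz: "A p (\<lambda>q. B q (\<lambda>q. f q * g q)) = f p * A p (\<lambda>q. B q g) + B p g * A p f
      + (g p * A p (\<lambda>q. B q f) + B p f * A p g)"
    if A: "A \<in> vector_fields M" and B: "B \<in> vector_fields M"
      and f: "f \<in> smooth_functions M" and g: "g \<in> smooth_functions M" for A B f g
  proof -
    note s = vector_field_smooth[OF B f] vector_field_smooth[OF B g]
    note Ap = vector_field_tangent[OF A p]
    have "A p (\<lambda>q. B q (\<lambda>q. f q * g q)) = A p (\<lambda>q. f q * B q g + g q * B q f)"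
      using tangent_mult[OF vector_field_tangent[OF B] f g]
      by (intro tangent_cong[OF Ap p vector_field_smooth[OF B smooth_mult[OF f g]]]) auto
    then show ?thesis
      using tangent_add[OF Ap smooth_mult[OF f s(2)] smooth_mult[OF g s(1)]]
        tangent_mult[OF Ap f s(2)] tangent_mult[OF Ap g s(1)] by simp
  qed
  show "lie_bracket M X Y p \<in> tangent_space M p"
    unfolding tangent_space_def
  proof (intro CollectI conjI ballI allI impI)
    show "lie_bracket M X Y p f = 0" if "f \<notin> smooth_functions M" for f
      using that by (simp add: lie_bracket_def)
    fix f g assume fg: "f \<in> smooth_functions M" "g \<in> smooth_functions M"
    show "lie_bracket M X Y p (\<lambda>q. a * f q + b * g q)
        = a * lie_bracket M X Y p f + b * lie_bracket M X Y p g" for a b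
      using lin[OF X Y fg, of a b] lin[OF Y X fg, of a b] fg
      by (simp add: lie_bracket_apply smooth_add smooth_mult algebra_simps)
    show "lie_bracket M X Y p (\<lambda>q. f q * g q)
        = f p * lie_bracket M X Y p g + g p * lie_bracket M X Y p f"
      using leibniz[OF X Y fg] leibniz[OF Y X fg] fg
      by (simp add: lie_bracket_apply smooth_mult algebra_simps)
  qed
qed

lemma lie_bracket_add:
  assumes "X \<in> vector_fields M" "Y \<in> vector_fields M" "Z \<in> vector_fields M" "p \<in> points M"
  shows "lie_bracket M X (\<lambda>q f. Y q f + Z q f) p = (\<lambda>f. lie_bracket M X Y p f + lie_bracket M X Z p f)"
proof
  fix f
  show "lie_bracket M X (\<lambda>q f. Y q f + Z q f) p f = lie_bracket M X Y p f + lie_bracket M X Z p f"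
    using tangent_add[OF vector_field_tangent[OF assms(1,4)] vector_field_smooth[OF assms(2)]
        vector_field_smooth[OF assms(3)], of f f]
    by (simp add: lie_bracket_def)
qed

lemma lie_bracket_scale:
  assumes X: "X \<in> vector_fields M" and Y: "Y \<in> vector_fields M" and h: "h \<in> smooth_functions M"
    and p: "p \<in> points M"
  shows "lie_bracket M X (\<lambda>q f. h q * Y q f) p = (\<lambda>f. h p * lie_bracket M X Y p f + X p h * Y p f)"
proof
  fix f
  show "lie_bracket M X (\<lambda>q f. h q * Y q f) p f = h p * lie_bracket M X Y p f + X p h * Y p f"
  proof (cases "f \<in> smooth_functions M")
    case True
    then show ?thesis
      using tangent_mult[OF vector_field_tangent[OF X p] h vector_field_smooth[OF Y True]]
      by (simp add: lie_bracket_apply algebra_simps)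
  next
    case False
    then show ?thesis
      using tangent_outside[OF vector_field_tangent[OF Y p]] by (simp add: lie_bracket_def)
  qed
qed

lemma one_form_bracket_add:
  assumes X: "X \<in> vector_fields M" and Y: "Y \<in> vector_fields M" and Z: "Z \<in> vector_fields M"
    and p: "p \<in> points M" and \<xi>: "linear_on_tangent M p \<xi>"
  shows "\<xi> (lie_bracket M X (\<lambda>q f. Y q f + Z q f) p)
    = \<xi> (lie_bracket M X Y p) + \<xi> (lie_bracket M X Z p)"
  unfolding lie_bracket_add[OF X Y Z p]
  by (intro linear_on_tangent_add[OF \<xi>] vector_field_tangent[OF _ p] lie_bracket_vector_field X Y Z)

lemma one_form_bracket_scale:
  assumes X: "X \<in> vector_fields M" and Y: "Y \<in> vector_fields M" and h: "h \<in> smooth_functions M"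
    and p: "p \<in> points M" and \<xi>: "linear_on_tangent M p \<xi>"
  shows "\<xi> (lie_bracket M X (\<lambda>q f. h q * Y q f) p)
    = h p * \<xi> (lie_bracket M X Y p) + X p h * \<xi> (Y p)"
  unfolding lie_bracket_scale[OF X Y h p]
  by (intro linear_on_tangent_comb[OF \<xi>] vector_field_tangent[OF _ p] lie_bracket_vector_field X Y)

lemma derivative_pairing_add:
  assumes v: "v \<in> tangent_space M p" and p: "p \<in> points M"
    and \<alpha>: "\<And>q. q \<in> points M \<Longrightarrow> linear_on_tangent M q (\<alpha> q)"
      "\<And>X. X \<in> vector_fields M \<Longrightarrow> (\<lambda>q. \<alpha> q (X q)) \<in> smooth_functions M"
    and X: "X \<in> vector_fields M" "Y \<in> vector_fields M"
  shows "v (\<lambda>q. \<alpha> q (\<lambda>f. X q f + Y q f)) = v (\<lambda>q. \<alpha> q (X q)) + v (\<lambda>q. \<alpha> q (Y q))"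
proof -
  have "v (\<lambda>q. \<alpha> q (\<lambda>f. X q f + Y q f)) = v (\<lambda>q. \<alpha> q (X q) + \<alpha> q (Y q))"
    using linear_on_tangent_add[OF \<alpha>(1) vector_field_tangent[OF X(1)] vector_field_tangent[OF X(2)]]
    by (intro tangent_cong[OF v p \<alpha>(2)[OF vector_field_add[OF X]]]) auto
  then show ?thesis
    using tangent_add[OF v \<alpha>(2)[OF X(1)] \<alpha>(2)[OF X(2)]] by simp
qed

lemma derivative_pairing_scale:
  assumes v: "v \<in> tangent_space M p" and p: "p \<in> points M"
    and \<alpha>: "\<And>q. q \<in> points M \<Longrightarrow> linear_on_tangent M q (\<alpha> q)"
      "\<And>X. X \<in> vector_fields M \<Longrightarrow> (\<lambda>q. \<alpha> q (X q)) \<in> smooth_functions M"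
    and X: "X \<in> vector_fields M" and h: "h \<in> smooth_functions M"
  shows "v (\<lambda>q. \<alpha> q (\<lambda>f. h q * X q f)) = h p * v (\<lambda>q. \<alpha> q (X q)) + \<alpha> p (X p) * v h"
proof -
  have "v (\<lambda>q. \<alpha> q (\<lambda>f. h q * X q f)) = v (\<lambda>q. h q * \<alpha> q (X q))"
    using linear_on_tangent_scale[OF \<alpha>(1) vector_field_tangent[OF X]]
    by (intro tangent_cong[OF v p \<alpha>(2)[OF vector_field_scale[OF h X]]]) auto
  then show ?thesis
    using tangent_mult[OF v h \<alpha>(2)[OF X]] by simp
qed

text \<open>Neither summand is tensorial in \<open>Z\<close>. For \<open>h\<close> times
  \<open>Z\<close>, the derivative of the pairing and the bracket both produce the derivative of
  \<open>h\<close> along \<open>X\<close> times the pairing of \<open>\<beta>\<close> with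
  \<open>Z\<close>, and the difference cancels it.\<close>

lemma lie_derivative_eq:
  assumes X: "X \<in> vector_fields M" and \<beta>: "\<beta> \<in> one_forms M" and Z: "Z \<in> vector_fields M"
    and p: "p \<in> points M"
  shows "lie_derivative M X \<beta> p (Z p) = X p (\<lambda>q. \<beta> q (Z q)) - \<beta> p (lie_bracket M X Z p)"
proof -
  note Xp = vector_field_tangent[OF X p] and \<beta>p = one_form_linear[OF \<beta> p]
  have "tensorial p (\<lambda>Z. X p (\<lambda>q. \<beta> q (Z q)) - \<beta> p (lie_bracket M X Z p))"
    unfolding tensorial_def
    using derivative_pairing_add[OF Xp p one_form_linear[OF \<beta>] one_form_smooth[OF \<beta>]]
      derivative_pairing_scale[OF Xp p one_form_linear[OF \<beta>] one_form_smooth[OF \<beta>]]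
      one_form_bracket_add[OF X _ _ p \<beta>p] one_form_bracket_scale[OF X _ _ p \<beta>p]
    by (simp add: algebra_simps)
  then show ?thesis
    unfolding lie_derivative_def by (rule covector_at_eq[OF _ p Z])
qed

lemma contract_d_one_form_eq:
  assumes Y: "Y \<in> vector_fields M" and \<alpha>: "\<alpha> \<in> one_forms M" and Z: "Z \<in> vector_fields M"
    and p: "p \<in> points M"
  shows "contract_d_one_form M Y \<alpha> p (Z p) = d_one_form M \<alpha> Y Z p"
proof -
  note Yp = vector_field_tangent[OF Y p] and \<alpha>p = one_form_linear[OF \<alpha> p]
  have "tensorial p (\<lambda>Z. d_one_form M \<alpha> Y Z p)"
    unfolding tensorial_def d_one_form_def
    using derivative_pairing_add[OF Yp p one_form_linear[OF \<alpha>] one_form_smooth[OF \<alpha>]]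
      derivative_pairing_scale[OF Yp p one_form_linear[OF \<alpha>] one_form_smooth[OF \<alpha>]]
      one_form_bracket_add[OF Y _ _ p \<alpha>p] one_form_bracket_scale[OF Y _ _ p \<alpha>p]
    by (simp add: algebra_simps)
  then show ?thesis
    unfolding contract_d_one_form_def by (rule covector_at_eq[OF _ p Z])
qed

section \<open>Two-forms and their exterior derivative\<close>

lemma two_form_linear:
  assumes "\<omega> \<in> two_forms M" "p \<in> points M" "v \<in> tangent_space M p"
  shows "linear_on_tangent M p (\<omega> p v)" "linear_on_tangent M p (\<lambda>w. \<omega> p w v)" "\<omega> p v v = 0"
  using assms by (auto simp: two_forms_def)

lemma two_form_smooth:
  "\<omega> \<in> two_forms M \<Longrightarrow> X \<in> vector_fields M \<Longrightarrow> Y \<in> vector_fields M \<Longrightarrow>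
    (\<lambda>p. \<omega> p (X p) (Y p)) \<in> smooth_functions M"
  by (simp add: two_forms_def)

lemma two_form_antisym:
  assumes \<omega>: "\<omega> \<in> two_forms M" and p: "p \<in> points M"
    and v: "v \<in> tangent_space M p" and w: "w \<in> tangent_space M p"
  shows "\<omega> p w v = - \<omega> p v w"
proof -
  have vw: "(\<lambda>f. v f + w f) \<in> tangent_space M p"
    using tangent_comb[OF v w, of 1 1] by simp
  have "0 = \<omega> p (\<lambda>f. v f + w f) (\<lambda>f. v f + w f)"
    using two_form_linear(3)[OF \<omega> p vw] by simp
  also have "\<dots> = \<omega> p v v + \<omega> p v w + (\<omega> p w v + \<omega> p w w)"
    using linear_on_tangent_add[OF two_form_linear(2)[OF \<omega> p vw] v w]
      linear_on_tangent_add[OF two_form_linear(1)[OF \<omega> p v] v w]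
      linear_on_tangent_add[OF two_form_linear(1)[OF \<omega> p w] v w] by simp
  finally show ?thesis
    using two_form_linear(3)[OF \<omega> p v] two_form_linear(3)[OF \<omega> p w] by simp
qed

lemma two_form_derivative_antisym:
  assumes \<omega>: "\<omega> \<in> two_forms M" and p: "p \<in> points M" and v: "v \<in> tangent_space M p"
    and X: "X \<in> vector_fields M" and Y: "Y \<in> vector_fields M"
  shows "v (\<lambda>q. \<omega> q (Y q) (X q)) = - v (\<lambda>q. \<omega> q (X q) (Y q))"
proof -
  have "v (\<lambda>q. \<omega> q (Y q) (X q)) = v (\<lambda>q. - \<omega> q (X q) (Y q))"
    using two_form_antisym[OF \<omega> _ vector_field_tangent[OF X] vector_field_tangent[OF Y]]
    by (intro tangent_cong[OF v p two_form_smooth[OF \<omega> Y X]]) auto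
  then show ?thesis
    using tangent_uminus[OF v two_form_smooth[OF \<omega> X Y]] by simp
qed

lemma two_form_bracket_antisym:
  assumes \<omega>: "\<omega> \<in> two_forms M" and p: "p \<in> points M" and v: "v \<in> tangent_space M p"
    and X: "X \<in> vector_fields M" and Y: "Y \<in> vector_fields M"
  shows "\<omega> p (lie_bracket M Y X p) v = - \<omega> p (lie_bracket M X Y p) v"
  unfolding lie_bracket_antisym[of Y X p]
  by (rule linear_on_tangent_uminus[OF two_form_linear(2)[OF \<omega> p v]
        vector_field_tangent[OF lie_bracket_vector_field[OF X Y] p]])

text \<open>These two transpositions generate all permutations of the arguments, so that
  tensoriality in one slot carries over to the other two.\<close>

lemma d_two_form_antisym:
  assumes \<omega>: "\<omega> \<in> two_forms M" and p: "p \<in> points M"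
    and X: "X \<in> vector_fields M" and Y: "Y \<in> vector_fields M" and Z: "Z \<in> vector_fields M"
  shows "d_two_form M \<omega> Y X Z p = - d_two_form M \<omega> X Y Z p"
    and "d_two_form M \<omega> Z Y X p = - d_two_form M \<omega> X Y Z p"
  unfolding d_two_form_def
  using two_form_derivative_antisym[OF \<omega> p vector_field_tangent[OF Z p] X Y]
    two_form_derivative_antisym[OF \<omega> p vector_field_tangent[OF X p] Y Z]
    two_form_derivative_antisym[OF \<omega> p vector_field_tangent[OF Y p] X Z]
    two_form_derivative_antisym[OF \<omega> p vector_field_tangent[OF Z p] Y X]
    two_form_bracket_antisym[OF \<omega> p vector_field_tangent[OF Z p] X Y]
    two_form_bracket_antisym[OF \<omega> p vector_field_tangent[OF Y p] X Z]
    two_form_bracket_antisym[OF \<omega> p vector_field_tangent[OF X p] Y Z]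
  by simp_all

lemma tensorial_d_two_form:
  assumes \<omega>: "\<omega> \<in> two_forms M" and p: "p \<in> points M"
    and X: "X \<in> vector_fields M" and Y: "Y \<in> vector_fields M"
  shows "tensorial p (\<lambda>Z. d_two_form M \<omega> X Y Z p)"
proof -
  note Xp = vector_field_tangent[OF X p] and Yp = vector_field_tangent[OF Y p]
  note lX = two_form_linear(1)[OF \<omega> _ vector_field_tangent[OF X]]
    and lY = two_form_linear(1)[OF \<omega> _ vector_field_tangent[OF Y]]
  note rX = two_form_linear(2)[OF \<omega> p Xp] and rY = two_form_linear(2)[OF \<omega> p Yp]
  note l = two_form_linear(1)[OF \<omega> p vector_field_tangent[OF lie_bracket_vector_field[OF X Y] p]]
  note sX = two_form_smooth[OF \<omega> X] and sY = two_form_smooth[OF \<omega> Y]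
  show ?thesis
    unfolding tensorial_def d_two_form_def
    using derivative_pairing_add[OF Xp p lY sY] derivative_pairing_add[OF Yp p lX sX]
      derivative_pairing_scale[OF Xp p lY sY] derivative_pairing_scale[OF Yp p lX sX]
      one_form_bracket_add[OF X _ _ p rY] one_form_bracket_scale[OF X _ _ p rY]
      one_form_bracket_add[OF Y _ _ p rX] one_form_bracket_scale[OF Y _ _ p rX]
      linear_on_tangent_add[OF l vector_field_tangent[OF _ p] vector_field_tangent[OF _ p]]
      linear_on_tangent_scale[OF l vector_field_tangent[OF _ p]]
      two_form_antisym[OF \<omega> p Xp vector_field_tangent[OF _ p]]
      two_form_antisym[OF \<omega> p Yp vector_field_tangent[OF _ p]]
    by (simp add: algebra_simps)
qed

text \<open>Transpositions bring each argument in turn into the last slot, the one where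
  tensoriality has been proved, and back again; the signs cancel.\<close>

lemma d_two_form_pointwise:
  assumes \<omega>: "\<omega> \<in> two_forms M" and p: "p \<in> points M"
    and X: "X \<in> vector_fields M" "X' \<in> vector_fields M" "X p = X' p"
    and Y: "Y \<in> vector_fields M" "Y' \<in> vector_fields M" "Y p = Y' p"
    and Z: "Z \<in> vector_fields M" "Z' \<in> vector_fields M" "Z p = Z' p"
  shows "d_two_form M \<omega> X Y Z p = d_two_form M \<omega> X' Y' Z' p"
proof -
  have last: "d_two_form M \<omega> A B C p = d_two_form M \<omega> A B C' p"
    if "A \<in> vector_fields M" "B \<in> vector_fields M" "C \<in> vector_fields M" "C' \<in> vector_fields M"
      "C p = C' p" for A B C C'
    using tensorial_pointwise[OF tensorial_d_two_form[OF \<omega> p that(1,2)] p that(3-5)] .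
  have "d_two_form M \<omega> X Y Z p = d_two_form M \<omega> X Y Z' p"
    by (rule last) (use X Y Z in auto)
  also have "\<dots> = - d_two_form M \<omega> Z' Y X p"
    using d_two_form_antisym(2)[OF \<omega> p X(1) Y(1) Z(2)] by simp
  also have "d_two_form M \<omega> Z' Y X p = d_two_form M \<omega> Z' Y X' p"
    by (rule last) (use X Y Z in auto)
  also have "\<dots> = - d_two_form M \<omega> Y Z' X' p"
    using d_two_form_antisym(1)[OF \<omega> p Y(1) Z(2) X(2)] by simp
  also have "\<dots> = d_two_form M \<omega> X' Z' Y p"
    using d_two_form_antisym(2)[OF \<omega> p Y(1) Z(2) X(2)] by simp
  also have "d_two_form M \<omega> X' Z' Y p = d_two_form M \<omega> X' Z' Y' p"
    by (rule last) (use X Y Z in auto)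
  also have "\<dots> = - d_two_form M \<omega> Z' X' Y' p"
    using d_two_form_antisym(1)[OF \<omega> p Z(2) X(2) Y(2)] by simp
  also have "\<dots> = d_two_form M \<omega> Y' X' Z' p"
    using d_two_form_antisym(2)[OF \<omega> p Z(2) X(2) Y(2)] by simp
  also have "\<dots> = - d_two_form M \<omega> X' Y' Z' p"
    using d_two_form_antisym(1)[OF \<omega> p X(2) Y(2) Z(2)] by simp
  finally show ?thesis
    by simp
qed

lemma tensors11_tangent: "r \<in> tensors11 M \<Longrightarrow> p \<in> points M \<Longrightarrow> v \<in> tangent_space M p \<Longrightarrow>
    r p v \<in> tangent_space M p"
  by (simp add: tensors11_def)

lemma tensors11_comb: "r \<in> tensors11 M \<Longrightarrow> p \<in> points M \<Longrightarrow> v \<in> tangent_space M p \<Longrightarrow>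
    w \<in> tangent_space M p \<Longrightarrow> r p (\<lambda>f. a * v f + b * w f) = (\<lambda>f. a * r p v f + b * r p w f)"
  by (simp add: tensors11_def)

lemma tensors11_vector_field:
  "r \<in> tensors11 M \<Longrightarrow> X \<in> vector_fields M \<Longrightarrow> apply_tensor r X \<in> vector_fields M"
  by (simp add: tensors11_def apply_tensor_def)

lemma tensors11_linear:
  assumes "r \<in> tensors11 M" "p \<in> points M"
  shows "linear_on_tangent M p (\<lambda>v. r p v f)"
  using assms unfolding linear_on_tangent_def by (simp add: tensors11_comb)

end

section \<open>Germs and immersed submanifolds\<close>

context smooth_mfd
begin

text \<open>Coefficients in a local frame are under control only near one point. Their germs form a
  ring in which a function that does not vanish at \<open>p\<close> is invertible, which is the
  setting for elimination.\<close>

definition smooth_near :: "'a \<Rightarrow> ('a \<Rightarrow> real) \<Rightarrow> bool" where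
  "smooth_near p f \<longleftrightarrow> (\<exists>g\<in>smooth_functions M. near p (\<lambda>q. f q = g q))"

lemma smooth_nearI: "g \<in> smooth_functions M \<Longrightarrow> near p (\<lambda>q. f q = g q) \<Longrightarrow> smooth_near p f"
  unfolding smooth_near_def by (rule bexI)

lemma smooth_near_obtain:
  assumes "smooth_near p f"
  obtains g where "g \<in> smooth_functions M" "near p (\<lambda>q. f q = g q)"
  using assms unfolding smooth_near_def by (rule bexE)

lemma smooth_near_smooth: "f \<in> smooth_functions M \<Longrightarrow> smooth_near p f"
  by (rule smooth_nearI) auto

lemma smooth_near_cong:
  assumes f: "smooth_near p f" and fg: "near p (\<lambda>q. g q = f q)"
  shows "smooth_near p g"
proof (rule smooth_near_obtain[OF f])
  fix h assume h: "h \<in> smooth_functions M" "near p (\<lambda>q. f q = h q)"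
  have "near p (\<lambda>q. g q = h q)"
    using fg h(2) by eventually_elim simp
  then show ?thesis
    by (rule smooth_nearI[OF h(1)])
qed

lemma smooth_near_binary:
  assumes f: "smooth_near p f" and g: "smooth_near p g"
    and op: "\<And>f g. f \<in> smooth_functions M \<Longrightarrow> g \<in> smooth_functions M \<Longrightarrow>
      (\<lambda>q. op (f q) (g q)) \<in> smooth_functions M"
  shows "smooth_near p (\<lambda>q. op (f q) (g q))"
proof (rule smooth_near_obtain[OF f], rule smooth_near_obtain[OF g])
  fix f' g' assume *: "f' \<in> smooth_functions M" "near p (\<lambda>q. f q = f' q)"
    "g' \<in> smooth_functions M" "near p (\<lambda>q. g q = g' q)"
  show ?thesis
  proof (rule smooth_nearI)
    show "(\<lambda>q. op (f' q) (g' q)) \<in> smooth_functions M"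
      using op * by blast
    show "near p (\<lambda>q. op (f q) (g q) = op (f' q) (g' q))"
      using *(2,4) by eventually_elim simp
  qed
qed

lemma smooth_near_add: "smooth_near p f \<Longrightarrow> smooth_near p g \<Longrightarrow> smooth_near p (\<lambda>q. f q + g q)"
  by (rule smooth_near_binary[where op = "(+)"]) (auto intro: smooth_add)

lemma smooth_near_minus: "smooth_near p f \<Longrightarrow> smooth_near p g \<Longrightarrow> smooth_near p (\<lambda>q. f q - g q)"
  by (rule smooth_near_binary[where op = "(-)"]) (auto intro: smooth_minus)

lemma smooth_near_mult: "smooth_near p f \<Longrightarrow> smooth_near p g \<Longrightarrow> smooth_near p (\<lambda>q. f q * g q)"
  by (rule smooth_near_binary[where op = "(*)"]) (auto intro: smooth_mult)

lemma smooth_near_sum: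
  "(\<And>j. j \<in> J \<Longrightarrow> smooth_near p (f j)) \<Longrightarrow> smooth_near p (\<lambda>q. \<Sum>j\<in>J. f j q)"
  by (induction J rule: infinite_finite_induct)
    (auto intro: smooth_near_add smooth_near_smooth)

lemma smooth_near_inverse:
  assumes f: "smooth_near p f" and p: "p \<in> points M" "f p \<noteq> 0"
  shows "smooth_near p (\<lambda>q. inverse (f q))" and "near p (\<lambda>q. f q \<noteq> 0)"
proof -
  obtain f' where f': "f' \<in> smooth_functions M" "near p (\<lambda>q. f q = f' q)"
    using smooth_near_obtain[OF f] .
  have "f' p \<noteq> 0"
    using near_imp[OF f'(2) p(1)] p(2) by simp
  then obtain g where g: "g \<in> smooth_functions M" "near p (\<lambda>q. f' q * g q = 1)"
    using smooth_inverse_germ[OF f'(1) p(1)] by metis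
  have "near p (\<lambda>q. inverse (f q) = g q)"
    using f'(2) g(2) by eventually_elim (simp add: inverse_unique)
  then show "smooth_near p (\<lambda>q. inverse (f q))"
    by (rule smooth_nearI[OF g(1)])
  show "near p (\<lambda>q. f q \<noteq> 0)"
    using f'(2) g(2) by eventually_elim auto
qed

lemma smooth_if_smooth_near: "(\<And>p. p \<in> points M \<Longrightarrow> smooth_near p f) \<Longrightarrow> f \<in> smooth_functions M"
  by (rule smooth_germI) (simp add: smooth_near_def)

text \<open>
  Gaussian elimination over the ring of germs of smooth functions. The equations are indexed by an
  arbitrary set, so no finite subsystem of full rank has to be selected in advance.
\<close>

lemma smooth_near_solve:
  fixes B :: "'b set" and A :: "'b \<Rightarrow> nat \<Rightarrow> 'a \<Rightarrow> real"
  assumes p: "p \<in> points M"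
    and eq: "\<And>b. b \<in> B \<Longrightarrow> near p (\<lambda>q. (\<Sum>j<m. A b j q * z j q) = y b q)"
    and A: "\<And>b j. b \<in> B \<Longrightarrow> j < m \<Longrightarrow> smooth_near p (A b j)"
    and y: "\<And>b. b \<in> B \<Longrightarrow> smooth_near p (y b)"
    and inj: "\<And>c j. (\<And>b. b \<in> B \<Longrightarrow> (\<Sum>j<m. A b j p * c j) = 0) \<Longrightarrow> j < m \<Longrightarrow> c j = 0"
    and k: "k < m"
  shows "smooth_near p (z k)"
  using eq A y inj k
proof (induction m arbitrary: A y k)
  case 0
  then show ?case
    by simp
next
  case (Suc m)
  \<comment> \<open>If the last column vanished at \<open>p\<close>, the unit vector with index
    \<open>m\<close> would lie in the kernel there.\<close>
  have "\<exists>b\<in>B. A b m p \<noteq> 0"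
  proof (rule ccontr)
    assume "\<not> ?thesis"
    then have "(\<Sum>j<Suc m. A b j p * (if j = m then 1 else 0)) = 0" if "b \<in> B" for b
      using that by simp
    then show False
      using Suc.prems(4)[of "\<lambda>j. if j = m then 1 else 0" m] by simp
  qed
  then obtain b0 where b0: "b0 \<in> B" "A b0 m p \<noteq> 0"
    by blast
  \<comment> \<open>A pivot that is nonzero at \<open>p\<close> is invertible near \<open>p\<close>,
    and its inverse is again smooth near \<open>p\<close>.\<close>
  define a where "a = (\<lambda>q. inverse (A b0 m q))"
  have a: "smooth_near p a" "near p (\<lambda>q. A b0 m q \<noteq> 0)"
    unfolding a_def using smooth_near_inverse[OF Suc.prems(2)[OF b0(1)] p b0(2)] by auto
  \<comment> \<open>Subtracting a multiple of the pivot equation removes the unknown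
    \<open>z m\<close>. Only coefficients and right-hand sides enter the hypotheses on smoothness;
    nothing is assumed about the unknowns.\<close>
  have IH: "smooth_near p (z k)" if "k < m" for k
  proof (rule Suc.IH[where A = "\<lambda>b j q. A b j q - A b m q * (A b0 j q * a q)"
        and y = "\<lambda>b q. y b q - A b m q * (y b0 q * a q)"])
    fix b assume b: "b \<in> B"
    show "near p (\<lambda>q. (\<Sum>j<m. (A b j q - A b m q * (A b0 j q * a q)) * z j q)
        = y b q - A b m q * (y b0 q * a q))"
      using Suc.prems(1)[OF b] Suc.prems(1)[OF b0(1)] a(2)
    proof eventually_elim
      case (elim q)
      have "(\<Sum>j<m. (A b j q - A b m q * (A b0 j q * a q)) * z j q)
          = (\<Sum>j<m. A b j q * z j q) - A b m q * a q * (\<Sum>j<m. A b0 j q * z j q)"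
        by (simp add: sum_subtractf sum_distrib_left algebra_simps)
      also have "(\<Sum>j<m. A b j q * z j q) = y b q - A b m q * z m q"
        using elim(1) by simp
      also have "(\<Sum>j<m. A b0 j q * z j q) = y b0 q - A b0 m q * z m q"
        using elim(2) by simp
      also have "y b q - A b m q * z m q - A b m q * a q * (y b0 q - A b0 m q * z m q)
          = y b q - A b m q * (y b0 q * a q)"
        using elim(3) by (simp add: a_def field_simps)
      finally show ?case .
    qed
    show "smooth_near p (\<lambda>q. y b q - A b m q * (y b0 q * a q))"
      by (rule smooth_near_minus[OF Suc.prems(3)[OF b] smooth_near_mult[OF Suc.prems(2)[OF b]
              smooth_near_mult[OF Suc.prems(3)[OF b0(1)] a(1)]]]) simp
    show "smooth_near p (\<lambda>q. A b j q - A b m q * (A b0 j q * a q))" if "j < m" for j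
      by (rule smooth_near_minus[OF Suc.prems(2)[OF b] smooth_near_mult[OF Suc.prems(2)[OF b]
              smooth_near_mult[OF Suc.prems(2)[OF b0(1)] a(1)]]]) (use that in simp_all)
  next
    fix c :: "nat \<Rightarrow> real" and j
    assume c: "\<And>b. b \<in> B \<Longrightarrow> (\<Sum>j<m. (A b j p - A b m p * (A b0 j p * a p)) * c j) = 0" and j: "j < m"
    \<comment> \<open>A kernel vector of the reduced system at \<open>p\<close> extends to one of
      the full system: the last entry is dictated by the pivot equation. Injectivity thus passes to
      the reduced system.\<close>
    define c' where "c' = c(m := - a p * (\<Sum>j<m. A b0 j p * c j))"
    have "(\<Sum>j<Suc m. A b j p * c' j) = 0" if b: "b \<in> B" for b
    proof -
      have "(\<Sum>j<Suc m. A b j p * c' j)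
          = (\<Sum>j<m. A b j p * c j) - A b m p * a p * (\<Sum>j<m. A b0 j p * c j)"
        by (simp add: c'_def)
      also have "\<dots> = (\<Sum>j<m. (A b j p - A b m p * (A b0 j p * a p)) * c j)"
        by (simp add: sum_subtractf sum_distrib_left algebra_simps)
      finally show ?thesis
        using c[OF b] by simp
    qed
    then have "c' j = 0"
      using Suc.prems(4)[of c' j] j by simp
    then show "c j = 0"
      using j by (simp add: c'_def)
  qed (rule that)
  \<comment> \<open>Back substitution: the pivot equation expresses \<open>z m\<close> through the
    unknowns already treated.\<close>
  have "smooth_near p (z m)"
  proof (rule smooth_near_cong)
    show "smooth_near p (\<lambda>q. (y b0 q - (\<Sum>j<m. A b0 j q * z j q)) * a q)"
    proof (rule smooth_near_mult[OF smooth_near_minus[OF Suc.prems(3)[OF b0(1)] smooth_near_sum] a(1)])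
      show "smooth_near p (\<lambda>q. A b0 j q * z j q)" if "j \<in> {..<m}" for j
        by (rule smooth_near_mult[OF Suc.prems(2)[OF b0(1)] IH]) (use that in auto)
    qed
    show "near p (\<lambda>q. z m q = (y b0 q - (\<Sum>j<m. A b0 j q * z j q)) * a q)"
      using Suc.prems(1)[OF b0(1)] a(2)
    proof eventually_elim
      case (elim q)
      then have "y b0 q - (\<Sum>j<m. A b0 j q * z j q) = A b0 m q * z m q"
        by simp
      then show ?case
        using elim(2) by (simp add: a_def)
    qed
  qed
  then show ?case
    using IH Suc.prems(5) by (cases "k = m") auto
qed

end

section \<open>Immersed submanifolds\<close>

locale immersed_mfd = M: smooth_mfd M + N: smooth_mfd N for M N :: "'a manifold" +
  assumes immersed: "immersed_submanifold M N"
begin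

lemma points_subset: "points N \<subseteq> points M"
  using immersed by (simp add: immersed_submanifold_def)

lemma points_M: "p \<in> points N \<Longrightarrow> p \<in> points M"
  using points_subset by (rule subsetD)

lemma open_restrict: "openin (mtop M) W \<Longrightarrow> openin (mtop N) {q \<in> points N. q \<in> W}"
  using immersed openin_continuous_map_preimage[of "mtop N" "mtop M" "\<lambda>p. p" W]
  by (simp add: immersed_submanifold_def smooth_map_def)

lemma near_restrict:
  assumes P: "M.near p P" and p: "p \<in> points N"
  shows "N.near p P"
proof -
  obtain W where W: "openin (mtop M) W" "p \<in> W" "\<forall>q\<in>W. P q"
    using P unfolding M.near_iff[OF points_M[OF p]] by blast
  have "N.near p (\<lambda>q. q \<in> {q \<in> points N. q \<in> W})"
    by (rule N.near_open[OF open_restrict[OF W(1)]]) (use p W in simp)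
  then show ?thesis
    by eventually_elim (use W in simp)
qed

lemma smooth_restrict:
  assumes f: "f \<in> smooth_functions M"
  shows "f \<in> smooth_functions N"
proof (rule N.smoothI)
  fix p assume p: "p \<in> points N"
  obtain U \<phi> where U: "(U, \<phi>) \<in> atlas N" "p \<in> U"
    using N.chart_exists[OF p] .
  obtain V \<psi> where V: "(V, \<psi>) \<in> atlas M" "p \<in> V"
    using M.chart_exists[OF points_M[OF p]] .
  define W where "W = U \<inter> {q \<in> points N. q \<in> V}"
  have W: "openin (mtop N) W" "W \<subseteq> U" "W \<subseteq> V" "p \<in> W"
    using N.chart_open[OF U(1)] open_restrict[OF M.chart_open[OF V(1)]] U(2) V(2) p
    by (auto simp: W_def)
  have "smooth_on N W f"
  proof (rule N.smooth_on_chartI[OF U(1) W(1,2)])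
    show "C_infinity_on (mdim N) (\<phi> ` W) (\<lambda>x. f (inv_into V \<psi> (\<psi> (inv_into U \<phi> x))))"
      unfolding C_infinity_on_def
    proof (rule allI, rule C_k_on_compose[OF M.chart_image_open[OF V(1)] N.chart_open_image[OF U(1) W(1,2)],
          where F = "\<lambda>x. \<psi> (inv_into U \<phi> x)" and g = "\<lambda>x. f (inv_into V \<psi> x)"])
      fix k
      show "(\<lambda>x. \<psi> (inv_into U \<phi> x)) ` \<phi> ` W \<subseteq> \<psi> ` V"
      proof clarify
        fix q assume "q \<in> W"
        then have "q \<in> U" "q \<in> V"
          using W by auto
        then show "\<psi> (inv_into U \<phi> (\<phi> q)) \<in> \<psi> ` V"
          by (simp add: N.chart_inv[OF U(1)])
      qed
      show "C_k_on k (mdim M) (\<psi> ` V) (\<lambda>x. f (inv_into V \<psi> x))"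
        using C_infinity_on_k[OF M.smooth_on_chartD[OF V(1)
              M.smooth_on_smooth[OF f M.chart_subset[OF V(1)]]]] by simp
      show "C_k_on k (mdim N) (\<phi> ` W) (\<lambda>x. \<psi> (inv_into U \<phi> x) j)" if "j < mdim M" for j
      proof (rule C_k_on_mono)
        have "smooth_map N M (\<lambda>p. p)"
          using immersed by (simp add: immersed_submanifold_def)
        then show "C_k_on k (mdim N) (\<phi> ` (U \<inter> (\<lambda>p. p) -` V)) (\<lambda>x. \<psi> (inv_into U \<phi> x) j)"
          unfolding smooth_map_def using U(1) V(1) that C_infinity_on_k by fast
      qed (use W in auto)
    qed
    show "f q = f (inv_into V \<psi> (\<psi> (inv_into U \<phi> (\<phi> q))))" if "q \<in> W" for q
      using N.chart_inv[OF U(1), of q] M.chart_inv[OF V(1), of q] subsetD[OF W(2) that]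
        subsetD[OF W(3) that] by simp
  qed
  then show "\<exists>W. openin (mtop N) W \<and> p \<in> W \<and> smooth_on N W f"
    using W by blast
qed

text \<open>Points of \<open>N\<close> are points of \<open>M\<close>, so composing with the
  inclusion leaves a function unchanged. \<open>push\<close> merely forgets the action of a
  derivation on functions that are not smooth on \<open>M\<close>.\<close>

lemma push_apply: "f \<in> smooth_functions M \<Longrightarrow> push N M v f = v f"
  and push_outside: "f \<notin> smooth_functions M \<Longrightarrow> push N M v f = 0"
  by (simp_all add: push_def differential_def comp_def)

lemma push_comb:
  "push N M (\<lambda>f. a * v f + b * w f) = (\<lambda>f. a * push N M v f + b * push N M w f)"
  by (auto simp: push_def differential_def)

lemma push_tangent:
  assumes v: "v \<in> tangent_space N p"
  shows "push N M v \<in> tangent_space M p"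
  unfolding tangent_space_def
  using N.tangent_lincomb[OF v smooth_restrict smooth_restrict]
    N.tangent_mult[OF v smooth_restrict smooth_restrict]
  by (simp add: push_apply push_outside M.smooth_add M.smooth_mult)

lemma push_inj: "p \<in> points N \<Longrightarrow> inj_on (push N M) (tangent_space N p)"
  using immersed by (simp add: immersed_submanifold_def)

lemma push_eqD:
  "push N M v = push N M w \<Longrightarrow> p \<in> points N \<Longrightarrow> v \<in> tangent_space N p \<Longrightarrow> w \<in> tangent_space N p \<Longrightarrow> v = w"
  using push_inj by (meson inj_onD)

lemma linear_on_tangent_push:
  assumes "linear_on_tangent M p \<xi>"
  shows "linear_on_tangent N p (\<lambda>v. \<xi> (push N M v))"
  using assms unfolding linear_on_tangent_def by (simp add: push_comb push_tangent)

text \<open>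
  The functions on \<open>N\<close> that extend to \<open>M\<close> separate the tangent vectors of \<open>N\<close>, as the inclusion
  is an immersion; so they suffice to test the smoothness of a vector field on \<open>N\<close>.
\<close>

lemma vector_field_restrictI:
  assumes Z: "\<And>q. q \<in> points N \<Longrightarrow> Z q \<in> tangent_space N q"
    and ZF: "\<And>F. F \<in> smooth_functions M \<Longrightarrow> (\<lambda>q. Z q F) \<in> smooth_functions N"
  shows "Z \<in> vector_fields N"
proof (rule N.vector_fieldI[OF Z])
  fix f assume f: "f \<in> smooth_functions N"
  show "(\<lambda>q. Z q f) \<in> smooth_functions N"
  proof (rule N.smooth_if_smooth_near)
    fix p assume p: "p \<in> points N"
    obtain x E where frame: "N.frame_at p x E"
      using N.frame_exists[OF p] .
    have expand: "N.near p (\<lambda>q. \<forall>f. Z q f = (\<Sum>j<mdim N. Z q (x j) * E j q f))"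
      using N.frame_atD(3)[OF frame] N.near_points[OF p]
    proof eventually_elim
      case (elim q)
      then have "Z q = (\<lambda>f. \<Sum>j<mdim N. Z q (x j) * E j q f)"
        using Z by blast
      from fun_cong[OF this] show ?case
        by (rule allI)
    qed
    \<comment> \<open>The unknowns are the frame coefficients of \<open>Z\<close>. Every smooth
      \<open>F\<close> on \<open>M\<close> gives one equation: its coefficients are the derivatives
      of \<open>F\<close> along the frame, and its right-hand side is smooth by assumption.\<close>
    have "N.smooth_near p (\<lambda>q. Z q (x j))" if j: "j < mdim N" for j
    proof (rule N.smooth_near_solve[OF p, where B = "smooth_functions M" and m = "mdim N"
          and A = "\<lambda>F j q. E j q F" and y = "\<lambda>F q. Z q F"])
      show "N.near p (\<lambda>q. (\<Sum>j<mdim N. E j q F * Z q (x j)) = Z q F)" for F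
        using expand
      proof eventually_elim
        case (elim q)
        from spec[OF this, of F] show ?case
          by (simp add: mult.commute)
      qed
      show "N.smooth_near p (\<lambda>q. E j q F)" if "F \<in> smooth_functions M" "j < mdim N" for F j
        by (rule N.smooth_near_smooth[OF N.vector_field_smooth[OF N.frame_atD(2)[OF frame that(2)]
                smooth_restrict[OF that(1)]]])
      show "N.smooth_near p (\<lambda>q. Z q F)" if "F \<in> smooth_functions M" for F
        by (rule N.smooth_near_smooth[OF ZF[OF that]])
      fix c :: "nat \<Rightarrow> real" and i
      assume c: "\<And>F. F \<in> smooth_functions M \<Longrightarrow> (\<Sum>j<mdim N. E j p F * c j) = 0" and i: "i < mdim N"
      let ?v = "\<lambda>f. \<Sum>j<mdim N. c j * E j p f"
      have v: "?v \<in> tangent_space N p"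
        by (rule N.tangent_vec_sum) (use N.frame_atD(2)[OF frame] N.vector_field_tangent p in auto)
      \<comment> \<open>A kernel vector of the system at \<open>p\<close> is a tangent vector that
        annihilates every smooth function of \<open>M\<close>, so it is pushed to \<open>0\<close>;
        the immersion then makes it \<open>0\<close>.\<close>
      have "push N M ?v = push N M (\<lambda>f. 0)"
        using c by (auto simp: push_def differential_def comp_def mult.commute)
      then have "?v = (\<lambda>f. 0)"
        by (rule push_eqD[OF _ p v N.tangent_zero])
      then have "0 = ?v (x i)"
        by (rule fun_cong[symmetric])
      also have "\<dots> = (\<Sum>j<mdim N. if j = i then c j else 0)"
        using N.frame_atD(4)[OF frame i] by (intro sum.cong) auto
      also have "\<dots> = c i"
        using i by simp
      finally show "c i = 0"
        by simp
    qed (rule j)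
    then have "N.smooth_near p (\<lambda>q. \<Sum>j<mdim N. Z q (x j) * E j q f)"
      using N.vector_field_smooth[OF N.frame_atD(2)[OF frame] f]
      by (intro N.smooth_near_sum N.smooth_near_mult) (auto intro: N.smooth_near_smooth)
    then show "N.smooth_near p (\<lambda>q. Z q f)"
      by (rule N.smooth_near_cong) (rule eventually_mono[OF expand], erule spec)
  qed
qed

text \<open>Relatedness along the inclusion: \<open>A\<close> is a field on \<open>M\<close> tangent
  to \<open>N\<close> along \<open>N\<close>, and \<open>X\<close> is its lift. Brackets respect it,
  so computations on the leaf can be done on \<open>M\<close>.\<close>

definition related :: "('a \<Rightarrow> 'a tvec) \<Rightarrow> ('a \<Rightarrow> 'a tvec) \<Rightarrow> bool" where
  "related X A \<longleftrightarrow> X \<in> vector_fields N \<and> A \<in> vector_fields M \<and> (\<forall>q\<in>points N. push N M (X q) = A q)"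

lemma relatedD:
  assumes "related X A"
  shows "X \<in> vector_fields N" "A \<in> vector_fields M" "q \<in> points N \<Longrightarrow> push N M (X q) = A q"
  using assms by (auto simp: related_def)

lemma related_apply:
  assumes "related X A" "q \<in> points N" "f \<in> smooth_functions M"
  shows "X q f = A q f"
  using relatedD(3)[OF assms(1,2)] push_apply[OF assms(3)] by metis

text \<open>The function \<open>g\<close> may make sense only on the leaf, for instance one built
  from the presymplectic form; agreement on \<open>N\<close> with a smooth function of
  \<open>M\<close> is enough to compute its derivative on \<open>M\<close>.\<close>

lemma related_derivative:
  assumes X: "related X A" and p: "p \<in> points N" and f: "f \<in> smooth_functions M"
    and fg: "\<And>q. q \<in> points N \<Longrightarrow> f q = g q"
  shows "X p g = A p f"
proof -
  have "X p f = X p g"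
    using fg by (rule N.tangent_cong[OF N.vector_field_tangent[OF relatedD(1)[OF X] p] p smooth_restrict[OF f]])
  then show ?thesis
    using related_apply[OF X p f] by simp
qed

lemma related_lie_bracket:
  assumes X: "related X A" and Y: "related Y B"
  shows "related (lie_bracket N X Y) (lie_bracket M A B)"
  unfolding related_def
proof (intro conjI ballI)
  fix q assume q: "q \<in> points N"
  show "push N M (lie_bracket N X Y q) = lie_bracket M A B q"
  proof
    fix f
    show "push N M (lie_bracket N X Y q) f = lie_bracket M A B q f"
    proof (cases "f \<in> smooth_functions M")
      case True
      have "X q (\<lambda>q. Y q f) = A q (\<lambda>q. B q f)"
        by (rule related_derivative[OF X q M.vector_field_smooth[OF relatedD(2)[OF Y] True]])
          (simp add: related_apply[OF Y _ True])
      moreover have "Y q (\<lambda>q. X q f) = B q (\<lambda>q. A q f)"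
        by (rule related_derivative[OF Y q M.vector_field_smooth[OF relatedD(2)[OF X] True]])
          (simp add: related_apply[OF X _ True])
      ultimately show ?thesis
        using True by (simp add: push_apply N.lie_bracket_apply M.lie_bracket_apply smooth_restrict)
    next
      case False
      then show ?thesis
        by (simp add: push_outside lie_bracket_def)
    qed
  qed
qed (rule N.lie_bracket_vector_field[OF relatedD(1)[OF X] relatedD(1)[OF Y]]
    M.lie_bracket_vector_field[OF relatedD(2)[OF X] relatedD(2)[OF Y]])+

end

section \<open>Torsion and Dirac structures\<close>

context smooth_mfd
begin

text \<open>Linearity of a tensor is known only at points of \<open>M\<close>, so its image of a sum
  of fields has the expected value there and possibly not elsewhere. The bracket has to be
  insensitive to this.\<close>

lemma lie_bracket_cong:
  assumes X: "X \<in> vector_fields M" and Y: "Y \<in> vector_fields M" and p: "p \<in> points M"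
    and YY': "\<And>q. q \<in> points M \<Longrightarrow> Y q = Y' q"
  shows "lie_bracket M X Y p = lie_bracket M X Y' p"
proof
  fix f
  show "lie_bracket M X Y p f = lie_bracket M X Y' p f"
  proof (cases "f \<in> smooth_functions M")
    case True
    have "X p (\<lambda>q. Y q f) = X p (\<lambda>q. Y' q f)"
      by (rule tangent_cong[OF vector_field_tangent[OF X p] p vector_field_smooth[OF Y True]])
        (simp add: YY')
    then show ?thesis
      by (simp add: lie_bracket_def YY'[OF p])
  qed (simp add: lie_bracket_def)
qed

section \<open>The Nijenhuis torsion of a tensor field\<close>

context
  fixes r assumes r: "r \<in> tensors11 M"
begin

lemma tensor_linear: "p \<in> points M \<Longrightarrow> linear_on_tangent M p (\<lambda>v. r p v f)"
  by (rule tensors11_linear[OF r])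

lemma tensor_tensor_linear: "p \<in> points M \<Longrightarrow> linear_on_tangent M p (\<lambda>v. r p (r p v) f)"
  using r unfolding linear_on_tangent_def by (simp add: tensors11_comb tensors11_tangent)

lemma dual_form_one_form:
  assumes \<alpha>: "\<alpha> \<in> one_forms M"
  shows "dual_form M r \<alpha> \<in> one_forms M"
proof -
  have "dual_form M r \<alpha> p \<in> cotangent_space M p" if p: "p \<in> points M" for p
    using one_form_linear[OF \<alpha> p] r p
    unfolding cotangent_space_def linear_on_tangent_def dual_form_def dual_map_def
    by (simp add: tensors11_comb tensors11_tangent tangent_comb)
  moreover have "(\<lambda>p. dual_form M r \<alpha> p (X p)) \<in> smooth_functions M" if X: "X \<in> vector_fields M" for X
    by (rule smooth_cong[OF one_form_smooth[OF \<alpha> tensors11_vector_field[OF r X]]])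
      (simp add: dual_form_def dual_map_def apply_tensor_def vector_field_tangent[OF X])
  ultimately show ?thesis
    by (simp add: one_forms_def one_form_on_def smooth_on_points_iff)
qed

text \<open>The Nijenhuis expression with the outer \<open>r\<close> distributed over the three
  terms. Each summand is then a linear function of one Lie bracket, and the generic bracket rules
  apply to it.\<close>

definition torsion :: "('a \<Rightarrow> 'a tvec) \<Rightarrow> ('a \<Rightarrow> 'a tvec) \<Rightarrow> 'a \<Rightarrow> 'a tvec" where
  "torsion X Y p = (\<lambda>f. lie_bracket M (apply_tensor r X) (apply_tensor r Y) p f
    - r p (lie_bracket M (apply_tensor r X) Y p) f - r p (lie_bracket M X (apply_tensor r Y) p) f
    + r p (r p (lie_bracket M X Y p)) f)"

lemma nijenhuis_iff_torsion:
  "nijenhuis M r \<longleftrightarrow>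
    (\<forall>X\<in>vector_fields M. \<forall>Y\<in>vector_fields M. \<forall>p\<in>points M. \<forall>f. torsion X Y p f = 0)"
proof -
  have "r p (\<lambda>g. lie_bracket M (apply_tensor r X) Y p g + lie_bracket M X (apply_tensor r Y) p g
      - r p (lie_bracket M X Y p) g) f
    = r p (lie_bracket M (apply_tensor r X) Y p) f + r p (lie_bracket M X (apply_tensor r Y) p) f
      - r p (r p (lie_bracket M X Y p)) f"
    if X: "X \<in> vector_fields M" and Y: "Y \<in> vector_fields M" and p: "p \<in> points M" for X Y p f
  proof -
    note br = vector_field_tangent[OF lie_bracket_vector_field p]
    note rX = tensors11_vector_field[OF r X] and rY = tensors11_vector_field[OF r Y]
    note t = br[OF rX Y] br[OF X rY] tensors11_tangent[OF r p br[OF X Y]]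
    show ?thesis
      using linear_on_tangent_minus[OF tensor_linear[OF p] tangent_comb[OF t(1,2), of 1 1] t(3)]
        linear_on_tangent_add[OF tensor_linear[OF p] t(1,2)] by simp
  qed
  then have "lie_bracket M (apply_tensor r X) (apply_tensor r Y) p f
      - r p (\<lambda>g. lie_bracket M (apply_tensor r X) Y p g + lie_bracket M X (apply_tensor r Y) p g
        - r p (lie_bracket M X Y p) g) f = torsion X Y p f"
    if "X \<in> vector_fields M" "Y \<in> vector_fields M" "p \<in> points M" for X Y p f
    using that by (simp add: torsion_def)
  then show ?thesis
    unfolding nijenhuis_def by (simp only: cong: ball_cong)
qed

lemma tangent_torsion:
  assumes X: "X \<in> vector_fields M" and Y: "Y \<in> vector_fields M" and p: "p \<in> points M"
  shows "torsion X Y p \<in> tangent_space M p"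
proof -
  note br = vector_field_tangent[OF lie_bracket_vector_field p]
  note rX = tensors11_vector_field[OF r X] and rY = tensors11_vector_field[OF r Y]
  note rt = tensors11_tangent[OF r p]
  show ?thesis
    using tangent_comb[OF tangent_comb[OF br[OF rX rY] rt[OF br[OF rX Y]], of 1 "- 1"]
        tangent_comb[OF rt[OF br[OF X rY]] rt[OF rt[OF br[OF X Y]]], of "- 1" 1], of 1 1]
    unfolding torsion_def by (simp add: algebra_simps)
qed

lemma torsion_antisym:
  assumes X: "X \<in> vector_fields M" and Y: "Y \<in> vector_fields M" and p: "p \<in> points M"
  shows "torsion Y X p f = - torsion X Y p f"
proof -
  note br = vector_field_tangent[OF lie_bracket_vector_field p]
  note rX = tensors11_vector_field[OF r X] and rY = tensors11_vector_field[OF r Y]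
  show ?thesis
    unfolding torsion_def lie_bracket_antisym[of Y X] lie_bracket_antisym[of "apply_tensor r Y" X]
      lie_bracket_antisym[of Y "apply_tensor r X"]
      lie_bracket_antisym[of "apply_tensor r Y" "apply_tensor r X"]
    by (simp add: linear_on_tangent_uminus[OF tensor_linear[OF p] br[OF rX Y]]
        linear_on_tangent_uminus[OF tensor_linear[OF p] br[OF X rY]]
        linear_on_tangent_uminus[OF tensor_tensor_linear[OF p] br[OF X Y]])
qed

text \<open>For \<open>h\<close> times \<open>Y\<close>, the derivatives of \<open>h\<close> cancel
  in pairs: the two along \<open>r X\<close> both multiply \<open>r Y\<close>, the two along
  \<open>X\<close> both multiply \<open>r\<close> applied twice to \<open>Y\<close>, with opposite
  signs each time.\<close>

lemma tensorial_torsion: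
  assumes X: "X \<in> vector_fields M" and p: "p \<in> points M"
  shows "tensorial p (\<lambda>Y. torsion X Y p f)"
proof -
  note rX = tensors11_vector_field[OF r X] and rV = tensors11_vector_field[OF r]
  have l0: "linear_on_tangent M p (\<lambda>v. v f)"
    by (simp add: linear_on_tangent_def)
  note l1 = tensor_linear[OF p, of f] and l2 = tensor_tensor_linear[OF p, of f]
  have add: "lie_bracket M A (apply_tensor r (\<lambda>q f. Y q f + Z q f)) p
      = lie_bracket M A (\<lambda>q f. apply_tensor r Y q f + apply_tensor r Z q f) p"
    if A: "A \<in> vector_fields M" and Y: "Y \<in> vector_fields M" and Z: "Z \<in> vector_fields M" for A Y Z
  proof (rule lie_bracket_cong[OF A rV[OF vector_field_add[OF Y Z]] p])
    fix q assume q: "q \<in> points M"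
    show "apply_tensor r (\<lambda>q f. Y q f + Z q f) q = (\<lambda>f. apply_tensor r Y q f + apply_tensor r Z q f)"
      using tensors11_comb[OF r q vector_field_tangent[OF Y q] vector_field_tangent[OF Z q], of 1 1]
      by (simp add: apply_tensor_def)
  qed
  have scale: "lie_bracket M A (apply_tensor r (\<lambda>q f. h q * Y q f)) p
      = lie_bracket M A (\<lambda>q f. h q * apply_tensor r Y q f) p"
    if A: "A \<in> vector_fields M" and Y: "Y \<in> vector_fields M" and h: "h \<in> smooth_functions M" for A Y h
  proof (rule lie_bracket_cong[OF A rV[OF vector_field_scale[OF h Y]] p])
    fix q assume q: "q \<in> points M"
    show "apply_tensor r (\<lambda>q f. h q * Y q f) q = (\<lambda>f. h q * apply_tensor r Y q f)"
      using tensors11_comb[OF r q vector_field_tangent[OF Y q] vector_field_tangent[OF Y q], of "h q" 0]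
      by (simp add: apply_tensor_def)
  qed
  show ?thesis
    unfolding tensorial_def
  proof (intro conjI ballI)
    fix Y Z assume Y: "Y \<in> vector_fields M" and Z: "Z \<in> vector_fields M"
    show "torsion X (\<lambda>q f. Y q f + Z q f) p f = torsion X Y p f + torsion X Z p f"
      unfolding torsion_def add[OF X Y Z] add[OF rX Y Z]
      using one_form_bracket_add[OF rX rV[OF Y] rV[OF Z] p l0]
        one_form_bracket_add[OF rX Y Z p l1] one_form_bracket_add[OF X rV[OF Y] rV[OF Z] p l1]
        one_form_bracket_add[OF X Y Z p l2]
      by simp
  next
    fix h Y assume h: "h \<in> smooth_functions M" and Y: "Y \<in> vector_fields M"
    show "torsion X (\<lambda>q f. h q * Y q f) p f = h p * torsion X Y p f"
      unfolding torsion_def scale[OF X Y h] scale[OF rX Y h]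
      using one_form_bracket_scale[OF rX rV[OF Y] h p l0]
        one_form_bracket_scale[OF rX Y h p l1] one_form_bracket_scale[OF X rV[OF Y] h p l1]
        one_form_bracket_scale[OF X Y h p l2]
      by (simp add: apply_tensor_def algebra_simps)
  qed
qed

lemma torsion_pointwise:
  assumes p: "p \<in> points M"
    and X: "X \<in> vector_fields M" "X' \<in> vector_fields M" "X p = X' p"
    and Y: "Y \<in> vector_fields M" "Y' \<in> vector_fields M" "Y p = Y' p"
  shows "torsion X Y p f = torsion X' Y' p f"
proof -
  have "torsion X Y p f = torsion X Y' p f"
    by (rule tensorial_pointwise[OF tensorial_torsion[OF X(1) p] p Y])
  also have "\<dots> = - torsion Y' X p f"
    by (rule torsion_antisym[OF Y(2) X(1) p])
  also have "torsion Y' X p f = torsion Y' X' p f"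
    by (rule tensorial_pointwise[OF tensorial_torsion[OF Y(2) p] p X])
  also have "- torsion Y' X' p f = torsion X' Y' p f"
    by (rule torsion_antisym[OF Y(2) X(2) p, symmetric])
  finally show ?thesis .
qed

end

lemma one_form_sum:
  fixes c :: "'b \<Rightarrow> real"
  assumes "\<And>i. i \<in> I \<Longrightarrow> \<alpha> i \<in> one_forms M"
  shows "(\<lambda>q v. \<Sum>i\<in>I. c i * \<alpha> i q v) \<in> one_forms M"
proof -
  have cot: "\<alpha> i q \<in> cotangent_space M q" if "i \<in> I" "q \<in> points M" for i q
    using assms[OF that(1)] that(2) by (simp add: one_forms_def one_form_on_def)
  have "(\<lambda>v. \<Sum>i\<in>I. c i * \<alpha> i q v) \<in> cotangent_space M q" if "q \<in> points M" for q
    using cot[OF _ that] unfolding cotangent_space_def linear_on_tangent_def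
    by (simp add: sum.distrib sum_distrib_left algebra_simps)
  moreover have "(\<lambda>q. \<Sum>i\<in>I. c i * \<alpha> i q (X q)) \<in> smooth_functions M" if "X \<in> vector_fields M" for X
    by (rule smooth_sum, rule smooth_mult[OF smooth_const], rule one_form_smooth[OF assms that])
  ultimately show ?thesis
    by (simp add: one_forms_def one_form_on_def smooth_on_points_iff)
qed

end

section \<open>Sections of a Dirac structure\<close>

locale dirac_mfd = smooth_mfd M for M :: "'a manifold" +
  fixes L :: "'a subset_TM"
  assumes dirac: "dirac_structure M L"
begin

lemma L_iff:
  assumes "p \<in> points M"
  shows "(v, \<xi>) \<in> L p \<longleftrightarrow> v \<in> tangent_space M p \<and> \<xi> \<in> cotangent_space M p \<and>
    (\<forall>(w, \<eta>)\<in>L p. \<eta> v + \<xi> w = 0)"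
proof -
  have "L p = orthogonal_TM M L p"
    using dirac assms by (simp add: dirac_structure_def)
  then have "(v, \<xi>) \<in> L p \<longleftrightarrow> (v, \<xi>) \<in> orthogonal_TM M L p"
    by simp
  then show ?thesis
    by (simp add: orthogonal_TM_def)
qed

lemma L_cotangent: "p \<in> points M \<Longrightarrow> (v, \<xi>) \<in> L p \<Longrightarrow> \<xi> \<in> cotangent_space M p"
  by (simp add: L_iff)

lemma L_linear: "p \<in> points M \<Longrightarrow> (v, \<xi>) \<in> L p \<Longrightarrow> linear_on_tangent M p \<xi>"
  using L_cotangent by (simp add: cotangent_space_def)

lemma L_isotropic:
  assumes "p \<in> points M" "(v, \<xi>) \<in> L p" "(w, \<eta>) \<in> L p"
  shows "\<eta> v + \<xi> w = 0"
proof -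
  have "\<forall>(w, \<eta>)\<in>L p. \<eta> v + \<xi> w = 0"
    using L_iff[OF assms(1), THEN iffD1, OF assms(2)] by (elim conjE)
  from bspec[OF this assms(3)] show ?thesis
    by simp
qed

lemma L_zero:
  assumes p: "p \<in> points M"
  shows "((\<lambda>f. 0), (\<lambda>v. 0)) \<in> L p"
proof -
  have "\<forall>(w, \<eta>)\<in>L p. \<eta> (\<lambda>f. 0) + 0 = 0"
  proof clarify
    fix w \<eta> assume "(w, \<eta>) \<in> L p"
    then have "linear_on_tangent M p \<eta>"
      by (rule L_linear[OF p])
    then have "\<eta> (\<lambda>f. 0 * 0) = 0 * \<eta> (\<lambda>f. 0)"
      by (rule linear_on_tangent_scale) (rule tangent_zero)
    then show "\<eta> (\<lambda>f. 0) + 0 = 0"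
      by simp
  qed
  moreover have "(\<lambda>v. 0) \<in> cotangent_space M p"
    by (simp add: cotangent_space_def linear_on_tangent_def)
  ultimately show ?thesis
    by (intro L_iff[OF p, THEN iffD2] conjI tangent_zero)
qed

lemma sectionD:
  assumes "(A, \<alpha>) \<in> sections M L"
  shows "A \<in> vector_fields M" "\<alpha> \<in> one_forms M" "p \<in> points M \<Longrightarrow> (A p, \<alpha> p) \<in> L p"
  using assms by (auto simp: sections_def)

text \<open>A combination with constant coefficients of a local frame of \<open>L\<close>,
  multiplied by a bump, stays in \<open>L\<close> inside \<open>U\<close> and is the zero element of
  \<open>L\<close> outside. Only the vector part at \<open>p\<close> is prescribed, which is all
  that the tangent space of a leaf sees.\<close>

lemma section_exists:
  assumes p: "p \<in> points M" and L: "(w, \<xi>) \<in> L p"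
  obtains A \<alpha> where "(A, \<alpha>) \<in> sections M L" "A p = w"
proof -
  obtain k where k: "\<forall>p\<in>points M. \<exists>U. openin (mtop M) U \<and> p \<in> U \<and>
     (\<exists>X \<alpha>. (\<forall>i<k. vector_field_on M U (X i) \<and> one_form_on M U (\<alpha> i)) \<and>
       (\<forall>q\<in>U.
          L q = {(\<lambda>f. \<Sum>i<k. c i * X i q f, \<lambda>v. \<Sum>i<k. c i * \<alpha> i q v) | c :: nat \<Rightarrow> real. True} \<and>
          (\<forall>c :: nat \<Rightarrow> real.
             (\<forall>f. (\<Sum>i<k. c i * X i q f) = 0) \<and> (\<forall>v. (\<Sum>i<k. c i * \<alpha> i q v) = 0)
             \<longrightarrow> (\<forall>i<k. c i = 0))))"
    using dirac unfolding dirac_structure_def smooth_subbundle_def by (elim conjE exE)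
  obtain U X \<alpha> where U: "openin (mtop M) U" "p \<in> U"
    and X: "\<forall>i<k. vector_field_on M U (X i) \<and> one_form_on M U (\<alpha> i)"
    and LU: "\<forall>q\<in>U. L q = {(\<lambda>f. \<Sum>i<k. c i * X i q f, \<lambda>v. \<Sum>i<k. c i * \<alpha> i q v) | c :: nat \<Rightarrow> real. True} \<and>
          (\<forall>c :: nat \<Rightarrow> real.
             (\<forall>f. (\<Sum>i<k. c i * X i q f) = 0) \<and> (\<forall>v. (\<Sum>i<k. c i * \<alpha> i q v) = 0)
             \<longrightarrow> (\<forall>i<k. c i = 0))"
    using bspec[OF k p] by (elim exE conjE)
  have LU: "L q = {(\<lambda>f. \<Sum>i<k. c i * X i q f, \<lambda>v. \<Sum>i<k. c i * \<alpha> i q v) | c :: nat \<Rightarrow> real. True}"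
    if "q \<in> U" for q
    using bspec[OF LU that] by (rule conjunct1)
  obtain c where c: "w = (\<lambda>f. \<Sum>i<k. c i * X i p f)"
    using L unfolding LU[OF U(2)] by blast
  obtain \<rho> where \<rho>: "\<rho> \<in> smooth_functions M" "near p (\<lambda>q. \<rho> q = 1)" "\<And>q. q \<notin> U \<Longrightarrow> \<rho> q = 0"
    "\<And>q. q \<in> points M - U \<Longrightarrow> near q (\<lambda>q. \<rho> q = 0)"
    using bump_exists[OF U] by blast
  define A where "A = (\<lambda>q f. \<Sum>i<k. c i * (\<rho> q * X i q f))"
  define \<gamma> where "\<gamma> = (\<lambda>q v. \<Sum>i<k. c i * (\<rho> q * \<alpha> i q v))"
  show ?thesis
  proof (rule that)
    have "A \<in> vector_fields M"
      unfolding A_def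
      by (rule vector_field_sum[OF smooth_const vector_field_cutoff[OF U(1) _ \<rho>(1,3,4)]])
        (use X in auto)
    moreover have "\<gamma> \<in> one_forms M"
      unfolding \<gamma>_def
      by (rule one_form_sum[OF one_form_cutoff[OF U(1) _ \<rho>(1,3,4)]]) (use X in auto)
    moreover have "(A q, \<gamma> q) \<in> L q" if q: "q \<in> points M" for q
    proof (cases "q \<in> U")
      case True
      have "A q = (\<lambda>f. \<Sum>i<k. (c i * \<rho> q) * X i q f)" "\<gamma> q = (\<lambda>v. \<Sum>i<k. (c i * \<rho> q) * \<alpha> i q v)"
        by (simp_all add: A_def \<gamma>_def mult.assoc)
      then show ?thesis
        unfolding LU[OF True] by (intro CollectI exI[of _ "\<lambda>i. c i * \<rho> q"]) simp
    next
      case False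
      then show ?thesis
        using L_zero[OF q] by (simp add: A_def \<gamma>_def \<rho>(3))
    qed
    ultimately show "(A, \<gamma>) \<in> sections M L"
      by (simp add: sections_def)
    show "A p = w"
      using near_imp[OF \<rho>(2) p] by (simp add: A_def c)
  qed
qed

text \<open>Written out by the invariant formulas, the pairing matches the six terms of the exterior
  derivative of the presymplectic form on a leaf.\<close>

lemma courant_dorfman_pairing:
  assumes A: "(A, \<alpha>) \<in> sections M L" and B: "(B, \<beta>) \<in> sections M L" and C: "(C, \<gamma>) \<in> sections M L"
    and p: "p \<in> points M"
  shows "A p (\<lambda>q. \<beta> q (C q)) - B p (\<lambda>q. \<alpha> q (C q)) + C p (\<lambda>q. \<alpha> q (B q))
    + \<gamma> p (lie_bracket M A B p) - \<beta> p (lie_bracket M A C p) + \<alpha> p (lie_bracket M B C p) = 0"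
proof -
  have "courant_dorfman M (A, \<alpha>) (B, \<beta>) \<in> sections M L"
    using dirac A B unfolding dirac_structure_def by blast
  then have "(lie_bracket M A B p, \<lambda>v. lie_derivative M A \<beta> p v - contract_d_one_form M B \<alpha> p v) \<in> L p"
    unfolding courant_dorfman.simps by (rule sectionD(3)[OF _ p])
  then have "\<gamma> p (lie_bracket M A B p)
      + (lie_derivative M A \<beta> p (C p) - contract_d_one_form M B \<alpha> p (C p)) = 0"
    by (rule L_isotropic[OF p _ sectionD(3)[OF C p]])
  then show ?thesis
    using lie_derivative_eq[OF sectionD(1)[OF A] sectionD(2)[OF B] sectionD(1)[OF C] p]
      contract_d_one_form_eq[OF sectionD(1)[OF B] sectionD(2)[OF A] sectionD(1)[OF C] p]
    by (simp add: d_one_form_def)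
qed

end

section \<open>Dirac structures compatible with a tensor field\<close>

locale compatible_dirac_mfd = dirac_mfd M L for M :: "'a manifold" and L +
  fixes r :: "'a \<Rightarrow> 'a tvec \<Rightarrow> 'a tvec"
  assumes tensor: "r \<in> tensors11 M" and compatible: "compatible_TM M L r"
begin

lemma L_tensor: "p \<in> points M \<Longrightarrow> (v, \<xi>) \<in> L p \<Longrightarrow> (r p v, dual_map M r p \<xi>) \<in> L p"
  using compatible by (force simp: compatible_TM_def)

lemma section_tensor:
  assumes A: "(A, \<alpha>) \<in> sections M L"
  shows "(apply_tensor r A, dual_form M r \<alpha>) \<in> sections M L"
  using tensors11_vector_field[OF tensor sectionD(1)[OF A]]
    dual_form_one_form[OF tensor sectionD(2)[OF A]] L_tensor[OF _ sectionD(3)[OF A]]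
  by (simp add: sections_def apply_tensor_def dual_form_def)

lemma dual_form_apply:
  "p \<in> points M \<Longrightarrow> v \<in> tangent_space M p \<Longrightarrow> dual_form M r \<alpha> p v = \<alpha> p (r p v)"
  by (simp add: dual_form_def dual_map_def)

lemma derivative_dual_form:
  assumes v: "v \<in> tangent_space M p" and p: "p \<in> points M"
    and \<alpha>: "\<alpha> \<in> one_forms M" and C: "C \<in> vector_fields M"
  shows "v (\<lambda>q. dual_form M r \<alpha> q (C q)) = v (\<lambda>q. \<alpha> q (apply_tensor r C q))"
  by (rule tangent_cong[OF v p one_form_smooth[OF dual_form_one_form[OF tensor \<alpha>] C]])
    (simp add: dual_form_apply vector_field_tangent[OF C] apply_tensor_def)

text \<open>\<open>A\<close> may be any vector field; only the other two arguments come from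
  sections. The brackets in \<open>D_vec\<close> start with \<open>B\<close>; antisymmetry reverses
  them, so that the terms compare directly with those of \<open>d_two_form\<close>.\<close>

lemma D_pairing:
  assumes A: "A \<in> vector_fields M" and B: "(B, \<beta>) \<in> sections M L" and C: "(C, \<gamma>) \<in> sections M L"
    and p: "p \<in> points M"
  shows "A p (\<lambda>q. \<beta> q (apply_tensor r C q)) - \<beta> p (r p (lie_bracket M A C p))
    - apply_tensor r A p (\<lambda>q. \<beta> q (C q)) + \<beta> p (lie_bracket M (apply_tensor r A) C p)
    - \<gamma> p (lie_bracket M (apply_tensor r A) B p) + \<gamma> p (r p (lie_bracket M A B p)) = 0"
proof -
  note B' = sectionD[OF B] and C' = sectionD[OF C]
  note rA = tensors11_vector_field[OF tensor A]
  note br = vector_field_tangent[OF lie_bracket_vector_field p]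
  note \<gamma> = one_form_linear[OF C'(2) p]
  have D: "(D_vec M r A B, D_form M r A \<beta>) \<in> sections M L"
    using compatible A B by (force simp: compatible_TM_def)
  have "\<gamma> p (D_vec M r A B p) + D_form M r A \<beta> p (C p) = 0"
    by (rule L_isotropic[OF p sectionD(3)[OF D p] sectionD(3)[OF C p]])
  moreover have "D_form M r A \<beta> p (C p)
      = A p (\<lambda>q. \<beta> q (apply_tensor r C q)) - \<beta> p (r p (lie_bracket M A C p))
        - apply_tensor r A p (\<lambda>q. \<beta> q (C q)) + \<beta> p (lie_bracket M (apply_tensor r A) C p)"
    using lie_derivative_eq[OF A dual_form_one_form[OF tensor B'(2)] C'(1) p]
      lie_derivative_eq[OF rA B'(2) C'(1) p] dual_form_apply[OF p br[OF A C'(1)], of \<beta>]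
      derivative_dual_form[OF vector_field_tangent[OF A p] p B'(2) C'(1)]
    by (simp add: D_form_def)
  moreover have "\<gamma> p (D_vec M r A B p)
      = \<gamma> p (lie_bracket M B (apply_tensor r A) p) - \<gamma> p (r p (lie_bracket M B A p))"
    unfolding D_vec_def
    by (rule linear_on_tangent_minus[OF \<gamma> br[OF B'(1) rA] tensors11_tangent[OF tensor p br[OF B'(1) A]]])
  moreover have "\<gamma> p (lie_bracket M B (apply_tensor r A) p) = - \<gamma> p (lie_bracket M (apply_tensor r A) B p)"
    unfolding lie_bracket_antisym[of B "apply_tensor r A"]
    by (rule linear_on_tangent_uminus[OF \<gamma> br[OF rA B'(1)]])
  moreover have "\<gamma> p (r p (lie_bracket M B A p)) = - \<gamma> p (r p (lie_bracket M A B p))"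
  proof -
    have "r p (lie_bracket M B A p) = (\<lambda>f. - r p (lie_bracket M A B p) f)"
      using tensors11_comb[OF tensor p br[OF A B'(1)] br[OF A B'(1)], of "- 1" 0]
      by (simp add: lie_bracket_antisym[of B A])
    then show ?thesis
      using linear_on_tangent_uminus[OF \<gamma> tensors11_tangent[OF tensor p br[OF A B'(1)]]] by simp
  qed
  ultimately show ?thesis
    by simp
qed

end

section \<open>Leaves of compatible Dirac structures\<close>

locale dirac_leaf = immersed_mfd M N + D: compatible_dirac_mfd M L r
  for M N :: "'a manifold" and L and r +
  assumes tangent_leaf: "\<And>p. p \<in> points N \<Longrightarrow> push N M ` tangent_space N p = fst ` L p"
begin

abbreviation \<omega> where "\<omega> \<equiv> presymplectic_form M L N"
abbreviation rN where "rN \<equiv> restrict_tensor M N r"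

lemma leaf_covector:
  assumes p: "p \<in> points N" and v: "v \<in> tangent_space N p"
  obtains \<xi> where "(push N M v, \<xi>) \<in> L p"
proof -
  have "push N M v \<in> fst ` L p"
    using tangent_leaf[OF p] v by blast
  then show ?thesis
    using that by auto
qed

lemma leaf_tangent:
  assumes p: "p \<in> points N" and L: "(w, \<xi>) \<in> L p"
  shows "inv_into (tangent_space N p) (push N M) w \<in> tangent_space N p"
    and "push N M (inv_into (tangent_space N p) (push N M) w) = w"
proof -
  have "w \<in> push N M ` tangent_space N p"
    unfolding tangent_leaf[OF p] using L by force
  then show "inv_into (tangent_space N p) (push N M) w \<in> tangent_space N p"
    "push N M (inv_into (tangent_space N p) (push N M) w) = w"
    by (rule inv_into_into, rule f_inv_into_f)
qed

section \<open>The presymplectic form as a smooth two-form on the leaf\<close>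

lemma presymplectic_eq:
  assumes p: "p \<in> points N" and L: "(push N M v, \<xi>) \<in> L p" and w: "w \<in> tangent_space N p"
  shows "\<omega> p v w = \<xi> (push N M w)"
proof -
  define \<xi>' where "\<xi>' = (SOME \<xi>. (push N M v, \<xi>) \<in> L p)"
  have \<xi>': "(push N M v, \<xi>') \<in> L p"
    unfolding \<xi>'_def by (rule someI[of "\<lambda>\<xi>. (push N M v, \<xi>) \<in> L p", OF L])
  obtain \<eta> where \<eta>: "(push N M w, \<eta>) \<in> L p"
    using leaf_covector[OF p w] .
  have "\<xi>' (push N M w) = \<xi> (push N M w)"
    using D.L_isotropic[OF points_M[OF p] L \<eta>] D.L_isotropic[OF points_M[OF p] \<xi>' \<eta>] by simp
  then show ?thesis
    by (simp add: presymplectic_form_def \<xi>'_def)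
qed

lemma presymplectic_antisym:
  assumes p: "p \<in> points N" and v: "v \<in> tangent_space N p" and w: "w \<in> tangent_space N p"
  shows "\<omega> p w v = - \<omega> p v w"
proof -
  obtain \<xi> \<eta> where *: "(push N M v, \<xi>) \<in> L p" "(push N M w, \<eta>) \<in> L p"
    using leaf_covector[OF p v] leaf_covector[OF p w] by metis
  show ?thesis
    using D.L_isotropic[OF points_M[OF p] *] presymplectic_eq[OF p *(1) w] presymplectic_eq[OF p *(2) v]
    by simp
qed

lemma presymplectic_linear:
  assumes p: "p \<in> points N" and v: "v \<in> tangent_space N p"
  shows "linear_on_tangent N p (\<omega> p v)" and "linear_on_tangent N p (\<lambda>w. \<omega> p w v)"
proof -
  obtain \<xi> where \<xi>: "(push N M v, \<xi>) \<in> L p"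
    using leaf_covector[OF p v] .
  have lin: "linear_on_tangent N p (\<lambda>w. \<xi> (push N M w))"
    by (rule linear_on_tangent_push[OF D.L_linear[OF points_M[OF p] \<xi>]])
  have "\<omega> p v w = \<xi> (push N M w)" "\<omega> p w v = - \<xi> (push N M w)" if "w \<in> tangent_space N p" for w
    using presymplectic_eq[OF p \<xi> that] presymplectic_antisym[OF p v that] by simp_all
  then show "linear_on_tangent N p (\<omega> p v)" "linear_on_tangent N p (\<lambda>w. \<omega> p w v)"
    using lin unfolding linear_on_tangent_def by (simp_all add: N.tangent_comb)
qed

text \<open>The vector part of a section is tangent to the leaf, so it lifts pointwise. On functions
  that come from \<open>M\<close> the lift acts as \<open>A\<close> does, and this settles its
  smoothness by \<open>vector_field_restrictI\<close>.\<close>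

lemma section_related:
  assumes A: "(A, \<alpha>) \<in> sections M L"
  obtains X where "related X A"
proof -
  define X where "X = (\<lambda>q. inv_into (tangent_space N q) (push N M) (A q))"
  have X: "X q \<in> tangent_space N q" "push N M (X q) = A q" if q: "q \<in> points N" for q
    unfolding X_def using leaf_tangent[OF q D.sectionD(3)[OF A points_M[OF q]]] by auto
  have "X \<in> vector_fields N"
  proof (rule vector_field_restrictI[OF X(1)])
    fix F assume F: "F \<in> smooth_functions M"
    show "(\<lambda>q. X q F) \<in> smooth_functions N"
    proof (rule N.smooth_cong[OF smooth_restrict[OF M.vector_field_smooth[OF D.sectionD(1)[OF A] F]]])
      show "A q F = X q F" if "q \<in> points N" for q
        using fun_cong[OF X(2)[OF that], of F] by (simp add: push_apply[OF F])
    qed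
  qed
  then have "related X A"
    using X(2) D.sectionD(1)[OF A] by (simp add: related_def)
  then show ?thesis
    by (rule that)
qed

lemma section_through:
  assumes p: "p \<in> points N" and v: "v \<in> tangent_space N p"
  obtains A \<alpha> X where "(A, \<alpha>) \<in> sections M L" "related X A" "X p = v"
proof -
  obtain \<xi> where \<xi>: "(push N M v, \<xi>) \<in> L p"
    using leaf_covector[OF p v] .
  obtain A \<alpha> where A: "(A, \<alpha>) \<in> sections M L" "A p = push N M v"
    using D.section_exists[OF points_M[OF p] \<xi>] .
  obtain X where X: "related X A"
    using section_related[OF A(1)] .
  have "push N M (X p) = push N M v"
    using relatedD(3)[OF X p] A(2) by simp
  then have "X p = v"
    by (rule push_eqD[OF _ p N.vector_field_tangent[OF relatedD(1)[OF X] p] v])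
  then show ?thesis
    by (rule that[OF A(1) X])
qed

lemma presymplectic_section:
  assumes A: "(A, \<alpha>) \<in> sections M L" and X: "related X A" and p: "p \<in> points N"
    and w: "w \<in> tangent_space N p"
  shows "\<omega> p (X p) w = \<alpha> p (push N M w)"
  by (rule presymplectic_eq[OF p _ w]) (simp add: relatedD(3)[OF X p] D.sectionD(3)[OF A points_M[OF p]])

text \<open>The pushed field lives only along \<open>N\<close>, so the smoothness of \<beta> on
  fields of \<open>M\<close> does not apply to it directly. In a frame of \<open>M\<close> its
  coefficients \<open>Y q (y j)\<close> are smooth on \<open>N\<close>. Any fibrewise linear \<beta>
  is allowed, which covers both one-forms and the components of \<open>r\<close>.\<close>

lemma smooth_push:
  assumes lin: "\<And>q. q \<in> points M \<Longrightarrow> linear_on_tangent M q (\<beta> q)"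
    and sm: "\<And>Z. Z \<in> vector_fields M \<Longrightarrow> (\<lambda>q. \<beta> q (Z q)) \<in> smooth_functions M"
    and Y: "Y \<in> vector_fields N"
  shows "(\<lambda>q. \<beta> q (push N M (Y q))) \<in> smooth_functions N"
proof (rule N.smooth_if_smooth_near)
  fix p assume p: "p \<in> points N"
  obtain y E where frame: "M.frame_at p y E"
    using M.frame_exists[OF points_M[OF p]] .
  let ?n = "mdim M"
  show "N.smooth_near p (\<lambda>q. \<beta> q (push N M (Y q)))"
  proof (rule N.smooth_near_cong)
    show "N.near p (\<lambda>q. \<beta> q (push N M (Y q)) = (\<Sum>j<?n. Y q (y j) * \<beta> q (E j q)))"
      using near_restrict[OF M.frame_atD(3)[OF frame] p] N.near_points[OF p]
    proof eventually_elim
      case (elim q)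
      have E: "E j q \<in> tangent_space M q" if "j \<in> {..<?n}" for j
        using M.vector_field_tangent[OF M.frame_atD(2)[OF frame] points_M[OF elim(2)]] that by simp
      have "push N M (Y q) = (\<lambda>f. \<Sum>j<?n. push N M (Y q) (y j) * E j q f)"
        using bspec[OF elim(1) push_tangent[OF N.vector_field_tangent[OF Y elim(2)]]] .
      also have "\<dots> = (\<lambda>f. \<Sum>j<?n. Y q (y j) * E j q f)"
        by (simp add: push_apply M.frame_atD(1)[OF frame])
      finally have *: "push N M (Y q) = (\<lambda>f. \<Sum>j<?n. Y q (y j) * E j q f)" .
      show ?case
        unfolding * by (rule M.linear_on_tangent_sum[OF lin[OF points_M[OF elim(2)]] E])
    qed
    show "N.smooth_near p (\<lambda>q. \<Sum>j<?n. Y q (y j) * \<beta> q (E j q))"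
    proof (rule N.smooth_near_smooth[OF N.smooth_sum], rule N.smooth_mult)
      fix j assume "j \<in> {..<?n}"
      then have j: "j < ?n"
        by simp
      show "(\<lambda>q. Y q (y j)) \<in> smooth_functions N"
        by (rule N.vector_field_smooth[OF Y smooth_restrict[OF M.frame_atD(1)[OF frame j]]])
      show "(\<lambda>q. \<beta> q (E j q)) \<in> smooth_functions N"
        by (rule smooth_restrict[OF sm[OF M.frame_atD(2)[OF frame j]]])
    qed
  qed
qed

text \<open>The form is defined by choosing covectors pointwise. Its values on a frame and
  \<open>Y\<close> nevertheless solve a linear system with one equation for each section: lifting
  the section and pairing with \<open>Y\<close> gives its one-form evaluated on the pushed
  \<open>Y\<close>, which is smooth by \<open>smooth_push\<close>.\<close>

lemma presymplectic_smooth: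
  assumes X: "X \<in> vector_fields N" and Y: "Y \<in> vector_fields N"
  shows "(\<lambda>q. \<omega> q (X q) (Y q)) \<in> smooth_functions N"
proof (rule N.smooth_if_smooth_near)
  fix p assume p: "p \<in> points N"
  let ?n = "mdim N"
  obtain x E where frame: "N.frame_at p x E"
    using N.frame_exists[OF p] .
  have expand: "N.near p (\<lambda>q. \<omega> q (Z q) (Y q) = (\<Sum>j<?n. Z q (x j) * \<omega> q (E j q) (Y q)))"
    if Z: "Z \<in> vector_fields N" for Z
    using N.frame_atD(3)[OF frame] N.near_points[OF p]
  proof eventually_elim
    case (elim q)
    have E: "E j q \<in> tangent_space N q" if "j \<in> {..<?n}" for j
      using N.vector_field_tangent[OF N.frame_atD(2)[OF frame] elim(2)] that by simp
    have "Z q = (\<lambda>f. \<Sum>j<?n. Z q (x j) * E j q f)"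
      using bspec[OF elim(1) N.vector_field_tangent[OF Z elim(2)]] .
    then have "\<omega> q (Z q) (Y q) = \<omega> q (\<lambda>f. \<Sum>j<?n. Z q (x j) * E j q f) (Y q)"
      by (rule arg_cong[where f = "\<lambda>v. \<omega> q v (Y q)"])
    also have "\<dots> = (\<Sum>j<?n. Z q (x j) * \<omega> q (E j q) (Y q))"
      by (rule N.linear_on_tangent_sum[OF presymplectic_linear(2)[OF elim(2)
              N.vector_field_tangent[OF Y elim(2)]] E])
    finally show ?case .
  qed
  \<comment> \<open>An equation remembers the lift, which supplies its coefficients, and the
    one-form, which supplies its right-hand side.\<close>
  define B where "B = {(X, \<alpha>). \<exists>A. (A, \<alpha>) \<in> sections M L \<and> related X A}"
  have "N.smooth_near p (\<lambda>q. \<omega> q (E i q) (Y q))" if i: "i < ?n" for i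
  proof (rule N.smooth_near_solve[OF p, where B = B and m = ?n
        and A = "\<lambda>b j q. fst b q (x j)" and y = "\<lambda>b q. snd b q (push N M (Y q))"])
    fix b assume "b \<in> B"
    then obtain X \<alpha> A where b: "b = (X, \<alpha>)" and A: "(A, \<alpha>) \<in> sections M L" and X: "related X A"
      by (auto simp: B_def)
    note \<alpha> = D.sectionD(2)[OF A]
    show "N.near p (\<lambda>q. (\<Sum>j<?n. fst b q (x j) * \<omega> q (E j q) (Y q)) = snd b q (push N M (Y q)))"
      using expand[OF relatedD(1)[OF X]] N.near_points[OF p]
    proof eventually_elim
      case (elim q)
      then show ?case
        using presymplectic_section[OF A X elim(2) N.vector_field_tangent[OF Y elim(2)]] by (simp add: b)
    qed
    show "N.smooth_near p (\<lambda>q. fst b q (x j))" if "j < ?n" for j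
      unfolding b fst_conv
      by (rule N.smooth_near_smooth[OF N.vector_field_smooth[OF relatedD(1)[OF X] N.frame_atD(1)[OF frame that]]])
    show "N.smooth_near p (\<lambda>q. snd b q (push N M (Y q)))"
      unfolding b snd_conv
      by (rule N.smooth_near_smooth[OF smooth_push[OF M.one_form_linear[OF \<alpha>] M.one_form_smooth[OF \<alpha>] Y]])
  next
    fix c :: "nat \<Rightarrow> real" and j
    assume c: "\<And>b. b \<in> B \<Longrightarrow> (\<Sum>j<?n. fst b p (x j) * c j) = 0" and j: "j < ?n"
    \<comment> \<open>A section whose lift equals \<open>E j p\<close> at \<open>p\<close> isolates
      \<open>c j\<close>, by duality of the frame at \<open>p\<close>.\<close>
    obtain A \<alpha> X where A: "(A, \<alpha>) \<in> sections M L" and X: "related X A" "X p = E j p"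
      using section_through[OF p N.vector_field_tangent[OF N.frame_atD(2)[OF frame j] p]] .
    have "(X, \<alpha>) \<in> B"
      using A X by (auto simp: B_def)
    then have "0 = (\<Sum>i<?n. E j p (x i) * c i)"
      using c[of "(X, \<alpha>)"] X(2) by simp
    also have "\<dots> = (\<Sum>i<?n. if i = j then c i else 0)"
      using N.frame_atD(4)[OF frame _ j] by (intro sum.cong) auto
    also have "\<dots> = c j"
      using j by simp
    finally show "c j = 0"
      by simp
  qed (rule i)
  then have "N.smooth_near p (\<lambda>q. \<Sum>j<?n. X q (x j) * \<omega> q (E j q) (Y q))"
    using N.vector_field_smooth[OF X N.frame_atD(1)[OF frame]]
    by (intro N.smooth_near_sum N.smooth_near_mult) (auto intro: N.smooth_near_smooth)
  then show "N.smooth_near p (\<lambda>q. \<omega> q (X q) (Y q))"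
    by (rule N.smooth_near_cong) (rule expand[OF X])
qed

lemma presymplectic_two_form: "\<omega> \<in> two_forms N"
proof -
  have "\<omega> p v v = 0" if "p \<in> points N" "v \<in> tangent_space N p" for p v
    using presymplectic_antisym[OF that(1) that(2) that(2)] by simp
  then show ?thesis
    using presymplectic_linear presymplectic_smooth by (simp add: two_forms_def)
qed

section \<open>The tensor restricted to the leaf\<close>

lemma restrict_tensor_push:
  assumes p: "p \<in> points N" and v: "v \<in> tangent_space N p"
  shows "rN p v \<in> tangent_space N p" and "push N M (rN p v) = r p (push N M v)"
proof -
  obtain \<xi> where "(push N M v, \<xi>) \<in> L p"
    using leaf_covector[OF p v] .
  then have "(r p (push N M v), dual_map M r p \<xi>) \<in> L p"
    by (rule D.L_tensor[OF points_M[OF p]])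
  then show "rN p v \<in> tangent_space N p" "push N M (rN p v) = r p (push N M v)"
    unfolding restrict_tensor_def by (rule leaf_tangent[OF p])+
qed

lemma leaf_invariant: "leaf_invariant M N r"
  unfolding leaf_invariant_def
proof clarify
  fix p v assume p: "p \<in> points N" and v: "v \<in> tangent_space N p"
  show "r p (push N M v) \<in> push N M ` tangent_space N p"
    using restrict_tensor_push[OF p v] by (metis imageI)
qed

lemma restrict_tensor_tensor: "rN \<in> tensors11 N"
proof -
  have "rN p (\<lambda>f. a * v f + b * w f) = (\<lambda>f. a * rN p v f + b * rN p w f)"
    if p: "p \<in> points N" and v: "v \<in> tangent_space N p" and w: "w \<in> tangent_space N p" for p v w a b
  proof (rule push_eqD[OF _ p])
    show "push N M (rN p (\<lambda>f. a * v f + b * w f)) = push N M (\<lambda>f. a * rN p v f + b * rN p w f)"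
      using restrict_tensor_push(2)[OF p N.tangent_comb[OF v w, of a b]]
        restrict_tensor_push(2)[OF p v] restrict_tensor_push(2)[OF p w]
        M.tensors11_comb[OF D.tensor points_M[OF p] push_tangent[OF v] push_tangent[OF w], of a b]
      by (simp add: push_comb)
    show "rN p (\<lambda>f. a * v f + b * w f) \<in> tangent_space N p"
      by (rule restrict_tensor_push(1)[OF p N.tangent_comb[OF v w]])
    show "(\<lambda>f. a * rN p v f + b * rN p w f) \<in> tangent_space N p"
      by (rule N.tangent_comb[OF restrict_tensor_push(1)[OF p v] restrict_tensor_push(1)[OF p w]])
  qed
  moreover have "(\<lambda>p. rN p (Y p)) \<in> vector_fields N" if Y: "Y \<in> vector_fields N" for Y
  proof (rule vector_field_restrictI)
    fix F assume F: "F \<in> smooth_functions M"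
    have "(\<lambda>q. r q (push N M (Y q)) F) \<in> smooth_functions N"
    \<comment> \<open>For fixed \<open>F\<close>, the \<open>F\<close>-component of \<open>r\<close>
      is a fibrewise linear function, as \<open>smooth_push\<close> requires.\<close>
    proof (rule smooth_push[OF M.tensors11_linear[OF D.tensor] _ Y])
      show "(\<lambda>q. r q (Z q) F) \<in> smooth_functions M" if "Z \<in> vector_fields M" for Z
        using M.vector_field_smooth[OF M.tensors11_vector_field[OF D.tensor that] F]
        by (simp add: apply_tensor_def)
    qed
    then show "(\<lambda>q. rN q (Y q) F) \<in> smooth_functions N"
    proof (rule N.smooth_cong)
      show "r q (push N M (Y q)) F = rN q (Y q) F" if q: "q \<in> points N" for q
        using fun_cong[OF restrict_tensor_push(2)[OF q N.vector_field_tangent[OF Y q]], of F]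
        by (simp add: push_apply[OF F])
    qed
  qed (rule restrict_tensor_push(1)[OF _ N.vector_field_tangent[OF Y]])
  ultimately show ?thesis
    by (simp add: tensors11_def restrict_tensor_push(1))
qed

lemma related_tensor:
  assumes X: "related X A"
  shows "related (apply_tensor rN X) (apply_tensor r A)"
  using N.tensors11_vector_field[OF restrict_tensor_tensor relatedD(1)[OF X]]
    M.tensors11_vector_field[OF D.tensor relatedD(2)[OF X]]
    restrict_tensor_push(2)[OF _ N.vector_field_tangent[OF relatedD(1)[OF X]]] relatedD(3)[OF X]
  by (simp add: related_def apply_tensor_def)

lemma presymplectic_tensor_symmetric:
  assumes p: "p \<in> points N" and v: "v \<in> tangent_space N p" and w: "w \<in> tangent_space N p"
  shows "\<omega> p (rN p v) w = \<omega> p v (rN p w)"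
proof -
  obtain \<xi> where \<xi>: "(push N M v, \<xi>) \<in> L p"
    using leaf_covector[OF p v] .
  then have "(push N M (rN p v), dual_map M r p \<xi>) \<in> L p"
    unfolding restrict_tensor_push(2)[OF p v] by (rule D.L_tensor[OF points_M[OF p]])
  then have "\<omega> p (rN p v) w = dual_map M r p \<xi> (push N M w)"
    by (rule presymplectic_eq[OF p _ w])
  also have "\<dots> = \<xi> (push N M (rN p w))"
    using push_tangent[OF w] restrict_tensor_push(2)[OF p w] by (simp add: dual_map_def)
  also have "\<dots> = \<omega> p v (rN p w)"
    by (rule presymplectic_eq[OF p \<xi> restrict_tensor_push(1)[OF p w], symmetric])
  finally show ?thesis .
qed

abbreviation \<omega>r where "\<omega>r \<equiv> \<lambda>q v w. \<omega> q (rN q v) w"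

lemma presymplectic_tensor_two_form: "\<omega>r \<in> two_forms N"
proof -
  have "linear_on_tangent N p (\<lambda>w. \<omega> p (rN p w) v)" if p: "p \<in> points N" and v: "v \<in> tangent_space N p" for p v
    using presymplectic_linear(2)[OF p v] restrict_tensor_push(1)[OF p]
      N.tensors11_comb[OF restrict_tensor_tensor p]
    unfolding linear_on_tangent_def by simp
  \<comment> \<open>Symmetry with respect to \<open>rN\<close> moves it to the second slot,
    antisymmetry of \<omega> gives the opposite sign, so the value equals its own negative.\<close>
  moreover have "\<omega> p (rN p v) v = 0" if p: "p \<in> points N" and v: "v \<in> tangent_space N p" for p v
    using presymplectic_tensor_symmetric[OF p v v] presymplectic_antisym[OF p v restrict_tensor_push(1)[OF p v]]
    by simp
  moreover have "(\<lambda>q. \<omega> q (rN q (X q)) (Y q)) \<in> smooth_functions N"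
    if X: "X \<in> vector_fields N" and Y: "Y \<in> vector_fields N" for X Y
    using presymplectic_smooth[OF N.tensors11_vector_field[OF restrict_tensor_tensor X] Y]
    by (simp add: apply_tensor_def)
  ultimately show ?thesis
    using presymplectic_linear(1)[OF _ restrict_tensor_push(1)] by (simp add: two_forms_def)
qed

section \<open>Exterior derivatives on the leaf computed from sections\<close>

lemma presymplectic_derivative:
  assumes X: "related X A" and Y: "related Y B" and B: "(B, \<beta>) \<in> sections M L" and Z: "related Z C"
    and p: "p \<in> points N"
  shows "X p (\<lambda>q. \<omega> q (Y q) (Z q)) = A p (\<lambda>q. \<beta> q (C q))"
proof (rule related_derivative[OF X p M.one_form_smooth[OF D.sectionD(2)[OF B] relatedD(2)[OF Z]]])
  fix q assume q: "q \<in> points N"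
  show "\<beta> q (C q) = \<omega> q (Y q) (Z q)"
    using presymplectic_section[OF B Y q N.vector_field_tangent[OF relatedD(1)[OF Z] q]]
    by (simp add: relatedD(3)[OF Z q])
qed

text \<open>Symmetry moves the tensor onto \<open>Z\<close>, so \<beta> is paired with
  \<open>apply_tensor r C\<close>; this is the form in which the term occurs in
  \<open>D_pairing\<close>.\<close>

lemma presymplectic_tensor_derivative:
  assumes X: "related X A" and Y: "related Y B" and B: "(B, \<beta>) \<in> sections M L" and Z: "related Z C"
    and p: "p \<in> points N"
  shows "X p (\<lambda>q. \<omega>r q (Y q) (Z q)) = A p (\<lambda>q. \<beta> q (apply_tensor r C q))"
proof (rule related_derivative[OF X p
      M.one_form_smooth[OF D.sectionD(2)[OF B] relatedD(2)[OF related_tensor[OF Z]]]])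
  fix q assume q: "q \<in> points N"
  note Yq = N.vector_field_tangent[OF relatedD(1)[OF Y] q]
    and Zq = N.vector_field_tangent[OF relatedD(1)[OF Z] q]
  show "\<beta> q (apply_tensor r C q) = \<omega>r q (Y q) (Z q)"
    using presymplectic_section[OF B Y q restrict_tensor_push(1)[OF q Zq]]
      presymplectic_tensor_symmetric[OF q Yq Zq]
    by (simp add: restrict_tensor_push(2)[OF q Zq] relatedD(3)[OF Z q] apply_tensor_def)
qed

text \<open>Meant for \<open>W\<close> a bracket, or its image under \<open>rN\<close>. Reading the
  form through the known covector \<gamma> of the second argument avoids finding one for
  \<open>W\<close>; the sign is antisymmetry.\<close>

lemma presymplectic_related:
  assumes W: "related W H" and Z: "related Z C" and C: "(C, \<gamma>) \<in> sections M L" and p: "p \<in> points N"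
  shows "\<omega> p (W p) (Z p) = - \<gamma> p (H p)"
  using presymplectic_antisym[OF p N.vector_field_tangent[OF relatedD(1)[OF Z] p]
      N.vector_field_tangent[OF relatedD(1)[OF W] p]]
    presymplectic_section[OF C Z p N.vector_field_tangent[OF relatedD(1)[OF W] p]]
  by (simp add: relatedD(3)[OF W p])

context
  fixes A B C \<alpha> \<beta> \<gamma> X Y Z p
  assumes A: "(A, \<alpha>) \<in> sections M L" "related X A" and B: "(B, \<beta>) \<in> sections M L" "related Y B"
    and C: "(C, \<gamma>) \<in> sections M L" "related Z C" and p: "p \<in> points N"
begin

lemma d_presymplectic_sections:
  "d_two_form N \<omega> X Y Z p = A p (\<lambda>q. \<beta> q (C q)) - B p (\<lambda>q. \<alpha> q (C q)) + C p (\<lambda>q. \<alpha> q (B q))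
    + \<gamma> p (lie_bracket M A B p) - \<beta> p (lie_bracket M A C p) + \<alpha> p (lie_bracket M B C p)"
  unfolding d_two_form_def
  using presymplectic_derivative[OF A(2) B(2,1) C(2) p] presymplectic_derivative[OF B(2) A(2,1) C(2) p]
    presymplectic_derivative[OF C(2) A(2,1) B(2) p]
    presymplectic_related[OF related_lie_bracket[OF A(2) B(2)] C(2,1) p]
    presymplectic_related[OF related_lie_bracket[OF A(2) C(2)] B(2,1) p]
    presymplectic_related[OF related_lie_bracket[OF B(2) C(2)] A(2,1) p]
  by simp

lemma d_presymplectic_tensor_sections:
  "d_two_form N \<omega>r X Y Z p = A p (\<lambda>q. \<beta> q (apply_tensor r C q)) - B p (\<lambda>q. \<alpha> q (apply_tensor r C q))
    + C p (\<lambda>q. \<alpha> q (apply_tensor r B q)) + \<gamma> p (r p (lie_bracket M A B p))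
    - \<beta> p (r p (lie_bracket M A C p)) + \<alpha> p (r p (lie_bracket M B C p))"
  unfolding d_two_form_def
  using presymplectic_tensor_derivative[OF A(2) B(2,1) C(2) p]
    presymplectic_tensor_derivative[OF B(2) A(2,1) C(2) p]
    presymplectic_tensor_derivative[OF C(2) A(2,1) B(2) p]
    presymplectic_related[OF related_tensor[OF related_lie_bracket[OF A(2) B(2)]] C(2,1) p]
    presymplectic_related[OF related_tensor[OF related_lie_bracket[OF A(2) C(2)]] B(2,1) p]
    presymplectic_related[OF related_tensor[OF related_lie_bracket[OF B(2) C(2)]] A(2,1) p]
  by (simp add: apply_tensor_def)

lemma presymplectic_closed_sections: "d_two_form N \<omega> X Y Z p = 0"
  unfolding d_presymplectic_sections by (rule D.courant_dorfman_pairing[OF A(1) B(1) C(1) points_M[OF p]])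

end

text \<open>\<open>dual_form M r \<alpha>\<close> is the covector belonging to
  \<open>apply_tensor r A\<close>, so the three terms with \<alpha> agree on both sides. The
  difference of what remains is the left-hand side of \<open>D_pairing\<close>.\<close>

lemma presymplectic_compatible_sections:
  assumes A: "(A, \<alpha>) \<in> sections M L" "related X A" and B: "(B, \<beta>) \<in> sections M L" "related Y B"
    and C: "(C, \<gamma>) \<in> sections M L" "related Z C" and p: "p \<in> points N"
  shows "d_two_form N \<omega>r X Y Z p = d_two_form N \<omega> (apply_tensor rN X) Y Z p"
proof -
  note pM = points_M[OF p]
  note A' = D.sectionD[OF A(1)] and B' = D.sectionD[OF B(1)] and C' = D.sectionD[OF C(1)]
  have "dual_form M r \<alpha> p (lie_bracket M B C p) = \<alpha> p (r p (lie_bracket M B C p))"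
    by (rule D.dual_form_apply[OF pM M.vector_field_tangent[OF M.lie_bracket_vector_field[OF B'(1) C'(1)] pM]])
  then show ?thesis
    unfolding d_presymplectic_tensor_sections[OF A B C p]
      d_presymplectic_sections[OF D.section_tensor[OF A(1)] related_tensor[OF A(2)] B C p]
    using D.D_pairing[OF A'(1) B(1) C(1) pM]
      D.derivative_dual_form[OF M.vector_field_tangent[OF B'(1) pM] pM A'(2) C'(1)]
      D.derivative_dual_form[OF M.vector_field_tangent[OF C'(1) pM] pM A'(2) B'(1)]
    by simp
qed

lemma presymplectic_compatible: "compatible_form N \<omega> rN"
  unfolding compatible_form_def
proof (intro conjI ballI)
  fix X Y Z p assume X: "X \<in> vector_fields N" and Y: "Y \<in> vector_fields N"
    and Z: "Z \<in> vector_fields N" and p: "p \<in> points N"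
  obtain A \<alpha> X' where A: "(A, \<alpha>) \<in> sections M L" "related X' A" "X' p = X p"
    using section_through[OF p N.vector_field_tangent[OF X p]] .
  obtain B \<beta> Y' where B: "(B, \<beta>) \<in> sections M L" "related Y' B" "Y' p = Y p"
    using section_through[OF p N.vector_field_tangent[OF Y p]] .
  obtain C \<gamma> Z' where C: "(C, \<gamma>) \<in> sections M L" "related Z' C" "Z' p = Z p"
    using section_through[OF p N.vector_field_tangent[OF Z p]] .
  note X' = relatedD(1)[OF A(2)] and Y' = relatedD(1)[OF B(2)] and Z' = relatedD(1)[OF C(2)]
  note rV = N.tensors11_vector_field[OF restrict_tensor_tensor]
  have "d_two_form N \<omega>r X Y Z p = d_two_form N \<omega>r X' Y' Z' p"
    by (rule N.d_two_form_pointwise[OF presymplectic_tensor_two_form p X X' A(3)[symmetric]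
          Y Y' B(3)[symmetric] Z Z' C(3)[symmetric]])
  also have "\<dots> = d_two_form N \<omega> (apply_tensor rN X') Y' Z' p"
    by (rule presymplectic_compatible_sections[OF A(1,2) B(1,2) C(1,2) p])
  also have "\<dots> = d_two_form N \<omega> (apply_tensor rN X) Y Z p"
    by (rule N.d_two_form_pointwise[OF presymplectic_two_form p rV[OF X'] rV[OF X] _ Y' Y B(3) Z' Z C(3)])
      (simp add: apply_tensor_def A(3))
  finally show "d_two_form N \<omega>r X Y Z p = d_two_form N \<omega> (apply_tensor rN X) Y Z p" .
qed (rule presymplectic_two_form restrict_tensor_tensor presymplectic_tensor_symmetric; assumption)+

lemma presymplectic_closed: "closed_two_form N \<omega>"
  unfolding closed_two_form_def
proof (intro ballI)
  fix X Y Z p assume X: "X \<in> vector_fields N" and Y: "Y \<in> vector_fields N"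
    and Z: "Z \<in> vector_fields N" and p: "p \<in> points N"
  obtain A \<alpha> X' where A: "(A, \<alpha>) \<in> sections M L" "related X' A" "X' p = X p"
    using section_through[OF p N.vector_field_tangent[OF X p]] .
  obtain B \<beta> Y' where B: "(B, \<beta>) \<in> sections M L" "related Y' B" "Y' p = Y p"
    using section_through[OF p N.vector_field_tangent[OF Y p]] .
  obtain C \<gamma> Z' where C: "(C, \<gamma>) \<in> sections M L" "related Z' C" "Z' p = Z p"
    using section_through[OF p N.vector_field_tangent[OF Z p]] .
  have "d_two_form N \<omega> X Y Z p = d_two_form N \<omega> X' Y' Z' p"
    by (rule N.d_two_form_pointwise[OF presymplectic_two_form p
          X relatedD(1)[OF A(2)] A(3)[symmetric] Y relatedD(1)[OF B(2)] B(3)[symmetric]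
          Z relatedD(1)[OF C(2)] C(3)[symmetric]])
  also have "\<dots> = 0"
    by (rule presymplectic_closed_sections[OF A(1,2) B(1,2) C(1,2) p])
  finally show "d_two_form N \<omega> X Y Z p = 0" .
qed

section \<open>The Nijenhuis condition on the leaf\<close>

lemma related_torsion:
  assumes X: "related X A" and Y: "related Y B" and p: "p \<in> points N"
  shows "push N M (N.torsion rN X Y p) = M.torsion r A B p"
proof
  fix F
  show "push N M (N.torsion rN X Y p) F = M.torsion r A B p F"
  proof (cases "F \<in> smooth_functions M")
    case True
    note rX = related_tensor[OF X] and rY = related_tensor[OF Y]
    \<comment> \<open>Relatedness survives both the bracket and the tensor, so each summand of the
      torsion has its counterpart on \<open>M\<close>.\<close>
    have rel: "W p F = H p F" "rN p (W p) F = r p (H p) F" "rN p (rN p (W p)) F = r p (r p (H p)) F"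
      if W: "related W H" for W H
      using related_apply[OF W p True] related_apply[OF related_tensor[OF W] p True]
        related_apply[OF related_tensor[OF related_tensor[OF W]] p True]
      by (simp_all add: apply_tensor_def)
    show ?thesis
      unfolding push_apply[OF True] N.torsion_def[OF restrict_tensor_tensor] M.torsion_def[OF D.tensor]
      using rel(1)[OF related_lie_bracket[OF rX rY]] rel(2)[OF related_lie_bracket[OF rX Y]]
        rel(2)[OF related_lie_bracket[OF X rY]] rel(3)[OF related_lie_bracket[OF X Y]]
      by simp
  next
    case False
    note A = relatedD(2)[OF X] and B = relatedD(2)[OF Y]
    show ?thesis
      using M.tangent_outside[OF M.tangent_torsion[OF D.tensor A B points_M[OF p]] False]
      by (simp add: push_outside[OF False])
  qed
qed

text \<open>The hypothesis on \<open>M\<close> reaches only lifts of fields of \<open>M\<close>.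
  Sections supply such lifts with prescribed values at \<open>p\<close>, and the pointwise nature of
  the torsion covers all other fields on the leaf.\<close>

lemma restrict_tensor_nijenhuis:
  assumes "nijenhuis M r"
  shows "nijenhuis N rN"
  unfolding N.nijenhuis_iff_torsion[OF restrict_tensor_tensor]
proof (intro ballI allI)
  fix X Y p f assume X: "X \<in> vector_fields N" and Y: "Y \<in> vector_fields N" and p: "p \<in> points N"
  obtain A \<alpha> X' where A: "(A, \<alpha>) \<in> sections M L" "related X' A" "X' p = X p"
    using section_through[OF p N.vector_field_tangent[OF X p]] .
  obtain B \<beta> Y' where B: "(B, \<beta>) \<in> sections M L" "related Y' B" "Y' p = Y p"
    using section_through[OF p N.vector_field_tangent[OF Y p]] .
  note X' = relatedD(1)[OF A(2)] and Y' = relatedD(1)[OF B(2)]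
  have "M.torsion r A B p = (\<lambda>f. 0)"
    using assms relatedD(2)[OF A(2)] relatedD(2)[OF B(2)] points_M[OF p]
    unfolding M.nijenhuis_iff_torsion[OF D.tensor] by blast
  then have "push N M (N.torsion rN X' Y' p) = push N M (\<lambda>f. 0)"
    unfolding related_torsion[OF A(2) B(2) p] by (simp add: push_def differential_def)
  then have "N.torsion rN X' Y' p = (\<lambda>f. 0)"
    by (rule push_eqD[OF _ p N.tangent_torsion[OF restrict_tensor_tensor X' Y' p] N.tangent_zero])
  then show "N.torsion rN X Y p f = 0"
    using N.torsion_pointwise[OF restrict_tensor_tensor p X X' A(3)[symmetric] Y Y' B(3)[symmetric], of f]
    by simp
qed

end

lemma dirac_leafI:
  assumes "smooth_manifold M" "dirac_structure M L" "r \<in> tensors11 M" "compatible_TM M L r" "leaf M L N"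
  shows "dirac_leaf M N L r"
proof -
  have N: "immersed_submanifold M N" "\<And>p. p \<in> points N \<Longrightarrow> push N M ` tangent_space N p = fst ` L p"
    using assms(5) by (auto simp: leaf_def integral_manifold_def)
  then have "smooth_manifold N"
    by (simp add: immersed_submanifold_def)
  with N assms show ?thesis
    by unfold_locales
qed

theorem corollary4p3:
  fixes M :: "'a manifold" and L :: "'a subset_TM" and r :: "'a \<Rightarrow> 'a tvec \<Rightarrow> 'a tvec"
  assumes "smooth_manifold M"
    and "dirac_structure M L"
    and "r \<in> tensors11 M"
    and "compatible_TM M L r"
  shows "(\<forall>N. leaf M L N \<longrightarrow>
            leaf_invariant M N r \<and>
            compatible_form N (presymplectic_form M L N) (restrict_tensor M N r)) \<and>
         (dirac_nijenhuis M L r \<longrightarrow>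
            (\<forall>N. leaf M L N \<longrightarrow>
               presymplectic_nijenhuis N (presymplectic_form M L N) (restrict_tensor M N r)))"
proof (intro conjI allI impI)
  fix N assume "leaf M L N"
  then interpret dirac_leaf M N L r
    by (rule dirac_leafI[OF assms])
  show "leaf_invariant M N r" "compatible_form N (presymplectic_form M L N) (restrict_tensor M N r)"
    by (rule leaf_invariant presymplectic_compatible)+
  show "presymplectic_nijenhuis N (presymplectic_form M L N) (restrict_tensor M N r)"
    if "dirac_nijenhuis M L r"
    using that N.smooth_manifold presymplectic_compatible presymplectic_closed restrict_tensor_nijenhuis
    by (simp add: presymplectic_nijenhuis_def dirac_nijenhuis_def)
qed

end
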